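(* Let $\mathbf{A}\in\mathbb{R}^{p\times n}$, $\mathbf{B}\in\mathbb{R}^{p\times m}$, $\mathbf{b}\in\mathbb{R}^p$, and $\rho>0$. Let $D_1\subseteq\mathbb{R}^n$ and $D_2\subseteq\mathbb{R}^m$ be nonempty open convex sets, and for $j=1,2$ let $f_j,h_j:D_j\to\mathbb{R}$ be twice continuously differentiable, with $h_j$ strongly convex on $D_j$ and $f_j$ being $L_j$-relatively smooth with respect to $h_j$ for some $L_j>0$. Let $0<\eta<\min_{j=1,2} 1/L_j$. Assume that there is an open set $\Omega\subseteq D_1\times D_2\times\mathbb{R}^p$ such that the one-iteration map $g$ of Bregman ADMM (defined in the context) is well defined on $\Omega$ and $g(\Omega)\subseteq\Omega$. Let the initial state $(\mathbf{x}^0,\mathbf{y}^0,\boldsymbol{\lambda}^0)$ be drawn from a probability distribution on $\Omega$ that is absolutely continuous with respect to Lebesgue measure, and let $(\mathbf{x}^k,\mathbf{y}^k,\boldsymbol{\lambda}^k)=g(\mathbf{x}^{k-1},\mathbf{y}^{k-1},\boldsymbol{\lambda}^{k-1})$ for $k\ge 1$. Then the probability that the sequence $(\mathbf{x}^k,\mathbf{y}^k,\boldsymbol{\lambda}^k)$ converges to a strict-saddle KKT point $(\mathbf{x}^\star,\mathbf{y}^\star,\boldsymbol{\lambda}^\star)\in\Omega$ of the problem of minimizing $f_1(\mathbf{x})+f_2(\mathbf{y})$ subject to $\mathbf{A}\mathbf{x}+\mathbf{B}\mathbf{y}=\mathbf{b}$ is zero.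
   Context: Relative smoothness (two-sided): a $\mathcal{C}^2$ function $f$ is $L$-relatively smooth with respect to a $\mathcal{C}^2$ strongly convex function $h$ if both $L\nabla^2 h(\mathbf{x})+\nabla^2 f(\mathbf{x})\succeq 0$ and $L\nabla^2 h(\mathbf{x})-\nabla^2 f(\mathbf{x})\succeq 0$ for all $\mathbf{x}$ in the domain. Bregman divergence: $D_h(\mathbf{x},\mathbf{y})=h(\mathbf{x})-h(\mathbf{y})-\langle\nabla h(\mathbf{y}),\mathbf{x}-\mathbf{y}\rangle$. Augmented Lagrangian: $\mathcal{L}(\mathbf{x},\mathbf{y},\boldsymbol{\lambda})=f_1(\mathbf{x})+f_2(\mathbf{y})+\langle\boldsymbol{\lambda},\mathbf{A}\mathbf{x}+\mathbf{B}\mathbf{y}-\mathbf{b}\rangle+\frac{\rho}{2}\|\mathbf{A}\mathbf{x}+\mathbf{B}\mathbf{y}-\mathbf{b}\|_2^2$. Bregman ADMM one-iteration map: $g(\mathbf{x},\mathbf{y},\boldsymbol{\lambda})=(\mathbf{x}^+,\mathbf{y}^+,\boldsymbol{\lambda}^+)$, where $\mathbf{x}^+=\operatorname{argmin}_{\mathbf{u}\in D_1}\ \mathcal{L}(\mathbf{u},\mathbf{y},\boldsymbol{\lambda})+\frac1\eta D_{h_1}(\mathbf{u},\mathbf{x})$, $\mathbf{y}^+=\operatorname{argmin}_{\mathbf{v}\in D_2}\ \mathcal{L}(\mathbf{x}^+,\mathbf{v},\boldsymbol{\lambda})+\frac1\eta D_{h_2}(\mathbf{v},\mathbf{y})$,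 $\boldsymbol{\lambda}^+=\boldsymbol{\lambda}+\rho(\mathbf{A}\mathbf{x}^++\mathbf{B}\mathbf{y}^+-\mathbf{b})$. "Well defined on $\Omega$" means that for every state in $\Omega$ both minimizers exist (in $D_1$ and $D_2$ respectively); they are unique since the subproblems are strongly convex under the stated conditions. KKT point: $(\mathbf{x}^\star,\mathbf{y}^\star,\boldsymbol{\lambda}^\star)$ with $\mathbf{A}\mathbf{x}^\star+\mathbf{B}\mathbf{y}^\star=\mathbf{b}$, $\nabla f_1(\mathbf{x}^\star)+\mathbf{A}^\top\boldsymbol{\lambda}^\star=\mathbf{0}$, $\nabla f_2(\mathbf{y}^\star)+\mathbf{B}^\top\boldsymbol{\lambda}^\star=\mathbf{0}$. It is a strict-saddle KKT point if in addition $\mathbf{d}_x^\top\nabla^2 f_1(\mathbf{x}^\star)\mathbf{d}_x+\mathbf{d}_y^\top\nabla^2 f_2(\mathbf{y}^\star)\mathbf{d}_y<0$ for some $(\mathbf{d}_x,\mathbf{d}_y)$ with $\mathbf{A}\mathbf{d}_x+\mathbf{B}\mathbf{d}_y=\mathbf{0}$. *)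

theory Defs
  imports "HOL-Probability.Probability_Measure"
begin

text \<open>Functions on a domain are total HOL functions, of which only the values on the
  (open) domain are ever constrained or used.\<close>

definition grad :: "('a::real_inner \<Rightarrow> real) \<Rightarrow> 'a \<Rightarrow> 'a" where
  "grad f x = (THE d. GDERIV f x :> d)"

definition hessian :: "(real^'n \<Rightarrow> real) \<Rightarrow> real^'n \<Rightarrow> real^'n^'n" where
  "hessian f x = jacobian (grad f) (at x)"

text \<open>Twice continuously differentiable on an open set \<open>D\<close>. Continuity of \<open>f\<close> and \<open>grad f\<close>
  follows from their differentiability.\<close>

definition C2_on :: "(real^'n) set \<Rightarrow> (real^'n \<Rightarrow> real) \<Rightarrow> bool" where
  "C2_on D f \<longleftrightarrow>
     (\<forall>x\<in>D. f differentiable (at x)) \<and>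
     (\<forall>x\<in>D. grad f differentiable (at x)) \<and>
     continuous_on D (hessian f)"

definition strongly_convex_on :: "'a::real_inner set \<Rightarrow> ('a \<Rightarrow> real) \<Rightarrow> bool" where
  "strongly_convex_on D h \<longleftrightarrow> convex D \<and>
     (\<exists>\<mu>>0. \<forall>x\<in>D. \<forall>y\<in>D. \<forall>t\<in>{0..1}.
        h (t *\<^sub>R x + (1 - t) *\<^sub>R y)
          \<le> t * h x + (1 - t) * h y - \<mu> / 2 * t * (1 - t) * (norm (x - y))\<^sup>2)"

text \<open>Symmetry is not part of the definition; it is only applied to Hessians of functions
  that are twice continuously differentiable, which are symmetric.\<close>

definition pos_semidef :: "real^'n^'n \<Rightarrow> bool" where
  "pos_semidef M \<longleftrightarrow> (\<forall>v. 0 \<le> v \<bullet> (M *v v))"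

definition relatively_smooth_on ::
    "(real^'n) set \<Rightarrow> real \<Rightarrow> (real^'n \<Rightarrow> real) \<Rightarrow> (real^'n \<Rightarrow> real) \<Rightarrow> bool" where
  "relatively_smooth_on D L f h \<longleftrightarrow>
     (\<forall>x\<in>D. pos_semidef (L *\<^sub>R hessian h x + hessian f x) \<and>
            pos_semidef (L *\<^sub>R hessian h x - hessian f x))"

definition bregman :: "('a::real_inner \<Rightarrow> real) \<Rightarrow> 'a \<Rightarrow> 'a \<Rightarrow> real" where
  "bregman h x y = h x - h y - grad h y \<bullet> (x - y)"

definition aug_lagrangian ::
    "(real^'n \<Rightarrow> real) \<Rightarrow> (real^'m \<Rightarrow> real) \<Rightarrow> real^'n^'p \<Rightarrow> real^'m^'p \<Rightarrow> real^'p \<Rightarrow> real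
      \<Rightarrow> real^'n \<Rightarrow> real^'m \<Rightarrow> real^'p \<Rightarrow> real" where
  "aug_lagrangian f\<^sub>1 f\<^sub>2 A B b \<rho> x y l =
     f\<^sub>1 x + f\<^sub>2 y + l \<bullet> (A *v x + B *v y - b) + \<rho> / 2 * (norm (A *v x + B *v y - b))\<^sup>2"

definition x_objective ::
    "(real^'n \<Rightarrow> real) \<Rightarrow> (real^'m \<Rightarrow> real) \<Rightarrow> (real^'n \<Rightarrow> real)
      \<Rightarrow> real^'n^'p \<Rightarrow> real^'m^'p \<Rightarrow> real^'p \<Rightarrow> real \<Rightarrow> real
      \<Rightarrow> real^'n \<Rightarrow> real^'m \<Rightarrow> real^'p \<Rightarrow> real^'n \<Rightarrow> real" where
  "x_objective f\<^sub>1 f\<^sub>2 h\<^sub>1 A B b \<rho> \<eta> x y l u =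
     aug_lagrangian f\<^sub>1 f\<^sub>2 A B b \<rho> u y l + 1 / \<eta> * bregman h\<^sub>1 u x"

text \<open>Here \<open>x'\<close> is the already updated first block.\<close>

definition y_objective ::
    "(real^'n \<Rightarrow> real) \<Rightarrow> (real^'m \<Rightarrow> real) \<Rightarrow> (real^'m \<Rightarrow> real)
      \<Rightarrow> real^'n^'p \<Rightarrow> real^'m^'p \<Rightarrow> real^'p \<Rightarrow> real \<Rightarrow> real
      \<Rightarrow> real^'n \<Rightarrow> real^'m \<Rightarrow> real^'p \<Rightarrow> real^'m \<Rightarrow> real" where
  "y_objective f\<^sub>1 f\<^sub>2 h\<^sub>2 A B b \<rho> \<eta> x' y l v =
     aug_lagrangian f\<^sub>1 f\<^sub>2 A B b \<rho> x' v l + 1 / \<eta> * bregman h\<^sub>2 v y"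

text \<open>The choice made by \<open>arg_min_on\<close> is immaterial where a minimizer exists, since both
  objectives are strongly convex when \<open>0 < \<eta> < 1 / L\<^sub>j\<close>.\<close>

definition badmm_step ::
    "(real^'n) set \<Rightarrow> (real^'m) set
      \<Rightarrow> (real^'n \<Rightarrow> real) \<Rightarrow> (real^'m \<Rightarrow> real) \<Rightarrow> (real^'n \<Rightarrow> real) \<Rightarrow> (real^'m \<Rightarrow> real)
      \<Rightarrow> real^'n^'p \<Rightarrow> real^'m^'p \<Rightarrow> real^'p \<Rightarrow> real \<Rightarrow> real
      \<Rightarrow> (real^'n) \<times> (real^'m) \<times> (real^'p) \<Rightarrow> (real^'n) \<times> (real^'m) \<times> (real^'p)" where
  "badmm_step D\<^sub>1 D\<^sub>2 f\<^sub>1 f\<^sub>2 h\<^sub>1 h\<^sub>2 A B b \<rho> \<eta> = (\<lambda>(x, y, l).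
     let x' = arg_min_on (x_objective f\<^sub>1 f\<^sub>2 h\<^sub>1 A B b \<rho> \<eta> x y l) D\<^sub>1;
         y' = arg_min_on (y_objective f\<^sub>1 f\<^sub>2 h\<^sub>2 A B b \<rho> \<eta> x' y l) D\<^sub>2
     in (x', y', l + \<rho> *\<^sub>R (A *v x' + B *v y' - b)))"

definition badmm_well_defined_on ::
    "((real^'n) \<times> (real^'m) \<times> (real^'p)) set \<Rightarrow> (real^'n) set \<Rightarrow> (real^'m) set
      \<Rightarrow> (real^'n \<Rightarrow> real) \<Rightarrow> (real^'m \<Rightarrow> real) \<Rightarrow> (real^'n \<Rightarrow> real) \<Rightarrow> (real^'m \<Rightarrow> real)
      \<Rightarrow> real^'n^'p \<Rightarrow> real^'m^'p \<Rightarrow> real^'p \<Rightarrow> real \<Rightarrow> real \<Rightarrow> bool" where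
  "badmm_well_defined_on \<Omega> D\<^sub>1 D\<^sub>2 f\<^sub>1 f\<^sub>2 h\<^sub>1 h\<^sub>2 A B b \<rho> \<eta> \<longleftrightarrow>
     (\<forall>(x, y, l) \<in> \<Omega>.
        (\<exists>u. is_arg_min (x_objective f\<^sub>1 f\<^sub>2 h\<^sub>1 A B b \<rho> \<eta> x y l) (\<lambda>u. u \<in> D\<^sub>1) u) \<and>
        (let x' = arg_min_on (x_objective f\<^sub>1 f\<^sub>2 h\<^sub>1 A B b \<rho> \<eta> x y l) D\<^sub>1
         in \<exists>v. is_arg_min (y_objective f\<^sub>1 f\<^sub>2 h\<^sub>2 A B b \<rho> \<eta> x' y l) (\<lambda>v. v \<in> D\<^sub>2) v))"

definition KKT_point ::
    "(real^'n \<Rightarrow> real) \<Rightarrow> (real^'m \<Rightarrow> real) \<Rightarrow> real^'n^'p \<Rightarrow> real^'m^'p \<Rightarrow> real^'p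
      \<Rightarrow> (real^'n) \<times> (real^'m) \<times> (real^'p) \<Rightarrow> bool" where
  "KKT_point f\<^sub>1 f\<^sub>2 A B b = (\<lambda>(x, y, l).
     A *v x + B *v y = b \<and>
     grad f\<^sub>1 x + transpose A *v l = 0 \<and>
     grad f\<^sub>2 y + transpose B *v l = 0)"

definition strict_saddle_KKT_point ::
    "(real^'n \<Rightarrow> real) \<Rightarrow> (real^'m \<Rightarrow> real) \<Rightarrow> real^'n^'p \<Rightarrow> real^'m^'p \<Rightarrow> real^'p
      \<Rightarrow> (real^'n) \<times> (real^'m) \<times> (real^'p) \<Rightarrow> bool" where
  "strict_saddle_KKT_point f\<^sub>1 f\<^sub>2 A B b = (\<lambda>(x, y, l).
     KKT_point f\<^sub>1 f\<^sub>2 A B b (x, y, l) \<and>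
     (\<exists>dx dy. A *v dx + B *v dy = 0 \<and>
        dx \<bullet> (hessian f\<^sub>1 x *v dx) + dy \<bullet> (hessian f\<^sub>2 y *v dy) < 0))"

end

theory Submission
  imports Defs "Jordan_Normal_Form.Schur_Decomposition"
begin

text \<open>The step map is continuous and injective, and its inverse is locally Lipschitz because the
  optimality conditions express the old iterate explicitly through the new one up to inverting the
  strongly monotone maps \<open>grad h\<^sub>j\<close>; hence preimages of null sets are null. By Lindelof it therefore
  suffices that every strict saddle has a neighbourhood \<open>U\<close> such that the points whose whole orbit
  stays in \<open>U\<close> form a null set.

  The linearised step at a strict saddle has a real eigenvalue larger than 1: for eigenvalue
  \<open>1 / (1 - w)\<close> with \<open>0 < w < 1\<close>, the eigenvalue equation becomes the singularity of a self-adjoint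
  pencil, which is positive definite for \<open>w\<close> near 1 and has a negative direction for \<open>w\<close> near 0.
  Almost diagonalising the linearisation over the complex numbers gives a cone, invariant under
  differences of nearby orbits, on which a seminorm grows geometrically. Two orbits that stay in \<open>U\<close>
  thus never differ by a vector of the cone, so their starting points lie on a Lipschitz graph over
  the hyperplane orthogonal to the eigenvector, which is a null set.\<close>

section \<open>Almost diagonal form and expanding cones\<close>

text \<open>The step is given only implicitly, through minimisers whose existence is assumed on
  \<Omega>, so it is handled through its optimality equations and never solved for. Comparing two
  orbits with each other, rather than one orbit with the saddle, cancels every constant in these
  equations and gives the graph property without constructing an invariant manifold. The price is
  that gradient increments must be controlled over all pairs of points near the saddle, which
  continuity of the Hessian provides. The linearised step need not be symmetric: it may have nonreal
  eigenvalues and may fail to be diagonalisable, hence complex functionals and a form that is only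
  almost diagonal. The cone separates moduli at least \<mu> from smaller ones, where \<mu> is the
  real unstable eigenvalue; moduli between 1 and \<mu> simply count as slow. Membership in
  \<open>null_sets M\<close> includes measurability, and absolute continuity speaks of
  \<open>lborel\<close> rather than its completion. The exceptional set must therefore be Borel, and
  this is what continuity of the step is for.\<close>

no_notation scalar_prod (infix \<open>\<bullet>\<close> 70)
no_notation vec_index (infixl \<open>$\<close> 100)

text \<open>Complex Schur form: if \<open>A = P * B * Q\<close> with \<open>B\<close> upper
  triangular and \<open>P\<close>, \<open>Q\<close> mutually inverse, then
  \<open>Q * A = B * Q\<close>, so the rows of \<open>Q\<close>, applied to the real coordinates of
  \<open>x\<close>, transform under \<open>T\<close> by \<open>B\<close>. Complex-valued functionals
  on the real space avoid complexifying the space itself.\<close>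

lemma triangular_functionals:
  fixes T :: "'a::euclidean_space \<Rightarrow> 'a"
  assumes T: "linear T"
  shows "\<exists>(c :: nat \<Rightarrow> nat \<Rightarrow> complex) (\<phi> :: nat \<Rightarrow> 'a \<Rightarrow> complex).
    (\<forall>i<DIM('a). \<forall>j<i. c i j = 0) \<and> (\<forall>i<DIM('a). linear (\<phi> i)) \<and>
    (\<forall>x. (\<forall>i<DIM('a). \<phi> i x = 0) \<longrightarrow> x = 0) \<and>
    (\<forall>i<DIM('a). \<forall>x. \<phi> i (T x) = (\<Sum>j<DIM('a). c i j * \<phi> j x))"
proof -
  define n where "n = DIM('a)"
  obtain bs :: "'a list" where bs: "set bs = Basis" "distinct bs"
    using finite_distinct_list[OF finite_Basis] by blast
  have len: "length bs = n"
    using bs distinct_card n_def by fastforce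
  have Basis_sum: "(\<Sum>b\<in>Basis. g b) = (\<Sum>j<n. g (bs ! j))" for g :: "'a \<Rightarrow> 'c::comm_monoid_add"
    using sum.reindex_bij_betw[OF bij_betw_nth[OF bs(2) _ bs(1)[symmetric]], of "{..<n}" g] len
    by simp
  define A where "A = Matrix.mat n n (\<lambda>(i,j). complex_of_real (bs ! i \<bullet> T (bs ! j)))"
  define co where "co x = Matrix.vec n (\<lambda>i. complex_of_real (x \<bullet> bs ! i))" for x
  have A: "A \<in> carrier_mat n n" by (simp add: A_def)
  have co: "co x \<in> carrier_vec n" for x by (simp add: co_def)
  have Aco: "A *\<^sub>v co x = co (T x)" for x
  proof (rule eq_vecI)
    fix i assume "i < dim_vec (co (T x))"
    then have i: "i < n" by (simp add: co_def)
    have "T x = T (\<Sum>j<n. (x \<bullet> bs ! j) *\<^sub>R bs ! j)"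
      using euclidean_representation[of x] Basis_sum[of "\<lambda>b. (x \<bullet> b) *\<^sub>R b"] by simp
    also have "\<dots> = (\<Sum>j<n. (x \<bullet> bs ! j) *\<^sub>R T (bs ! j))"
      by (simp add: linear_sum[OF T] linear_cmul[OF T])
    finally have "T x \<bullet> bs ! i = (\<Sum>j<n. (x \<bullet> bs ! j) * (T (bs ! j) \<bullet> bs ! i))"
      by (simp add: inner_sum_left)
    then show "vec_index (A *\<^sub>v co x) i = vec_index (co (T x)) i"
      using i by (simp add: A_def co_def scalar_prod_def atLeast0LessThan inner_commute mult.commute)
  qed (simp add: A_def co_def)
  obtain es where es: "char_poly A = (\<Prod>a\<leftarrow>es. [:- a, 1:])"
    using char_poly_factorized[OF A] by blast
  obtain B P Q where "schur_decomposition A es = (B, P, Q)"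
    using prod_cases3 by blast
  then have wit: "similar_mat_wit A B P Q" and ut: "upper_triangular B"
    using schur_decomposition[OF A es] by blast+
  note w = similar_mat_witD2[OF A wit]
  define c where "c i j = index_mat B (i, j)" for i j
  define \<phi> where "\<phi> i x = vec_index (Q *\<^sub>v co x) i" for i x
  have QA: "Q * A = B * Q"
  proof -
    have BQ: "B * Q \<in> carrier_mat n n"
      using w(5,7) by simp
    have "Q * A = Q * (P * (B * Q))"
      using w(3) assoc_mult_mat[OF w(6) w(5) w(7)] by simp
    also have "\<dots> = (Q * P) * (B * Q)"
      using assoc_mult_mat[OF w(7) w(6) BQ] by simp
    finally show ?thesis
      using w(2) left_mult_one_mat[OF BQ] by simp
  qed
  have \<phi>_eq: "\<phi> i x = (\<Sum>j<n. index_mat Q (i, j) * complex_of_real (x \<bullet> bs ! j))" if "i < n" for i x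
    using that w(7) by (simp add: \<phi>_def co_def scalar_prod_def atLeast0LessThan)
  show ?thesis
    unfolding n_def[symmetric]
  proof (rule exI[of _ c], rule exI[of _ \<phi>], intro conjI allI impI)
    show "c i j = 0" if "i < n" "j < i" for i j
      using ut w(5) that by (auto simp: c_def)
    show "linear (\<phi> i)" if "i < n" for i
      by (rule linearI)
        (simp_all add: \<phi>_eq[OF that] inner_add_left sum.distrib algebra_simps scaleR_conv_of_real sum_distrib_left)
    show "x = 0" if "\<forall>i<n. \<phi> i x = 0" for x
    proof -
      have "Q *\<^sub>v co x = 0\<^sub>v n"
        using w(7) that by (intro eq_vecI) (auto simp: \<phi>_def)
      then have "P *\<^sub>v (Q *\<^sub>v co x) = 0\<^sub>v n"
        using w(6) by (auto intro!: eq_vecI simp: scalar_prod_def)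
      then have z: "co x = 0\<^sub>v n"
        using assoc_mult_mat_vec[OF w(6,7) co[of x]] w(1) one_mult_mat_vec[OF co[of x]] by simp
      have "x \<bullet> bs ! i = 0" if "i < n" for i
        using arg_cong[OF z, of "\<lambda>v. vec_index v i"] that by (simp add: co_def)
      then show "x = 0"
        using bs(1) len by (metis euclidean_all_zero_iff in_set_conv_nth)
    qed
    show "\<phi> i (T x) = (\<Sum>j<n. c i j * \<phi> j x)" if "i < n" for i x
    proof -
      have "Q *\<^sub>v co (T x) = B *\<^sub>v (Q *\<^sub>v co x)"
        unfolding Aco[symmetric] assoc_mult_mat_vec[OF w(7) A co, symmetric] QA
        by (rule assoc_mult_mat_vec[OF w(5) w(7) co])
      then show ?thesis
        using that w(5,7) by (simp add: \<phi>_def c_def scalar_prod_def[of _ "Q *\<^sub>v co x"] atLeast0LessThan)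
    qed
  qed
qed

text \<open>Scaling \<open>\<phi> i\<close> by \<open>\<kappa> ^ i\<close> multiplies the entry
  \<open>c i j\<close> by the power \<open>i - j\<close> of \<kappa>: entries above the diagonal
  become small while the diagonal stays fixed. Hence \<open>lam\<close> can be chosen before \<tau>,
  as it must be, since \<tau> is later taken from the gap between the moduli of
  \<open>lam\<close>.\<close>

lemma almost_diagonal_functionals:
  fixes T :: "'a::euclidean_space \<Rightarrow> 'a"
  assumes T: "linear T"
  shows "\<exists>lam :: nat \<Rightarrow> complex. \<forall>\<tau>>0. \<exists>\<psi> :: nat \<Rightarrow> 'a \<Rightarrow> complex.
       (\<forall>i<DIM('a). linear (\<psi> i)) \<and> (\<forall>x. (\<forall>i<DIM('a). \<psi> i x = 0) \<longrightarrow> x = 0) \<and>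
       (\<forall>i<DIM('a). \<forall>x. cmod (\<psi> i (T x) - lam i * \<psi> i x) \<le> \<tau> * (\<Sum>j<DIM('a). cmod (\<psi> j x)))"
proof -
  from triangular_functionals[OF T]
  obtain c :: "nat \<Rightarrow> nat \<Rightarrow> complex" and \<phi> :: "nat \<Rightarrow> 'a \<Rightarrow> complex"
    where c: "\<forall>i<DIM('a). \<forall>j<i. c i j = 0" and lin: "\<forall>i<DIM('a). linear (\<phi> i)"
      and inj: "\<forall>x. (\<forall>i<DIM('a). \<phi> i x = 0) \<longrightarrow> x = 0"
      and \<phi>T: "\<forall>i<DIM('a). \<forall>x. \<phi> i (T x) = (\<Sum>j<DIM('a). c i j * \<phi> j x)"
    by (elim exE conjE)
  define \<beta> where "\<beta> = (\<Sum>i<DIM('a). \<Sum>j<DIM('a). cmod (c i j))"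
  have \<beta>: "cmod (c i j) \<le> \<beta>" if "i < DIM('a)" "j < DIM('a)" for i j
  proof -
    have "cmod (c i j) \<le> (\<Sum>j<DIM('a). cmod (c i j))"
      using that by (intro member_le_sum) auto
    also have "\<dots> \<le> \<beta>"
      unfolding \<beta>_def using that
      by (intro member_le_sum[of i _ "\<lambda>i. \<Sum>j<DIM('a). cmod (c i j)"]) (auto intro: sum_nonneg)
    finally show ?thesis .
  qed
  have "0 \<le> \<beta>" unfolding \<beta>_def by (intro sum_nonneg) auto
  show ?thesis
  proof (intro exI[of _ "\<lambda>i. c i i"] allI impI)
    fix \<tau> :: real assume \<tau>: "\<tau> > 0"
    \<comment> \<open>With this choice \<open>\<beta> / \<kappa> \<le> \<tau>\<close>, so a single
      inverse power of \<kappa> already brings every entry above the diagonal below \<tau>.\<close>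
    define \<kappa> where "\<kappa> = 1 + \<beta> / \<tau>"
    have \<kappa>: "\<kappa> \<ge> 1" "\<beta> \<le> \<kappa> * \<tau>"
      using \<tau> \<open>0 \<le> \<beta>\<close> by (auto simp: \<kappa>_def field_simps)
    define \<psi> where "\<psi> i x = complex_of_real (\<kappa> ^ i) * \<phi> i x" for i x
    show "\<exists>\<psi> :: nat \<Rightarrow> 'a \<Rightarrow> complex.
       (\<forall>i<DIM('a). linear (\<psi> i)) \<and> (\<forall>x. (\<forall>i<DIM('a). \<psi> i x = 0) \<longrightarrow> x = 0) \<and>
       (\<forall>i<DIM('a). \<forall>x. cmod (\<psi> i (T x) - c i i * \<psi> i x) \<le> \<tau> * (\<Sum>j<DIM('a). cmod (\<psi> j x)))"
    proof (intro exI[of _ \<psi>] conjI allI impI)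
    show "linear (\<psi> i)" if "i < DIM('a)" for i
      using lin[rule_format, OF that] unfolding \<psi>_def linear_iff by (auto simp: algebra_simps)
    show "x = 0" if "\<forall>i<DIM('a). \<psi> i x = 0" for x
      using inj[rule_format, of x] that \<kappa> by (auto simp: \<psi>_def)
    show "cmod (\<psi> i (T x) - c i i * \<psi> i x) \<le> \<tau> * (\<Sum>j<DIM('a). cmod (\<psi> j x))"
      if i: "i < DIM('a)" for i x
    proof -
      have "(\<Sum>j<DIM('a). c i j * \<phi> j x) = c i i * \<phi> i x + (\<Sum>j\<in>{..<DIM('a)} - {i}. c i j * \<phi> j x)"
        using i by (simp add: sum.remove)
      then have "\<psi> i (T x) - c i i * \<psi> i x
          = (\<Sum>j\<in>{..<DIM('a)} - {i}. complex_of_real (\<kappa> ^ i) * (c i j * \<phi> j x))"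
        by (simp add: \<psi>_def \<phi>T[rule_format, OF i] distrib_left sum_distrib_left mult_ac)
      then have "cmod (\<psi> i (T x) - c i i * \<psi> i x)
          \<le> (\<Sum>j\<in>{..<DIM('a)} - {i}. cmod (complex_of_real (\<kappa> ^ i) * (c i j * \<phi> j x)))"
        by (simp add: norm_sum)
      also have "\<dots> \<le> (\<Sum>j\<in>{..<DIM('a)} - {i}. \<tau> * cmod (\<psi> j x))"
      proof (rule sum_mono)
        fix j assume j: "j \<in> {..<DIM('a)} - {i}"
        show "cmod (complex_of_real (\<kappa> ^ i) * (c i j * \<phi> j x)) \<le> \<tau> * cmod (\<psi> j x)"
        proof (cases "j < i")
          case True
          then show ?thesis using c[rule_format, OF i] \<tau> by simp
        next
          case False
          then have "\<kappa> ^ i * \<kappa> \<le> \<kappa> ^ j"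
            using j \<kappa>(1) power_increasing[of "Suc i" j \<kappa>] by (simp add: mult.commute)
          moreover have "cmod (c i j) \<le> \<kappa> * \<tau>"
            using \<beta>[OF i, of j] j \<kappa>(2) by simp
          then have "\<kappa> ^ i * cmod (c i j) \<le> \<kappa> ^ i * (\<kappa> * \<tau>)"
            using \<kappa>(1) by (intro mult_left_mono) auto
          moreover have "\<kappa> ^ i * \<kappa> * \<tau> \<le> \<kappa> ^ j * \<tau>"
            using calculation \<tau> by (intro mult_right_mono) auto
          ultimately have "\<kappa> ^ i * cmod (c i j) \<le> \<tau> * \<kappa> ^ j"
            by (simp add: mult_ac)
          then have "\<kappa> ^ i * cmod (c i j) * cmod (\<phi> j x) \<le> \<tau> * \<kappa> ^ j * cmod (\<phi> j x)"
            by (intro mult_right_mono) auto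
          then show ?thesis
            using \<kappa>(1) by (simp add: \<psi>_def norm_mult norm_power mult_ac)
        qed
      qed
      also have "\<dots> \<le> \<tau> * (\<Sum>j<DIM('a). cmod (\<psi> j x))"
        using \<tau> unfolding sum_distrib_left by (intro sum_mono2) auto
      finally show ?thesis .
    qed
    qed
  qed
qed

text \<open>The growth functions below use only some of the functionals and may vanish on a
  subspace, so they are not norms. Nonnegativity follows from the two axioms.\<close>

definition seminorm :: "('a::real_vector \<Rightarrow> real) \<Rightarrow> bool" where
  "seminorm N \<longleftrightarrow> (\<forall>x y. N (x + y) \<le> N x + N y) \<and> (\<forall>c x. N (c *\<^sub>R x) = \<bar>c\<bar> * N x)"

lemma seminorm_zero: "seminorm N \<Longrightarrow> N 0 = 0"
  unfolding seminorm_def by (metis abs_zero mult_zero_left scaleR_zero_left)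

lemma seminorm_minus: "seminorm N \<Longrightarrow> N (- x) = N x"
  unfolding seminorm_def by (metis abs_minus_cancel abs_one mult_1 scaleR_minus1_left)

lemma seminorm_nonneg:
  assumes "seminorm N" shows "0 \<le> N x"
proof -
  have "N (x + - x) \<le> N x + N (- x)" using assms unfolding seminorm_def by blast
  then show ?thesis using seminorm_zero[OF assms] seminorm_minus[OF assms] by simp
qed

lemma seminorm_add_le: "seminorm N \<Longrightarrow> N (x + y) \<le> N x + N y"
  and seminorm_scaleR: "seminorm N \<Longrightarrow> N (c *\<^sub>R x) = \<bar>c\<bar> * N x"
  unfolding seminorm_def by blast+

lemma seminorm_add_ge: "seminorm N \<Longrightarrow> N x - N y \<le> N (x + y)"
  using seminorm_add_le[of N "x + y" "- y"] seminorm_minus[of N y] by simp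

lemma seminorm_sum_cmod:
  assumes "\<And>i. i \<in> I \<Longrightarrow> linear (\<psi> i)"
  shows "seminorm (\<lambda>x. \<Sum>i\<in>I. cmod (\<psi> i x))"
  unfolding seminorm_def
proof safe
  show "(\<Sum>i\<in>I. cmod (\<psi> i (x + y))) \<le> (\<Sum>i\<in>I. cmod (\<psi> i x)) + (\<Sum>i\<in>I. cmod (\<psi> i y))" for x y
    unfolding sum.distrib[symmetric]
    by (intro sum_mono) (simp add: linear_add[OF assms] norm_triangle_ineq)
  show "(\<Sum>i\<in>I. cmod (\<psi> i (c *\<^sub>R x))) = \<bar>c\<bar> * (\<Sum>i\<in>I. cmod (\<psi> i x))" for c x
    unfolding sum_distrib_left by (intro sum.cong) (auto simp: linear_cmul[OF assms])
qed

lemma seminorm_bounded: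
  fixes N :: "'a::euclidean_space \<Rightarrow> real"
  assumes N: "seminorm N"
  shows "\<exists>K>0. \<forall>x. N x \<le> K * norm x"
proof -
  define K where "K = (\<Sum>b\<in>Basis. N b) + 1"
  have "K > 0" using sum_nonneg[of Basis N] seminorm_nonneg[OF N] by (simp add: K_def add_nonneg_pos)
  moreover have "N x \<le> K * norm x" for x
  proof -
    have sum_le: "N (sum f S) \<le> (\<Sum>b\<in>S. N (f b))" if "finite S" for f and S :: "'a set"
      using that
      by (induction S rule: finite_induct)
        (auto simp: seminorm_zero[OF N] intro: order_trans[OF seminorm_add_le[OF N]])
    have "N x = N (\<Sum>b\<in>Basis. (x \<bullet> b) *\<^sub>R b)" by (simp add: euclidean_representation)
    also have "\<dots> \<le> (\<Sum>b\<in>Basis. \<bar>x \<bullet> b\<bar> * N b)"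
      using sum_le[of Basis "\<lambda>b. (x \<bullet> b) *\<^sub>R b"] by (simp add: seminorm_scaleR[OF N])
    also have "\<dots> \<le> (\<Sum>b\<in>Basis. norm x * N b)"
      by (intro sum_mono mult_right_mono) (auto simp: Basis_le_norm seminorm_nonneg[OF N])
    also have "\<dots> = norm x * sum N Basis" by (rule sum_distrib_left[symmetric])
    also have "\<dots> \<le> K * norm x" by (simp add: K_def algebra_simps)
    finally show ?thesis .
  qed
  ultimately show ?thesis by blast
qed

text \<open>The sum attains a minimum on the compact unit sphere; it is positive because the
  functionals separate points, and homogeneity does the rest.\<close>

lemma norm_le_sum_cmod:
  fixes \<psi> :: "nat \<Rightarrow> 'a::euclidean_space \<Rightarrow> complex"
  assumes lin: "\<And>i. i < n \<Longrightarrow> linear (\<psi> i)" and inj: "\<And>x. (\<forall>i<n. \<psi> i x = 0) \<Longrightarrow> x = 0"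
  shows "\<exists>C>0. \<forall>x. norm x \<le> C * (\<Sum>i<n. cmod (\<psi> i x))"
proof -
  let ?N = "\<lambda>x. \<Sum>i<n. cmod (\<psi> i x)"
  have semi: "seminorm ?N" using lin by (intro seminorm_sum_cmod) auto
  have cont: "continuous_on (sphere 0 1) ?N"
    using lin by (intro continuous_intros linear_continuous_on linear_conv_bounded_linear[THEN iffD1]) auto
  have "sphere (0::'a) 1 \<noteq> {}" by simp
  from continuous_attains_inf[OF compact_sphere this cont]
  obtain x0 where x0: "x0 \<in> sphere 0 1" "\<forall>x\<in>sphere 0 1. ?N x0 \<le> ?N x" ..
  have pos: "?N x0 > 0"
  proof (rule ccontr)
    assume "\<not> ?N x0 > 0"
    then have "?N x0 = 0" using seminorm_nonneg[OF semi, of x0] by simp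
    then have "\<forall>i<n. \<psi> i x0 = 0" by (simp add: sum_nonneg_eq_0_iff)
    then show False using inj[of x0] x0(1) by auto
  qed
  show ?thesis
  proof (intro exI[of _ "1 / ?N x0"] conjI allI)
    show "1 / ?N x0 > 0" using pos by simp
    fix x
    show "norm x \<le> 1 / ?N x0 * ?N x"
    proof (cases "x = 0")
      case False
      have "?N x0 \<le> ?N ((1 / norm x) *\<^sub>R x)" using False by (intro x0(2)[rule_format]) auto
      also have "\<dots> = ?N x / norm x" by (subst seminorm_scaleR[OF semi]) simp
      finally show ?thesis using pos False by (simp add: field_simps)
    qed (use pos in \<open>auto intro!: divide_nonneg_nonneg sum_nonneg\<close>)
  qed
qed

text \<open>\<open>U\<close> collects the functionals whose diagonal entry has modulus at least
  \<mu>, \<open>S\<close> the others. Errors are multiples of \<open>U + S\<close>, hence on the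
  cone \<open>S < U\<close> at most twice that multiple of \<open>U\<close>. There \<open>U\<close>
  grows by nearly \<mu>, while \<open>S\<close> is bounded by a smaller multiple of the old
  \<open>U\<close>. The deviation of \<open>y\<close> from \<open>T x\<close> is built in so that
  differences of nonlinear orbits qualify.\<close>

lemma invariant_expanding_cone:
  fixes T :: "'a::euclidean_space \<Rightarrow> 'a"
  assumes T: "linear T" and e: "T e = \<mu> *\<^sub>R e" "e \<noteq> 0" and \<mu>: "1 < \<mu>"
  shows "\<exists>(U :: 'a \<Rightarrow> real) S \<theta> \<epsilon>. seminorm U \<and> seminorm S \<and> \<theta> > 1 \<and> \<epsilon> > 0 \<and> S e < U e \<and>
    (\<forall>x y. norm (y - T x) \<le> \<epsilon> * norm x \<longrightarrow> S x < U x \<longrightarrow> S y < U y \<and> \<theta> * U x \<le> U y)"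
proof -
  let ?n = "DIM('a)"
  from almost_diagonal_functionals[OF T]
  obtain lam :: "nat \<Rightarrow> complex" where lam: "\<forall>\<tau>>0. \<exists>\<psi> :: nat \<Rightarrow> 'a \<Rightarrow> complex.
       (\<forall>i<?n. linear (\<psi> i)) \<and> (\<forall>x. (\<forall>i<?n. \<psi> i x = 0) \<longrightarrow> x = 0) \<and>
       (\<forall>i<?n. \<forall>x. cmod (\<psi> i (T x) - lam i * \<psi> i x) \<le> \<tau> * (\<Sum>j<?n. cmod (\<psi> j x)))" ..
  define I where "I = {i. i < ?n \<and> \<mu> \<le> cmod (lam i)}"
  define J where "J = {i. i < ?n \<and> cmod (lam i) < \<mu>}"
  have IJ: "finite I" "finite J" "I \<inter> J = {}" "I \<union> J = {..<?n}" "I \<subseteq> {..<?n}" "J \<subseteq> {..<?n}"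
    by (auto simp: I_def J_def)
  \<comment> \<open>The largest modulus below \<mu>; the inserted 0 covers the case that
    \<open>J\<close> is empty.\<close>
  define b where "b = Max (insert 0 ((\<lambda>i. cmod (lam i)) ` J))"
  have "b \<in> insert 0 ((\<lambda>i. cmod (lam i)) ` J)" unfolding b_def using IJ(2) by (intro Max_in) auto
  then have "b < \<mu>" using \<mu> by (auto simp: J_def)
  moreover have "0 \<le> b" "\<And>j. j \<in> J \<Longrightarrow> cmod (lam j) \<le> b"
    unfolding b_def using IJ(2) by (auto intro!: Max_ge)
  ultimately have b: "b < \<mu>" "0 \<le> b" "\<And>j. j \<in> J \<Longrightarrow> cmod (lam j) \<le> b"
    by blast+
  \<comment> \<open>Inside the cone two errors, from the off-diagonal part and from
    \<open>y - T x\<close>, cost at most \<open>2 * \<delta> * U x\<close> each. The resulting rates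
    \<open>\<mu> - 4 * \<delta>\<close> and \<open>b + 4 * \<delta>\<close> must stay separated, and
    the first must exceed 1.\<close>
  define \<delta> where "\<delta> = min ((\<mu> - b) / 16) ((\<mu> - 1) / 16)"
  have \<delta>: "\<delta> > 0" "b + 4 * \<delta> < \<mu> - 4 * \<delta>" "\<mu> - 4 * \<delta> > 1"
  proof -
    have "\<delta> \<le> (\<mu> - b) / 16" "\<delta> \<le> (\<mu> - 1) / 16" unfolding \<delta>_def by (rule min.cobounded1 min.cobounded2)+
    then show "b + 4 * \<delta> < \<mu> - 4 * \<delta>" "\<mu> - 4 * \<delta> > 1" using b(1) \<mu> by argo+
    show "\<delta> > 0" using b(1) \<mu> unfolding \<delta>_def by simp
  qed
  \<comment> \<open>At most \<open>?n\<close> errors of this relative size are added up, so each sum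
    costs no more than \<delta>.\<close>
  have "\<delta> / (real ?n + 1) > 0" using \<delta>(1) by simp
  from lam[rule_format, OF this] obtain \<psi> :: "nat \<Rightarrow> 'a \<Rightarrow> complex"
    where \<psi>: "(\<forall>i<?n. linear (\<psi> i)) \<and> (\<forall>x. (\<forall>i<?n. \<psi> i x = 0) \<longrightarrow> x = 0) \<and>
       (\<forall>i<?n. \<forall>x. cmod (\<psi> i (T x) - lam i * \<psi> i x) \<le> \<delta> / (real ?n + 1) * (\<Sum>j<?n. cmod (\<psi> j x)))" ..
  have lin: "linear (\<psi> i)" if "i < ?n" for i
    using \<psi> that by blast
  have inj: "x = 0" if "\<forall>i<?n. \<psi> i x = 0" for x
    using \<psi> that by blast
  have \<psi>T: "cmod (\<psi> i (T x) - lam i * \<psi> i x) \<le> \<delta> / (real ?n + 1) * (\<Sum>j<?n. cmod (\<psi> j x))"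
    if "i < ?n" for i x
    using \<psi> that by blast
  define U where "U x = (\<Sum>i\<in>I. cmod (\<psi> i x))" for x
  define S where "S x = (\<Sum>i\<in>J. cmod (\<psi> i x))" for x
  have US: "(\<Sum>i<?n. cmod (\<psi> i x)) = U x + S x" for x
    unfolding U_def S_def IJ(4)[symmetric] by (rule sum.union_disjoint[OF IJ(1-3)])
  have semi: "seminorm U" "seminorm S"
    unfolding U_def S_def using lin IJ by (auto intro!: seminorm_sum_cmod)
  note nonneg = seminorm_nonneg[OF semi(1)] seminorm_nonneg[OF semi(2)]
  have err: "(\<Sum>i\<in>X. cmod (\<psi> i (T x) - lam i * \<psi> i x)) \<le> \<delta> * (U x + S x)" if "X \<subseteq> {..<?n}" for X x
  proof -
    define q where "q = \<delta> / (real ?n + 1) * (U x + S x)"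
    have q: "0 \<le> q" using \<delta>(1) nonneg[of x] by (simp add: q_def)
    have "(\<Sum>i\<in>X. cmod (\<psi> i (T x) - lam i * \<psi> i x)) \<le> real (card X) * q"
      using \<psi>T that by (intro sum_bounded_above) (auto simp: q_def simp flip: US)
    also have "card X \<le> ?n"
      using card_mono[of "{..<?n}" X] that by simp
    then have "real (card X) * q \<le> (real ?n + 1) * q"
      using q by (intro mult_right_mono) auto
    also have "(real ?n + 1) * q = \<delta> * (U x + S x)" by (simp add: q_def)
    finally show ?thesis .
  qed
  have UT: "\<mu> * U x - \<delta> * (U x + S x) \<le> U (T x)" for x
  proof -
    have "\<mu> * U x \<le> (\<Sum>i\<in>I. cmod (\<psi> i (T x)) + cmod (\<psi> i (T x) - lam i * \<psi> i x))"
      unfolding U_def sum_distrib_left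
    proof (rule sum_mono)
      fix i assume "i \<in> I"
      then have "\<mu> * cmod (\<psi> i x) \<le> cmod (lam i * \<psi> i x)"
        by (auto simp: I_def norm_mult intro: mult_right_mono)
      also have "\<dots> \<le> cmod (\<psi> i (T x)) + cmod (\<psi> i (T x) - lam i * \<psi> i x)"
        by (metis norm_triangle_sub norm_minus_commute)
      finally show "\<mu> * cmod (\<psi> i x) \<le> cmod (\<psi> i (T x)) + cmod (\<psi> i (T x) - lam i * \<psi> i x)" .
    qed
    then show ?thesis using err[OF IJ(5), of x] by (simp add: sum.distrib U_def)
  qed
  have ST: "S (T x) \<le> b * S x + \<delta> * (U x + S x)" for x
  proof -
    have "S (T x) \<le> (\<Sum>i\<in>J. b * cmod (\<psi> i x) + cmod (\<psi> i (T x) - lam i * \<psi> i x))"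
      unfolding S_def
    proof (rule sum_mono)
      fix i assume "i \<in> J"
      then have "cmod (lam i * \<psi> i x) \<le> b * cmod (\<psi> i x)"
        using b(3) by (auto simp: norm_mult intro: mult_right_mono)
      moreover have "cmod (\<psi> i (T x)) \<le> cmod (lam i * \<psi> i x) + cmod (\<psi> i (T x) - lam i * \<psi> i x)"
        by (metis norm_triangle_sub)
      ultimately show "cmod (\<psi> i (T x)) \<le> b * cmod (\<psi> i x) + cmod (\<psi> i (T x) - lam i * \<psi> i x)"
        by simp
    qed
    then show ?thesis using err[OF IJ(6), of x] by (simp add: sum.distrib S_def sum_distrib_left)
  qed
  obtain C where "C > 0" "\<forall>x. norm x \<le> C * (\<Sum>i<?n. cmod (\<psi> i x))"
    using norm_le_sum_cmod[of ?n \<psi>, OF lin inj] by blast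
  then have C: "C > 0" "\<And>x. norm x \<le> C * (U x + S x)" by (simp_all add: US)
  obtain K1 where K1: "K1 > 0" "\<forall>x. U x \<le> K1 * norm x" using seminorm_bounded[OF semi(1)] by blast
  obtain K2 where K2: "K2 > 0" "\<forall>x. S x \<le> K2 * norm x" using seminorm_bounded[OF semi(2)] by blast
  define K where "K = K1 + K2"
  have K: "K > 0" "\<And>x. U x \<le> K * norm x" "\<And>x. S x \<le> K * norm x"
  proof -
    show "K > 0" using K1(1) K2(1) by (simp add: K_def)
    fix x :: 'a
    have "0 \<le> K1 * norm x" "0 \<le> K2 * norm x" using K1(1) K2(1) by auto
    then show "U x \<le> K * norm x" "S x \<le> K * norm x"
      using K1(2)[rule_format, of x] K2(2)[rule_format, of x] unfolding K_def distrib_right by linarith+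
  qed
  \<comment> \<open>\<open>C\<close> bounds \<open>norm x\<close> by \<open>U x + S x\<close>, and
    \<open>K\<close> bounds \<open>U\<close> and \<open>S\<close> of the remainder by its norm; the
    quotient makes the combined factor \<delta>.\<close>
  define \<epsilon> where "\<epsilon> = \<delta> / (K * C)"
  show ?thesis
  proof (rule exI[of _ U], rule exI[of _ S], rule exI[of _ "\<mu> - 4 * \<delta>"], rule exI[of _ \<epsilon>],
      intro conjI allI impI)
    show "\<epsilon> > 0" using \<delta>(1) K(1) C(1) by (simp add: \<epsilon>_def)
    \<comment> \<open>Outside the cone, \<open>S e\<close> would have to grow by the full factor
      \<mu>, which is more than \<open>S\<close> allows unless \<open>e\<close> vanishes.\<close>
    show "S e < U e"
    proof (rule ccontr)
      assume "\<not> S e < U e"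
      then have le: "U e \<le> S e" by simp
      have "\<mu> * S e \<le> b * S e + \<delta> * (U e + S e)"
        using ST[of e] \<mu> by (simp add: e(1) seminorm_scaleR[OF semi(2)])
      also have "\<dots> \<le> b * S e + \<delta> * (2 * S e)"
        using le \<delta>(1) by (intro add_left_mono mult_left_mono) auto
      finally have "(\<mu> - b - 2 * \<delta>) * S e \<le> 0" by (simp add: algebra_simps)
      moreover have "\<mu> - b - 2 * \<delta> > 0" using \<delta> by linarith
      ultimately have "S e \<le> 0" by (simp add: mult_le_0_iff)
      then have "U e + S e = 0" using le nonneg[of e] by linarith
      then show False using C(2)[of e] e(2) by simp
    qed
    fix x y assume y: "norm (y - T x) \<le> \<epsilon> * norm x" and SU: "S x < U x"
    define r where "r = y - T x"
    have "K * norm r \<le> K * (\<epsilon> * (C * (U x + S x)))"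
    proof -
      have "\<epsilon> * norm x \<le> \<epsilon> * (C * (U x + S x))"
        using C(2)[of x] \<open>\<epsilon> > 0\<close> by (intro mult_left_mono) auto
      then show ?thesis using y K(1) unfolding r_def by (intro mult_left_mono) auto
    qed
    also have "\<dots> = \<delta> * (U x + S x)" using K(1) C(1) by (simp add: \<epsilon>_def)
    finally have r: "U r \<le> \<delta> * (U x + S x)" "S r \<le> \<delta> * (U x + S x)"
      using K(2,3)[of r] by linarith+
    have s: "\<delta> * (U x + S x) \<le> 2 * \<delta> * U x"
      using SU \<delta>(1) by (simp add: algebra_simps)
    have "y = T x + r" by (simp add: r_def)
    then have "U (T x) - U r \<le> U y" "S y \<le> S (T x) + S r"
      using seminorm_add_ge[OF semi(1), of "T x" r] seminorm_add_le[OF semi(2), of "T x" r] by simp_all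
    then have "\<mu> * U x - 2 * (2 * \<delta> * U x) \<le> U y" and Sy: "S y \<le> b * S x + 2 * (2 * \<delta> * U x)"
      using UT[of x] ST[of x] r s by linarith+
    then have 1: "(\<mu> - 4 * \<delta>) * U x \<le> U y" by (simp add: left_diff_distrib)
    have "b * S x \<le> b * U x" using SU b(2) by (intro mult_left_mono) auto
    with Sy have "S y \<le> (b + 4 * \<delta>) * U x" by (simp add: distrib_right)
    also have "\<dots> < (\<mu> - 4 * \<delta>) * U x"
      using SU nonneg(2)[of x] \<delta> by (intro mult_strict_right_mono) auto
    finally show "S y < U y" using 1 by simp
    show "(\<mu> - 4 * \<delta>) * U x \<le> U y" by (rule 1)
  qed (use semi \<delta> in auto)
qed

section \<open>Null sets of orbits staying near an unstable fixed point\<close>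

text \<open>The projection \<open>p\<close> along \<open>v\<close> is injective on \<open>W\<close>
  with Lipschitz inverse, so \<open>W\<close> is a Lipschitz image of a subset of a
  hyperplane.\<close>

lemma negligible_Lipschitz_graph:
  fixes W :: "'a::euclidean_space set" and v :: 'a
  assumes v: "v \<noteq> 0"
    and C: "\<And>w w'. w \<in> W \<Longrightarrow> w' \<in> W \<Longrightarrow>
      norm (w - w') \<le> C * norm ((w - w') - ((w - w') \<bullet> v / (v \<bullet> v)) *\<^sub>R v)"
  shows "negligible W"
proof -
  define p where "p w = w - (w \<bullet> v / (v \<bullet> v)) *\<^sub>R v" for w
  have p_diff: "p w - p w' = (w - w') - ((w - w') \<bullet> v / (v \<bullet> v)) *\<^sub>R v" for w w'
    by (simp add: p_def inner_diff_left diff_divide_distrib algebra_simps)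
  have inj: "inj_on p W"
  proof (rule inj_onI)
    fix w w' assume "w \<in> W" "w' \<in> W" "p w = p w'"
    then show "w = w'" using C[of w w'] p_diff[of w w'] by simp
  qed
  have "p ` W \<subseteq> {x. v \<bullet> x = 0}"
    using v by (auto simp: p_def inner_diff_right inner_commute)
  then have "negligible (p ` W)"
    using negligible_hyperplane[of v 0] v negligible_subset by blast
  then have "negligible (the_inv_into W p ` p ` W)"
  proof (rule negligible_locally_Lipschitz_image[rotated])
    fix x assume "x \<in> p ` W"
    then obtain w where w: "w \<in> W" "x = p w" by blast
    have "norm (the_inv_into W p y - the_inv_into W p x) \<le> C * norm (y - x)" if "y \<in> p ` W" for y
      using that w C[of _ w] p_diff[of _ w] by (auto simp: the_inv_into_f_f[OF inj])
    then show "\<exists>T B. open T \<and> x \<in> T \<and>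
        (\<forall>y\<in>p ` W \<inter> T. norm (the_inv_into W p y - the_inv_into W p x) \<le> B * norm (y - x))"
      by (intro exI[of _ UNIV] exI[of _ C]) auto
  qed auto
  moreover have "the_inv_into W p ` p ` W = W"
    by (force simp: the_inv_into_f_f[OF inj] image_image)
  ultimately show ?thesis by simp
qed

text \<open>A difference inside the cone would grow geometrically, against boundedness, so all
  differences satisfy \<open>U \<le> S\<close>. As \<open>S e < U e\<close>, the component along
  \<open>e\<close> is then controlled by the orthogonal one. The bound \<epsilon> is fixed before
  \<open>W\<close> and \<open>g\<close>, so that a neighbourhood can later be chosen to fit
  it.\<close>

lemma negligible_bounded_invariant:
  fixes T :: "'a::euclidean_space \<Rightarrow> 'a"
  assumes T: "linear T" and e: "T e = \<mu> *\<^sub>R e" "e \<noteq> 0" and \<mu>: "1 < \<mu>"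
  shows "\<exists>\<epsilon>>0. \<forall>W g. bounded W \<longrightarrow> g ` W \<subseteq> W \<longrightarrow>
    (\<forall>w\<in>W. \<forall>w'\<in>W. norm (g w - g w' - T (w - w')) \<le> \<epsilon> * norm (w - w')) \<longrightarrow> negligible W"
proof -
  from invariant_expanding_cone[OF T e \<mu>]
  obtain U S :: "'a \<Rightarrow> real" and \<theta> \<epsilon> :: real
    where U: "seminorm U" and S: "seminorm S" and \<theta>: "\<theta> > 1" and \<epsilon>: "\<epsilon> > 0" and eUS: "S e < U e"
      and cone: "\<forall>x y. norm (y - T x) \<le> \<epsilon> * norm x \<longrightarrow> S x < U x \<longrightarrow> S y < U y \<and> \<theta> * U x \<le> U y"
    by (elim exE conjE)
  show ?thesis
  proof (intro exI[of _ \<epsilon>] conjI allI impI)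
    fix W and g :: "'a \<Rightarrow> 'a"
    assume W: "bounded W" and g: "g ` W \<subseteq> W"
      and lin: "\<forall>w\<in>W. \<forall>w'\<in>W. norm (g w - g w' - T (w - w')) \<le> \<epsilon> * norm (w - w')"
    obtain K1 where K1: "K1 > 0" "\<forall>x. U x \<le> K1 * norm x" using seminorm_bounded[OF U] by blast
    obtain K2 where K2: "K2 > 0" "\<forall>x. S x \<le> K2 * norm x" using seminorm_bounded[OF S] by blast
    obtain R where R: "\<And>w. w \<in> W \<Longrightarrow> norm w \<le> R" using W bounded_iff by blast
    have US: "U (w - w') \<le> S (w - w')" if w: "w \<in> W" "w' \<in> W" for w w'
    proof (rule ccontr)
      assume "\<not> U (w - w') \<le> S (w - w')"
      then have 0: "S (w - w') < U (w - w')" by simp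
      have iter: "(g ^^ k) w \<in> W \<and> (g ^^ k) w' \<in> W \<and>
          S ((g ^^ k) w - (g ^^ k) w') < U ((g ^^ k) w - (g ^^ k) w') \<and>
          \<theta> ^ k * U (w - w') \<le> U ((g ^^ k) w - (g ^^ k) w')" for k
      proof (induction k)
        case (Suc k)
        let ?d = "(g ^^ k) w - (g ^^ k) w'"
        let ?d' = "(g ^^ Suc k) w - (g ^^ Suc k) w'"
        have "S ?d' < U ?d' \<and> \<theta> * U ?d \<le> U ?d'"
          using Suc lin by (intro cone[rule_format]) auto
        moreover have "\<theta> * (\<theta> ^ k * U (w - w')) \<le> \<theta> * U ?d"
          using Suc \<theta> by (intro mult_left_mono) auto
        ultimately show ?case using Suc.IH g by (auto simp: mult.assoc)
      qed (use w 0 in auto)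
      have pos: "U (w - w') > 0" using 0 seminorm_nonneg[OF S, of "w - w'"] by linarith
      \<comment> \<open>\<open>K1 * (2 * R)\<close> bounds \<open>U\<close> on all differences of
        points of \<open>W\<close>; this \<open>k\<close> makes the geometric growth exceed
        it.\<close>
      obtain k where k: "K1 * (2 * R) / U (w - w') < \<theta> ^ k"
        using real_arch_pow[OF \<theta>] by blast
      then have "K1 * (2 * R) < \<theta> ^ k * U (w - w')" using pos by (simp add: pos_divide_less_eq)
      also have "\<dots> \<le> K1 * norm ((g ^^ k) w - (g ^^ k) w')"
        using iter[of k] K1(2)[rule_format, of "(g ^^ k) w - (g ^^ k) w'"] by linarith
      also have "\<dots> \<le> K1 * (R + R)"
      proof (rule mult_left_mono)
        show "norm ((g ^^ k) w - (g ^^ k) w') \<le> R + R"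
          using norm_triangle_ineq4[of "(g ^^ k) w" "(g ^^ k) w'"] R[of "(g ^^ k) w"] R[of "(g ^^ k) w'"]
            iter[of k] by linarith
      qed (use K1(1) in simp)
      finally show False by simp
    qed
    \<comment> \<open>Inserting \<open>w - w' = t *\<^sub>R e + d\<close> into
      \<open>U \<le> S\<close> and collecting the terms in \<open>t\<close> bounds
      \<open>\<bar>t\<bar>\<close> by \<open>q * norm d\<close>.\<close>
    define q where "q = (K1 + K2) / (U e - S e)"
    define C where "C = 1 + q * norm e"
    show "negligible W"
    proof (rule negligible_Lipschitz_graph[OF e(2), where C = C])
      fix w w' assume w: "w \<in> W" "w' \<in> W"
      define t where "t = (w - w') \<bullet> e / (e \<bullet> e)"
      define d where "d = (w - w') - t *\<^sub>R e"
      have wd: "w - w' = t *\<^sub>R e + d" by (simp add: d_def)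
      have "\<bar>t\<bar> * U e - U d \<le> U (w - w')"
        using seminorm_add_ge[OF U, of "t *\<^sub>R e" d] by (simp add: wd seminorm_scaleR[OF U])
      also have "\<dots> \<le> S (w - w')" by (rule US[OF w])
      also have "\<dots> \<le> \<bar>t\<bar> * S e + S d"
        using seminorm_add_le[OF S, of "t *\<^sub>R e" d] by (simp add: wd seminorm_scaleR[OF S])
      finally have "\<bar>t\<bar> * (U e - S e) \<le> U d + S d" unfolding right_diff_distrib by linarith
      also have "\<dots> \<le> (K1 + K2) * norm d"
        using K1(2)[rule_format, of d] K2(2)[rule_format, of d] unfolding distrib_right by linarith
      finally have "\<bar>t\<bar> \<le> q * norm d"
        using eUS unfolding q_def by (simp add: pos_le_divide_eq)
      then have "\<bar>t\<bar> * norm e \<le> q * norm d * norm e"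
        by (rule mult_right_mono) simp
      moreover have "norm (w - w') \<le> \<bar>t\<bar> * norm e + norm d"
        using norm_triangle_ineq[of "t *\<^sub>R e" d] unfolding wd by simp
      moreover have "C * norm d = norm d + q * norm d * norm e"
        unfolding C_def by (simp add: distrib_right)
      ultimately have "norm (w - w') \<le> C * norm d" by linarith
      then show "norm (w - w') \<le> C * norm ((w - w') - ((w - w') \<bullet> e / (e \<bullet> e)) *\<^sub>R e)"
        by (simp add: d_def t_def)
    qed
  qed (rule \<epsilon>)
qed

section \<open>The unstable eigenvalue of the linearised step\<close>

text \<open>By compactness there is a last parameter at which some unit vector has a nonpositive
  value. A negative value there would, by the intermediate value theorem, produce a zero at a
  strictly later parameter. No lowest eigenvalue has to be followed as a function of
  \<open>t\<close>.\<close>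

lemma degenerate_parameter:
  fixes Q :: "real \<Rightarrow> 'a::euclidean_space \<Rightarrow> real"
  assumes ab: "a \<le> b"
    and cont: "continuous_on ({a..b} \<times> sphere 0 1) (\<lambda>(t, x). Q t x)"
    and hom: "\<And>t c x. Q t (c *\<^sub>R x) = c\<^sup>2 * Q t x"
    and pos: "\<And>x. x \<noteq> 0 \<Longrightarrow> 0 < Q b x" and neg: "Q a x0 < 0"
  shows "\<exists>t\<in>{a..b}. (\<exists>x. x \<noteq> 0 \<and> Q t x = 0) \<and> (\<forall>x. 0 \<le> Q t x)"
proof -
  let ?X = "{a..b} \<times> sphere (0::'a) 1"
  define S where "S = {p \<in> ?X. (\<lambda>(t, x). Q t x) p \<le> 0}"
  have unit: "Q t x = (norm x)\<^sup>2 * Q t (x /\<^sub>R norm x)" "x /\<^sub>R norm x \<in> sphere 0 1" if "x \<noteq> 0" for t x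
    using that hom[of t "norm x" "x /\<^sub>R norm x"] by simp_all
  have "x0 \<noteq> 0" using neg hom[of a 0 0] by auto
  then have "(a, x0 /\<^sub>R norm x0) \<in> S"
    using unit(1)[of x0 a] unit(2)[of x0] neg ab by (auto simp: S_def mult_less_0_iff)
  then have "S \<noteq> {}" by blast
  have "closedin (top_of_set ?X) S"
  proof -
    have "S = ?X \<inter> (\<lambda>(t, x). Q t x) -` {..0}" by (auto simp: S_def)
    then show ?thesis using continuous_closedin_preimage[OF cont, of "{..0}"] by simp
  qed
  then have "compact S"
    using closedin_compact[of ?X S] by (simp add: compact_Times)
  from continuous_attains_sup[OF this \<open>S \<noteq> {}\<close> continuous_on_fst[OF continuous_on_id]]
  obtain p where p: "p \<in> S" "\<forall>q\<in>S. fst q \<le> fst p" ..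
  obtain t x where tx: "p = (t, x)" by (cases p)
  have t: "t \<in> {a..b}" "x \<in> sphere 0 1" "Q t x \<le> 0" using p(1) by (auto simp: S_def tx)
  have nonneg: "0 \<le> Q t y" for y
  proof (rule ccontr)
    assume neg: "\<not> 0 \<le> Q t y"
    then have "y \<noteq> 0" using hom[of t 0 0] by auto
    define u where "u = y /\<^sub>R norm y"
    have u: "u \<in> sphere 0 1" "u \<noteq> 0" using unit(2)[OF \<open>y \<noteq> 0\<close>] \<open>y \<noteq> 0\<close> by (auto simp: u_def)
    have "Q t u < 0"
      using neg unit(1)[OF \<open>y \<noteq> 0\<close>, of t] by (auto simp: u_def mult_less_0_iff not_le)
    have "continuous_on {t..b} (\<lambda>s. (\<lambda>(t, x). Q t x) (s, u))"
      using t(1) u(1) by (intro continuous_on_compose2[OF cont] continuous_intros) auto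
    then have "\<exists>s\<ge>t. s \<le> b \<and> Q s u = 0"
      using IVT'[of "\<lambda>s. Q s u" t 0 b] \<open>Q t u < 0\<close> pos[OF u(2)] t(1) by auto
    then obtain s where s: "t \<le> s" "s \<le> b" "Q s u = 0" by blast
    then have "(s, u) \<in> S" using t(1) u(1) by (auto simp: S_def)
    then have "s \<le> t" using p(2) tx by auto
    then show False using s \<open>Q t u < 0\<close> by simp
  qed
  have "x \<noteq> 0" using t(2) by auto
  moreover have "Q t x = 0" using t(3) nonneg[of x] by simp
  ultimately show ?thesis using t(1) nonneg by blast
qed

text \<open>Moving \<open>x\<close> slightly against \<open>K x\<close> would make the form negative
  if \<open>K x\<close> did not vanish. This turns a zero of the semidefinite form of the pencil
  into a kernel vector.\<close>

lemma psd_kernel: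
  fixes K :: "'a::real_inner \<Rightarrow> 'a"
  assumes lin: "linear K" and sym: "\<And>u v. K u \<bullet> v = u \<bullet> K v"
    and psd: "\<And>v. 0 \<le> v \<bullet> K v" and x: "x \<bullet> K x = 0"
  shows "K x = 0"
proof (rule ccontr)
  assume "K x \<noteq> 0"
  define v where "v = K x"
  define p where "p = v \<bullet> v"
  define c where "c = v \<bullet> K v"
  \<comment> \<open>The added 1 avoids division by zero and yields \<open>s * c \<ge> - p\<close>,
    so that \<open>2 * p + s * c\<close> stays positive while \<open>s\<close> is negative.\<close>
  define s where "s = - p / (c + 1)"
  have p: "p > 0" using \<open>K x \<noteq> 0\<close> by (simp add: p_def v_def)
  have c: "c \<ge> 0" unfolding c_def by (rule psd)
  have "x \<bullet> K v = p" "v \<bullet> K x = p" using sym[of x v] by (simp_all add: p_def v_def)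
  then have "(x + s *\<^sub>R v) \<bullet> K (x + s *\<^sub>R v) = s * (2 * p + s * c)"
    using x by (simp add: linear_add[OF lin] linear_cmul[OF lin] inner_add_left inner_add_right
        c_def algebra_simps)
  moreover have "s < 0" using p c by (simp add: s_def)
  moreover have "s * c \<ge> - p"
    using p c by (simp add: s_def field_simps)
  then have "2 * p + s * c > 0" using p by linarith
  ultimately have "(x + s *\<^sub>R v) \<bullet> K (x + s *\<^sub>R v) < 0" by (simp add: mult_neg_pos)
  then show False using psd[of "x + s *\<^sub>R v"] by linarith
qed

text \<open>The method frozen at one point: \<open>H\<^sub>j\<close> and \<open>F\<^sub>j\<close>
  stand for the Hessians of \<open>h\<^sub>j\<close> and \<open>f\<^sub>j\<close> there.\<close>

locale linear_badmm =
  fixes H\<^sub>1 F\<^sub>1 :: "'a::euclidean_space \<Rightarrow> 'a" and H\<^sub>2 F\<^sub>2 :: "'b::euclidean_space \<Rightarrow> 'b"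
    and A :: "'a \<Rightarrow> 'c::euclidean_space" and B :: "'b \<Rightarrow> 'c" and \<eta> \<rho> L\<^sub>1 L\<^sub>2 :: real
  assumes lin: "linear H\<^sub>1" "linear F\<^sub>1" "linear H\<^sub>2" "linear F\<^sub>2" "linear A" "linear B"
    and sym: "\<And>u v. H\<^sub>1 u \<bullet> v = u \<bullet> H\<^sub>1 v" "\<And>u v. F\<^sub>1 u \<bullet> v = u \<bullet> F\<^sub>1 v"
      "\<And>u v. H\<^sub>2 u \<bullet> v = u \<bullet> H\<^sub>2 v" "\<And>u v. F\<^sub>2 u \<bullet> v = u \<bullet> F\<^sub>2 v"
    and H_pos: "\<And>v. v \<noteq> 0 \<Longrightarrow> 0 < v \<bullet> H\<^sub>1 v" "\<And>v. v \<noteq> 0 \<Longrightarrow> 0 < v \<bullet> H\<^sub>2 v"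
    and rel: "\<And>v. 0 \<le> L\<^sub>1 * (v \<bullet> H\<^sub>1 v) + v \<bullet> F\<^sub>1 v" "\<And>v. 0 \<le> L\<^sub>2 * (v \<bullet> H\<^sub>2 v) + v \<bullet> F\<^sub>2 v"
    and \<eta>: "0 < \<eta>" "\<eta> * L\<^sub>1 < 1" "\<eta> * L\<^sub>2 < 1" and \<rho>: "0 < \<rho>"
begin

text \<open>One step of the method on quadratic data is \<open>implicit_part z' = explicit_part z\<close>.\<close>

definition implicit_part :: "'a \<times> 'b \<times> 'c \<Rightarrow> 'a \<times> 'b \<times> 'c" where
  "implicit_part = (\<lambda>(x, y, l).
     (H\<^sub>1 x + \<eta> *\<^sub>R F\<^sub>1 x + (\<eta> * \<rho>) *\<^sub>R adjoint A (A x),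
      H\<^sub>2 y + \<eta> *\<^sub>R F\<^sub>2 y + (\<eta> * \<rho>) *\<^sub>R adjoint B (A x + B y),
      l - \<rho> *\<^sub>R (A x + B y)))"

definition explicit_part :: "'a \<times> 'b \<times> 'c \<Rightarrow> 'a \<times> 'b \<times> 'c" where
  "explicit_part = (\<lambda>(x, y, l).
     (H\<^sub>1 x - \<eta> *\<^sub>R adjoint A l - (\<eta> * \<rho>) *\<^sub>R adjoint A (B y), H\<^sub>2 y - \<eta> *\<^sub>R adjoint B l, l))"

lemma lin_adjoint: "linear (adjoint A)" "linear (adjoint B)"
  using lin by (simp_all add: adjoint_linear)

lemma adj: "x \<bullet> adjoint A w = A x \<bullet> w" "y \<bullet> adjoint B w = B y \<bullet> w"
  "adjoint A w \<bullet> x = w \<bullet> A x" "adjoint B w \<bullet> y = w \<bullet> B y"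
  using adjoint_works[OF lin(5)] adjoint_works[OF lin(6)] by (simp_all add: inner_commute)

lemmas lin_simps =
  lin[THEN linear_add] lin[THEN linear_cmul] lin[THEN linear_diff] lin[THEN linear_0]
  lin_adjoint[THEN linear_add] lin_adjoint[THEN linear_cmul] lin_adjoint[THEN linear_diff]
  lin_adjoint[THEN linear_0]

lemma linear_implicit_part: "linear implicit_part"
  by (rule linearI) (auto simp: implicit_part_def lin_simps algebra_simps)

lemma linear_explicit_part: "linear explicit_part"
  by (rule linearI) (auto simp: explicit_part_def lin_simps algebra_simps)

text \<open>The assumption says that \<open>w / \<eta>\<close> exceeds both constants
  \<open>L\<^sub>j\<close>. The case \<open>w = 1\<close> makes the linearised subproblems
  nondegenerate; a value slightly below 1 makes the diagonal blocks of the pencil positive.\<close>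

lemma H_plus_F_pos:
  assumes "\<eta> * max L\<^sub>1 L\<^sub>2 < w"
  shows "v \<noteq> 0 \<Longrightarrow> 0 < w / \<eta> * (v \<bullet> H\<^sub>1 v) + v \<bullet> F\<^sub>1 v"
    and "u \<noteq> 0 \<Longrightarrow> 0 < w / \<eta> * (u \<bullet> H\<^sub>2 u) + u \<bullet> F\<^sub>2 u"
proof -
  have "max L\<^sub>1 L\<^sub>2 < w / \<eta>"
    using assms \<eta>(1) by (simp add: pos_less_divide_eq mult.commute del: max_less_iff_conj)
  then have w: "L\<^sub>1 < w / \<eta>" "L\<^sub>2 < w / \<eta>" by simp_all
  show "0 < w / \<eta> * (v \<bullet> H\<^sub>1 v) + v \<bullet> F\<^sub>1 v" if "v \<noteq> 0"
    using mult_strict_right_mono[OF w(1) H_pos(1)[OF that]] rel(1)[of v] by linarith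
  show "0 < w / \<eta> * (u \<bullet> H\<^sub>2 u) + u \<bullet> F\<^sub>2 u" if "u \<noteq> 0"
    using mult_strict_right_mono[OF w(2) H_pos(2)[OF that]] rel(2)[of u] by linarith
qed

text \<open>The system is block triangular in the order \<open>x\<close>, \<open>y\<close>,
  \<open>l\<close>: pairing the first row with \<open>x\<close>, and then the second with
  \<open>y\<close>, gives something positive unless that block vanishes.\<close>

lemma inj_implicit_part: "inj implicit_part"
  unfolding linear_injective_0[OF linear_implicit_part]
proof (intro allI impI)
  fix z assume z: "implicit_part z = 0"
  obtain x y l where zz: "z = (x, y, l)" by (cases z)
  have \<eta>max: "\<eta> * max L\<^sub>1 L\<^sub>2 < 1" using \<eta> by (simp add: max_def)
  have e: "H\<^sub>1 x + \<eta> *\<^sub>R F\<^sub>1 x + (\<eta> * \<rho>) *\<^sub>R adjoint A (A x) = 0"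
    "H\<^sub>2 y + \<eta> *\<^sub>R F\<^sub>2 y + (\<eta> * \<rho>) *\<^sub>R adjoint B (A x + B y) = 0" "l = \<rho> *\<^sub>R (A x + B y)"
    using z by (auto simp: zz implicit_part_def zero_prod_def)
  have x: "x = 0"
  proof (rule ccontr)
    assume "x \<noteq> 0"
    from H_plus_F_pos(1)[OF \<eta>max this] have "0 < x \<bullet> H\<^sub>1 x + \<eta> * (x \<bullet> F\<^sub>1 x)"
      using \<eta>(1) by (simp add: field_simps)
    moreover have "x \<bullet> (H\<^sub>1 x + \<eta> *\<^sub>R F\<^sub>1 x + (\<eta> * \<rho>) *\<^sub>R adjoint A (A x))
        = x \<bullet> H\<^sub>1 x + \<eta> * (x \<bullet> F\<^sub>1 x) + (\<eta> * \<rho>) * (A x \<bullet> A x)"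
      by (simp add: inner_add_right adj)
    moreover have "(\<eta> * \<rho>) * (A x \<bullet> A x) \<ge> 0" using \<eta>(1) \<rho> by simp
    ultimately show False by (simp add: e(1))
  qed
  have y: "y = 0"
  proof (rule ccontr)
    assume "y \<noteq> 0"
    from H_plus_F_pos(2)[OF \<eta>max this] have "0 < y \<bullet> H\<^sub>2 y + \<eta> * (y \<bullet> F\<^sub>2 y)"
      using \<eta>(1) by (simp add: field_simps)
    moreover have "y \<bullet> (H\<^sub>2 y + \<eta> *\<^sub>R F\<^sub>2 y + (\<eta> * \<rho>) *\<^sub>R adjoint B (A x + B y))
        = y \<bullet> H\<^sub>2 y + \<eta> * (y \<bullet> F\<^sub>2 y) + (\<eta> * \<rho>) * (B y \<bullet> B y)"
      by (simp add: inner_add_right adj x lin_simps)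
    moreover have "(\<eta> * \<rho>) * (B y \<bullet> B y) \<ge> 0" using \<eta>(1) \<rho> by simp
    ultimately show False by (simp add: e(2))
  qed
  show "z = 0" using x y e(3) by (simp add: zz zero_prod_def lin_simps)
qed

text \<open>Eliminating the multiplier from the eigenvalue equation with eigenvalue \<open>1 / (1 - w)\<close> leaves
  a block system whose off-diagonal blocks are positive multiples of each other's adjoints;
  multiplying its second row by \<open>1 - w\<^sup>2\<close> makes it the self-adjoint \<open>pencil w\<close>.\<close>

definition pencil :: "real \<Rightarrow> 'a \<times> 'b \<Rightarrow> 'a \<times> 'b" where
  "pencil w = (\<lambda>(x, y).
     ((w / \<eta>) *\<^sub>R H\<^sub>1 x + F\<^sub>1 x + (\<rho> * w) *\<^sub>R adjoint A (A x) + (\<rho> / w * (1 - w\<^sup>2)) *\<^sub>R adjoint A (A x + B y),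
      (1 - w\<^sup>2) *\<^sub>R ((w / \<eta>) *\<^sub>R H\<^sub>2 y + F\<^sub>2 y + (\<rho> / w) *\<^sub>R adjoint B (A x + B y))))"

lemma linear_pencil: "linear (pencil w)"
  by (rule linearI) (auto simp: pencil_def lin_simps algebra_simps)

lemma pencil_sym: "pencil w u \<bullet> v = u \<bullet> pencil w v"
  by (cases u; cases v) (simp add: pencil_def inner_add_left inner_add_right adj sym algebra_simps)

text \<open>The coefficient \<open>\<rho> / w\<close> blows up as \<open>w\<close> tends to 0, but
  it multiplies only the square of \<open>A x + B y\<close>, which vanishes in feasible directions.
  Negative curvature along such a direction therefore survives for small \<open>w\<close>.\<close>

lemma pencil_quadratic:
  "(x, y) \<bullet> pencil w (x, y) = w / \<eta> * (x \<bullet> H\<^sub>1 x) + x \<bullet> F\<^sub>1 x + \<rho> * w * (A x \<bullet> A x)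
    + (1 - w\<^sup>2) * (w / \<eta> * (y \<bullet> H\<^sub>2 y) + y \<bullet> F\<^sub>2 y)
    + \<rho> / w * (1 - w\<^sup>2) * ((A x + B y) \<bullet> (A x + B y))"
  by (simp add: pencil_def inner_add_left inner_add_right adj algebra_simps diff_divide_distrib)

lemma singular_pencil:
  assumes ker: "A dx + B dy = 0" and neg: "dx \<bullet> F\<^sub>1 dx + dy \<bullet> F\<^sub>2 dy < 0"
  shows "\<exists>w z. 0 < w \<and> w < 1 \<and> z \<noteq> 0 \<and> pencil w z = 0"
proof -
  have "max (\<eta> * max L\<^sub>1 L\<^sub>2) 0 < 1" using \<eta> by (simp add: max_def)
  \<comment> \<open>Room below 1 is needed: \<open>w1\<close> must exceed the threshold of
    \<open>H_plus_F_pos\<close> and yet keep \<open>1 - w1\<^sup>2\<close> positive, so that the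
    second block is not annihilated.\<close>
  from dense[OF this] obtain w1 where "max (\<eta> * max L\<^sub>1 L\<^sub>2) 0 < w1" "w1 < 1" by blast
  then have w1: "0 < w1" "w1 < 1" "\<eta> * max L\<^sub>1 L\<^sub>2 < w1" by simp_all
  have sq1: "0 < 1 - w1\<^sup>2" using w1 by (simp add: abs_square_less_1)
  \<comment> \<open>This is the form of the pencil in the direction \<open>(dx, dy)\<close>, where
    the singular term drops out; its limit at 0 is the curvature assumed negative.\<close>
  have "((\<lambda>w. w / \<eta> * (dx \<bullet> H\<^sub>1 dx) + dx \<bullet> F\<^sub>1 dx + \<rho> * w * (A dx \<bullet> A dx)
      + (1 - w\<^sup>2) * (w / \<eta> * (dy \<bullet> H\<^sub>2 dy) + dy \<bullet> F\<^sub>2 dy)) \<longlongrightarrow>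
      0 / \<eta> * (dx \<bullet> H\<^sub>1 dx) + dx \<bullet> F\<^sub>1 dx + \<rho> * 0 * (A dx \<bullet> A dx)
      + (1 - 0\<^sup>2) * (0 / \<eta> * (dy \<bullet> H\<^sub>2 dy) + dy \<bullet> F\<^sub>2 dy)) (at_right 0)" (is "(?f \<longlongrightarrow> ?l) _")
    using \<eta>(1) by (intro tendsto_intros) auto
  moreover have "?l < 0" using neg by simp
  ultimately have "eventually (\<lambda>w. ?f w < 0) (at_right 0)" by (rule order_tendstoD(2))
  then have "eventually (\<lambda>w. ?f w < 0 \<and> 0 < w \<and> w < w1) (at_right 0)"
    using eventually_at_right_real[OF w1(1)] by eventually_elim auto
  then obtain w0 where w0: "?f w0 < 0" "0 < w0" "w0 < w1"
    using eventually_happens'[OF trivial_limit_at_right_real] by blast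
  define Q where "Q w z = z \<bullet> pencil w z" for w z
  have "\<exists>t\<in>{w0..w1}. (\<exists>x. x \<noteq> 0 \<and> Q t x = 0) \<and> (\<forall>x. 0 \<le> Q t x)"
  proof (rule degenerate_parameter)
    show "w0 \<le> w1" using w0 by simp
    have bl: "bounded_linear H\<^sub>1" "bounded_linear F\<^sub>1" "bounded_linear H\<^sub>2" "bounded_linear F\<^sub>2"
      "bounded_linear A" "bounded_linear B"
      using lin by (simp_all add: linear_conv_bounded_linear)
    have "continuous_on ({w0..w1} \<times> sphere 0 1) (\<lambda>p.
       fst p / \<eta> * (fst (snd p) \<bullet> H\<^sub>1 (fst (snd p))) + fst (snd p) \<bullet> F\<^sub>1 (fst (snd p))
       + \<rho> * fst p * (A (fst (snd p)) \<bullet> A (fst (snd p)))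
       + (1 - (fst p)\<^sup>2) * (fst p / \<eta> * (snd (snd p) \<bullet> H\<^sub>2 (snd (snd p))) + snd (snd p) \<bullet> F\<^sub>2 (snd (snd p)))
       + \<rho> / fst p * (1 - (fst p)\<^sup>2) *
         ((A (fst (snd p)) + B (snd (snd p))) \<bullet> (A (fst (snd p)) + B (snd (snd p)))))"
      using \<eta>(1) w0(2) by (intro continuous_intros bl[THEN bounded_linear.continuous_on]) auto
    then show "continuous_on ({w0..w1} \<times> sphere 0 1) (\<lambda>(t, x). Q t x)"
      unfolding Q_def case_prod_unfold pencil_quadratic[symmetric] by simp
    show "Q t (c *\<^sub>R z) = c\<^sup>2 * Q t z" for t c z
      by (simp add: Q_def linear_cmul[OF linear_pencil] power2_eq_square)
    show "0 < Q w1 z" if nz: "z \<noteq> 0" for z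
    proof -
      obtain x y where z: "z = (x, y)" by (cases z)
      have px: "0 \<le> w1 / \<eta> * (x \<bullet> H\<^sub>1 x) + x \<bullet> F\<^sub>1 x" "0 \<le> w1 / \<eta> * (y \<bullet> H\<^sub>2 y) + y \<bullet> F\<^sub>2 y"
        using H_plus_F_pos(1)[OF w1(3), of x] H_plus_F_pos(2)[OF w1(3), of y]
        by (cases "x = 0"; cases "y = 0"; simp add: lin_simps)+
      have rest: "0 \<le> \<rho> * w1 * (A x \<bullet> A x)" "0 \<le> \<rho> / w1 * (1 - w1\<^sup>2) * ((A x + B y) \<bullet> (A x + B y))"
        using \<rho> w1(1) sq1 by auto
      have "0 < w1 / \<eta> * (x \<bullet> H\<^sub>1 x) + x \<bullet> F\<^sub>1 x \<or>
          0 < (1 - w1\<^sup>2) * (w1 / \<eta> * (y \<bullet> H\<^sub>2 y) + y \<bullet> F\<^sub>2 y)"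
      proof (cases "x = 0")
        case True
        then have "y \<noteq> 0" using nz by (auto simp: z zero_prod_def)
        then show ?thesis using mult_pos_pos[OF sq1 H_plus_F_pos(2)[OF w1(3)]] by blast
      qed (use H_plus_F_pos(1)[OF w1(3)] in blast)
      moreover have "0 \<le> (1 - w1\<^sup>2) * (w1 / \<eta> * (y \<bullet> H\<^sub>2 y) + y \<bullet> F\<^sub>2 y)"
        using px(2) sq1 by simp
      ultimately show ?thesis using px(1) rest unfolding Q_def z pencil_quadratic by linarith
    qed
    show "Q w0 (dx, dy) < 0"
      using w0(1) unfolding Q_def pencil_quadratic ker by simp
  qed
  then obtain w z where w: "w \<in> {w0..w1}" and z: "z \<noteq> 0" "Q w z = 0" and psd: "\<forall>x. 0 \<le> Q w x"
    by blast
  have "pencil w z = 0"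
    using psd z(2) by (intro psd_kernel[OF linear_pencil pencil_sym]) (auto simp: Q_def)
  then show ?thesis using w z(1) w0 w1 by (intro exI[of _ w] exI[of _ z]) auto
qed

text \<open>With \<open>\<mu> = 1 / (1 - w)\<close> the multiplier row of the eigenvalue equation
  reads \<open>(1 - w) *\<^sub>R l = l - \<rho> *\<^sub>R r\<close> and forces
  \<open>l = (\<rho> / w) *\<^sub>R r\<close>. Substituting this and dividing the other rows by
  \<eta> leads to the kernel equation of the pencil; the proof runs the computation
  backwards.\<close>

lemma unstable_eigenvector:
  assumes ker: "A dx + B dy = 0" and neg: "dx \<bullet> F\<^sub>1 dx + dy \<bullet> F\<^sub>2 dy < 0"
  shows "\<exists>\<mu> e. 1 < \<mu> \<and> e \<noteq> 0 \<and> explicit_part e = \<mu> *\<^sub>R implicit_part e"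
proof -
  obtain w x y where w: "0 < w" "w < 1" and nz: "(x, y) \<noteq> 0" and K: "pencil w (x, y) = 0"
    using singular_pencil[OF ker neg] by (metis surj_pair)
  define r where "r = A x + B y"
  define k where "k = \<rho> / w"
  have \<rho>_eq: "\<rho> = k * w" using w by (simp add: k_def)
  define l where "l = k *\<^sub>R r"
  have w2: "1 - w\<^sup>2 \<noteq> 0" using w by (simp add: power2_eq_1_iff)
  have f1: "F\<^sub>1 x = - ((w / \<eta>) *\<^sub>R H\<^sub>1 x + (\<rho> * w) *\<^sub>R adjoint A (A x) + (k * (1 - w\<^sup>2)) *\<^sub>R adjoint A r)"
    using K by (simp add: pencil_def zero_prod_def r_def k_def eq_neg_iff_add_eq_0 algebra_simps)
  have "(w / \<eta>) *\<^sub>R H\<^sub>2 y + F\<^sub>2 y + k *\<^sub>R adjoint B r = 0"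
    using K w2 by (simp add: pencil_def zero_prod_def r_def k_def)
  then have f2: "F\<^sub>2 y = - ((w / \<eta>) *\<^sub>R H\<^sub>2 y + k *\<^sub>R adjoint B r)"
    by (simp add: eq_neg_iff_add_eq_0 algebra_simps)
  have By: "adjoint A (B y) = adjoint A r - adjoint A (A x)"
    by (simp add: r_def lin_simps)
  \<comment> \<open>Comparing coefficients one by one keeps the remaining algebra among real
    numbers.\<close>
  have sc: "a *\<^sub>R u + b *\<^sub>R v + c *\<^sub>R t = a' *\<^sub>R u + b' *\<^sub>R v + c' *\<^sub>R t"
    if "a = a'" "b = b'" "c = c'" for a b c a' b' c' :: real and u v t :: "'d::real_vector"
    using that by simp
  have "(1 - w) *\<^sub>R explicit_part (x, y, l) = implicit_part (x, y, l)"
  proof -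
    have "(1 - w) *\<^sub>R (H\<^sub>1 x - \<eta> *\<^sub>R adjoint A l - (\<eta> * \<rho>) *\<^sub>R adjoint A (B y))
      = (1 - w) *\<^sub>R H\<^sub>1 x + (- (1 - w) * \<eta> * k - (1 - w) * \<eta> * \<rho>) *\<^sub>R adjoint A r
        + ((1 - w) * \<eta> * \<rho>) *\<^sub>R adjoint A (A x)"
      unfolding By l_def by (simp add: lin_simps algebra_simps)
    also have "\<dots> = (1 - w) *\<^sub>R H\<^sub>1 x + (- \<eta> * (k * (1 - w\<^sup>2))) *\<^sub>R adjoint A r
        + (\<eta> * \<rho> - \<eta> * \<rho> * w) *\<^sub>R adjoint A (A x)"
      by (intro sc) (simp_all add: \<rho>_eq algebra_simps power2_eq_square)
    also have "\<dots> = H\<^sub>1 x + \<eta> *\<^sub>R F\<^sub>1 x + (\<eta> * \<rho>) *\<^sub>R adjoint A (A x)"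
      using \<eta>(1) unfolding f1 by (simp add: algebra_simps)
    finally have 1: "(1 - w) *\<^sub>R (H\<^sub>1 x - \<eta> *\<^sub>R adjoint A l - (\<eta> * \<rho>) *\<^sub>R adjoint A (B y))
      = H\<^sub>1 x + \<eta> *\<^sub>R F\<^sub>1 x + (\<eta> * \<rho>) *\<^sub>R adjoint A (A x)" .
    have "(1 - w) *\<^sub>R (H\<^sub>2 y - \<eta> *\<^sub>R adjoint B l)
      = (1 - w) *\<^sub>R H\<^sub>2 y + (- (1 - w) * \<eta> * k) *\<^sub>R adjoint B r + 0 *\<^sub>R adjoint B r"
      unfolding l_def by (simp add: lin_simps algebra_simps)
    also have "\<dots> = (1 - w) *\<^sub>R H\<^sub>2 y + (\<eta> * \<rho> - \<eta> * k) *\<^sub>R adjoint B r + 0 *\<^sub>R adjoint B r"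
      by (intro sc) (simp_all add: \<rho>_eq algebra_simps)
    also have "\<dots> = H\<^sub>2 y + \<eta> *\<^sub>R F\<^sub>2 y + (\<eta> * \<rho>) *\<^sub>R adjoint B r"
      using \<eta>(1) unfolding f2 by (simp add: algebra_simps)
    finally have 2: "(1 - w) *\<^sub>R (H\<^sub>2 y - \<eta> *\<^sub>R adjoint B l)
      = H\<^sub>2 y + \<eta> *\<^sub>R F\<^sub>2 y + (\<eta> * \<rho>) *\<^sub>R adjoint B r" .
    have 3: "(1 - w) *\<^sub>R l = l - \<rho> *\<^sub>R r"
      by (simp add: l_def \<rho>_eq algebra_simps)
    show ?thesis
      using 1 2 3 by (simp add: implicit_part_def explicit_part_def r_def)
  qed
  then have "explicit_part (x, y, l) = (1 / (1 - w)) *\<^sub>R implicit_part (x, y, l)"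
    using w by (simp flip: \<open>(1 - w) *\<^sub>R explicit_part (x, y, l) = implicit_part (x, y, l)\<close>)
  moreover have "1 < 1 / (1 - w)" using w by simp
  moreover have "(x, y, l) \<noteq> 0" using nz by (auto simp: zero_prod_def)
  ultimately show ?thesis by blast
qed

end

section \<open>Gradients and Hessians\<close>

text \<open>\<open>adjoint f' 1\<close> is the Riesz vector of the derivative, and uniqueness of
  derivatives makes the description in \<open>grad\<close> pick it.\<close>

lemma grad_works:
  fixes f :: "'a::euclidean_space \<Rightarrow> real"
  assumes "f differentiable (at x)"
  shows "(f has_derivative (\<lambda>h. h \<bullet> grad f x)) (at x)"
proof -
  obtain f' where f': "(f has_derivative f') (at x)"
    using assms by (auto simp: differentiable_def)
  have "f' = (\<lambda>h. h \<bullet> adjoint f' 1)"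
    using adjoint_works[OF has_derivative_linear[OF f'], of _ 1] by auto
  then have d: "GDERIV f x :> adjoint f' 1"
    using f' unfolding gderiv_def by simp
  have "d' = adjoint f' 1" if "GDERIV f x :> d'" for d'
  proof -
    have "(\<lambda>h. h \<bullet> d') = (\<lambda>h. h \<bullet> adjoint f' 1)"
      using has_derivative_unique[OF that[unfolded gderiv_def] d[unfolded gderiv_def]] .
    then show ?thesis by (metis inner_commute vector_eq_rdot)
  qed
  then have "grad f x = adjoint f' 1"
    unfolding grad_def by (rule the_equality[of "\<lambda>d. GDERIV f x :> d", OF d])
  then show ?thesis using d unfolding gderiv_def by simp
qed

lemma C2_on_grad:
  assumes "C2_on D f" "x \<in> D"
  shows "(f has_derivative (\<lambda>h. h \<bullet> grad f x)) (at x)"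
  using assms by (intro grad_works) (auto simp: C2_on_def)

lemma C2_on_hessian:
  assumes "C2_on D f" "x \<in> D"
  shows "(grad f has_derivative (*v) (hessian f x)) (at x)"
  using assms jacobian_works[of "grad f" "at x"] by (auto simp: C2_on_def hessian_def)

lemma C2_on_grad_continuous:
  assumes "C2_on D f"
  shows "continuous_on D (grad f)"
  using C2_on_hessian[OF assms] has_derivative_continuous continuous_at_imp_continuous_on by blast

text \<open>Strict differentiability of the gradient: one Hessian serves all pairs of nearby points,
  by the mean value inequality and continuity of the Hessian. Pairs matter because two orbits are
  compared, neither of which is the limit point.\<close>

lemma C2_on_strictly_differentiable:
  fixes f :: "real^'n \<Rightarrow> real"
  assumes f: "C2_on D f" and D: "open D" and x: "x \<in> D" and e: "0 < e"
  shows "\<exists>r>0. ball x r \<subseteq> D \<and> (\<forall>u\<in>ball x r. \<forall>v\<in>ball x r.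
    norm (grad f u - grad f v - hessian f x *v (u - v)) \<le> e * norm (u - v))"
proof -
  \<comment> \<open>Factor by which a bound on all matrix entries turns into a bound on the operator
    norm.\<close>
  define c where "c = real CARD('n) * real CARD('n)"
  have c: "c > 0" by (simp add: c_def)
  have "continuous (at x) (hessian f)"
    using f D x by (auto simp: C2_on_def continuous_on_eq_continuous_at)
  then obtain d where d: "d > 0" "\<And>u. dist u x < d \<Longrightarrow> dist (hessian f u) (hessian f x) < e / c"
    using e c unfolding continuous_at_eps_delta by (metis divide_pos_pos)
  obtain r0 where r0: "r0 > 0" "ball x r0 \<subseteq> D" using D x open_contains_ball by blast
  define r where "r = min d r0"
  have r: "r > 0" "ball x r \<subseteq> D" using d(1) r0 by (auto simp: r_def)
  have bound: "onorm ((*v) (hessian f u) - (*v) (hessian f x)) \<le> e" if "u \<in> ball x r" for u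
  proof -
    have "(*v) (hessian f u) - (*v) (hessian f x) = (*v) (hessian f u - hessian f x)"
      by (auto simp: matrix_vector_mult_diff_rdistrib)
    moreover have "onorm ((*v) (hessian f u - hessian f x)) \<le> c * norm (hessian f u - hessian f x)"
      unfolding c_def
    proof (rule onorm_le_matrix_component)
      fix i j
      show "\<bar>(hessian f u - hessian f x) $ i $ j\<bar> \<le> norm (hessian f u - hessian f x)"
        using component_le_norm_cart[of "(hessian f u - hessian f x) $ i" j]
          Finite_Cartesian_Product.norm_nth_le[of "hessian f u - hessian f x" i] by linarith
    qed
    moreover have "norm (hessian f u - hessian f x) \<le> e / c"
      using d(2)[of u] that by (auto simp: r_def dist_norm norm_minus_commute)
    then have "c * norm (hessian f u - hessian f x) \<le> e"
      using c by (simp add: pos_le_divide_eq mult.commute)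
    ultimately show ?thesis by simp
  qed
  have "norm (grad f u - grad f v - hessian f x *v (u - v)) \<le> e * norm (u - v)"
    if u: "u \<in> ball x r" and v: "v \<in> ball x r" for u v
  proof -
    have "norm (grad f u - grad f v - hessian f x *v (u - v)) \<le> norm (u - v) * e"
    proof (rule differentiable_bound_linearization[where S = "ball x r" and f' = "\<lambda>u. (*v) (hessian f u)"])
      show "v + t *\<^sub>R (u - v) \<in> ball x r" if "t \<in> {0..1}" for t
        using convexD_alt[OF convex_ball v u, of t] that by (simp add: algebra_simps)
      show "(grad f has_derivative (*v) (hessian f u)) (at u within ball x r)" if "u \<in> ball x r" for u
        using C2_on_hessian[OF f] r(2) that has_derivative_at_withinI by blast
      show "onorm ((*v) (hessian f u) - (*v) (hessian f x)) \<le> e" if "u \<in> ball x r" for u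
        using that by (rule bound)
      show "x \<in> ball x r" using r(1) by simp
    qed
    then show ?thesis by (simp add: mult.commute)
  qed
  then show ?thesis using r by blast
qed

text \<open>Schwarz's theorem on mixed second derivatives, for a gradient \<open>g\<close> that is
  strictly differentiable at \<open>x\<close>. Through it the pencil becomes self-adjoint.\<close>

lemma strictly_differentiable_symmetric:
  fixes f :: "'a::euclidean_space \<Rightarrow> real"
  assumes H: "linear H"
    and diff: "\<And>y. y \<in> ball x r \<Longrightarrow> (f has_derivative (\<lambda>h. h \<bullet> g y)) (at y)"
    and strict: "\<And>e. 0 < e \<Longrightarrow> \<exists>r>0. \<forall>u\<in>ball x r. \<forall>v\<in>ball x r.
      norm (g u - g v - H (u - v)) \<le> e * norm (u - v)"
    and r: "0 < r"
  shows "H u \<bullet> v = u \<bullet> H v"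
proof -
  define \<Delta> where "\<Delta> s a b = f (x + s *\<^sub>R a + s *\<^sub>R b) - f (x + s *\<^sub>R a) - f (x + s *\<^sub>R b) + f x" for s :: real and a b
  text \<open>The second difference is symmetric in both increments and, by the mean value theorem
    in direction \<open>a\<close>, close to \<open>s\<^sup>2\<close> times \<open>a \<bullet> H b\<close>.\<close>
  have key: "\<exists>s0>0. \<forall>s. 0 < s \<longrightarrow> s < s0 \<longrightarrow> \<bar>\<Delta> s a b - s\<^sup>2 * (a \<bullet> H b)\<bar> \<le> e * s\<^sup>2" if e: "0 < e" for e a b
  proof -
    define k where "k = norm a * norm b + 1"
    have k: "0 < k" by (simp add: k_def add_nonneg_pos)
    from strict[OF divide_pos_pos[OF e k]]
    obtain r1 where r1: "r1 > 0" "\<forall>u\<in>ball x r1. \<forall>v\<in>ball x r1.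
        norm (g u - g v - H (u - v)) \<le> (e / k) * norm (u - v)"
      by (elim exE conjE)
    \<comment> \<open>Keeps every point \<open>x + t *\<^sub>R a + c *\<^sub>R b\<close> with
      \<open>t\<close> and \<open>c\<close> between 0 and \<open>s\<close> inside both
      balls.\<close>
    define s0 where "s0 = min r r1 / (norm a + norm b + 1)"
    have den: "norm a + norm b + 1 > 0" by (simp add: add_nonneg_pos)
    have s0: "s0 > 0" using r r1(1) den by (simp add: s0_def)
    have "\<bar>\<Delta> s a b - s\<^sup>2 * (a \<bullet> H b)\<bar> \<le> e * s\<^sup>2" if s: "0 < s" "s < s0" for s
    proof -
      have lt: "s * (norm a + norm b + 1) < min r r1"
        using s(2) den by (simp add: s0_def pos_less_divide_eq del: min_less_iff_conj)
      have inb: "x + t *\<^sub>R a + c *\<^sub>R b \<in> ball x r" "x + t *\<^sub>R a + c *\<^sub>R b \<in> ball x r1"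
        if t: "0 \<le> t" "t \<le> s" "0 \<le> c" "c \<le> s" for t c
      proof -
        have "norm (t *\<^sub>R a + c *\<^sub>R b) \<le> t * norm a + c * norm b"
          using t norm_triangle_ineq[of "t *\<^sub>R a" "c *\<^sub>R b"] by simp
        also have "\<dots> \<le> s * norm a + s * norm b"
          using t by (intro add_mono mult_right_mono) auto
        also have "\<dots> < s * (norm a + norm b + 1)" using s(1) by (simp add: algebra_simps)
        also note lt
        finally have "norm (t *\<^sub>R a + c *\<^sub>R b) < min r r1" .
        moreover have "dist x (x + t *\<^sub>R a + c *\<^sub>R b) = norm (t *\<^sub>R a + c *\<^sub>R b)"
          unfolding dist_norm by (metis add.assoc add_diff_cancel_left' norm_minus_commute)
        ultimately show "x + t *\<^sub>R a + c *\<^sub>R b \<in> ball x r" "x + t *\<^sub>R a + c *\<^sub>R b \<in> ball x r1" by auto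
      qed
      \<comment> \<open>The zero multiple of \<open>b\<close> is kept so that both terms have the
        shape covered by \<open>inb\<close> and share one derivative computation.\<close>
      define \<phi> where "\<phi> t = f (x + t *\<^sub>R a + s *\<^sub>R b) - f (x + t *\<^sub>R a + 0 *\<^sub>R b)" for t
      have d\<phi>: "(\<phi> has_derivative (\<lambda>h. (h *\<^sub>R a) \<bullet> (g (x + t *\<^sub>R a + s *\<^sub>R b) - g (x + t *\<^sub>R a + 0 *\<^sub>R b)))) (at t within {0..s})"
        if t: "t \<in> {0..s}" for t
      proof -
        have "((\<lambda>t. f (x + t *\<^sub>R a + c *\<^sub>R b)) has_derivative (\<lambda>h. (h *\<^sub>R a) \<bullet> g (x + t *\<^sub>R a + c *\<^sub>R b))) (at t within {0..s})"
          if "0 \<le> c" "c \<le> s" for c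
        proof (rule has_derivative_compose[where f = "\<lambda>t. x + t *\<^sub>R a + c *\<^sub>R b"])
          show "((\<lambda>t. x + t *\<^sub>R a + c *\<^sub>R b) has_derivative (\<lambda>h. h *\<^sub>R a)) (at t within {0..s})"
            by (auto intro!: derivative_eq_intros)
          show "(f has_derivative (\<lambda>h. h \<bullet> g (x + t *\<^sub>R a + c *\<^sub>R b))) (at (x + t *\<^sub>R a + c *\<^sub>R b))"
            using t that by (intro diff inb(1)) auto
        qed
        from has_derivative_diff[OF this[of s] this[of 0]] s(1) show ?thesis
          unfolding \<phi>_def by (simp add: inner_diff_right)
      qed
      obtain t where t: "t \<in> {0<..<s}"
        "\<phi> s - \<phi> 0 = ((s - 0) *\<^sub>R a) \<bullet> (g (x + t *\<^sub>R a + s *\<^sub>R b) - g (x + t *\<^sub>R a + 0 *\<^sub>R b))"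
        using mvt_simple[OF s(1), of \<phi> "\<lambda>t h. (h *\<^sub>R a) \<bullet> (g (x + t *\<^sub>R a + s *\<^sub>R b) - g (x + t *\<^sub>R a + 0 *\<^sub>R b))"]
          d\<phi> by auto
      define w where "w = g (x + t *\<^sub>R a + s *\<^sub>R b) - g (x + t *\<^sub>R a + 0 *\<^sub>R b) - H (s *\<^sub>R b)"
      have "norm w \<le> (e / k) * norm (s *\<^sub>R b)"
        using r1(2)[rule_format, OF inb(2)[of t s] inb(2)[of t 0]] t(1) s(1) by (simp add: w_def)
      have "\<Delta> s a b = \<phi> s - \<phi> 0" by (simp add: \<Delta>_def \<phi>_def)
      also have "\<dots> = s * (a \<bullet> (w + H (s *\<^sub>R b)))" using t(2) by (simp add: w_def)
      also have "\<dots> = s * (a \<bullet> w) + s\<^sup>2 * (a \<bullet> H b)"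
        by (simp add: linear_cmul[OF H] inner_add_right power2_eq_square algebra_simps)
      finally have "\<bar>\<Delta> s a b - s\<^sup>2 * (a \<bullet> H b)\<bar> = s * \<bar>a \<bullet> w\<bar>" using s(1) by (simp add: abs_mult)
      also have "\<dots> \<le> s * (norm a * ((e / k) * norm (s *\<^sub>R b)))"
      proof (intro mult_left_mono)
        show "\<bar>a \<bullet> w\<bar> \<le> norm a * ((e / k) * norm (s *\<^sub>R b))"
          using Cauchy_Schwarz_ineq2[of a w] mult_left_mono[OF \<open>norm w \<le> _\<close> norm_ge_zero[of a]] by linarith
      qed (use s(1) in simp)
      also have "\<dots> = e * s\<^sup>2 * ((norm a * norm b) / k)" using s(1) by (simp add: power2_eq_square)
      also have "\<dots> \<le> e * s\<^sup>2 * 1"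
        using e k by (intro mult_left_mono) (auto simp: k_def)
      finally show ?thesis by simp
    qed
    then show ?thesis using s0 by blast
  qed
  have "\<bar>u \<bullet> H v - v \<bullet> H u\<bar> \<le> e" if "0 < e" for e
  proof -
    from key[OF half_gt_zero[OF that], of u v]
    obtain s1 where s1: "s1 > 0" "\<forall>s. 0 < s \<longrightarrow> s < s1 \<longrightarrow> \<bar>\<Delta> s u v - s\<^sup>2 * (u \<bullet> H v)\<bar> \<le> (e / 2) * s\<^sup>2"
      by (elim exE conjE)
    from key[OF half_gt_zero[OF that], of v u]
    obtain s2 where s2: "s2 > 0" "\<forall>s. 0 < s \<longrightarrow> s < s2 \<longrightarrow> \<bar>\<Delta> s v u - s\<^sup>2 * (v \<bullet> H u)\<bar> \<le> (e / 2) * s\<^sup>2"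
      by (elim exE conjE)
    define s where "s = min s1 s2 / 2"
    have s: "0 < s" "s < s1" "s < s2" using s1(1) s2(1) by (auto simp: s_def)
    have "\<Delta> s u v = \<Delta> s v u" by (simp add: \<Delta>_def algebra_simps)
    then have "\<bar>s\<^sup>2 * (u \<bullet> H v) - s\<^sup>2 * (v \<bullet> H u)\<bar> \<le> e * s\<^sup>2"
      using s1(2)[rule_format, OF s(1,2)] s2(2)[rule_format, OF s(1,3)] by linarith
    then have "\<bar>u \<bullet> H v - v \<bullet> H u\<bar> * s\<^sup>2 \<le> e * s\<^sup>2"
      unfolding right_diff_distrib[symmetric] abs_mult by (simp add: mult.commute)
    then show ?thesis using s(1) by simp
  qed
  then have "\<bar>u \<bullet> H v - v \<bullet> H u\<bar> \<le> 0" by (rule field_le_epsilon[of _ 0, simplified])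
  then show ?thesis by (simp add: inner_commute)
qed

lemma C2_on_hessian_symmetric:
  fixes f :: "real^'n \<Rightarrow> real"
  assumes f: "C2_on D f" and D: "open D" and x: "x \<in> D"
  shows "(hessian f x *v u) \<bullet> v = u \<bullet> (hessian f x *v v)"
proof -
  obtain r where r: "r > 0" "ball x r \<subseteq> D" using D x open_contains_ball by blast
  show ?thesis
  proof (rule strictly_differentiable_symmetric[where g = "grad f", OF matrix_vector_mul_linear _ _ r(1)])
    show "(f has_derivative (\<lambda>h. h \<bullet> grad f y)) (at y)" if "y \<in> ball x r" for y
      using C2_on_grad[OF f] r(2) that by blast
    show "\<exists>r>0. \<forall>u\<in>ball x r. \<forall>v\<in>ball x r.
        norm (grad f u - grad f v - hessian f x *v (u - v)) \<le> e * norm (u - v)" if "0 < e" for e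
      using C2_on_strictly_differentiable[OF f D x that] by blast
  qed
qed

section \<open>Strong convexity as strong monotonicity of the gradient\<close>

text \<open>Dividing the convexity inequality by \<open>t\<close> and letting \<open>t\<close> tend
  to 0 gives the first-order inequality with constant \<open>m / 2\<close>; adding its copy with
  \<open>x\<close> and \<open>y\<close> exchanged gives \<open>m\<close>.\<close>

lemma strongly_convex_on_grad_monotone:
  fixes h :: "'a::euclidean_space \<Rightarrow> real"
  assumes sc: "strongly_convex_on D h" and diff: "\<And>x. x \<in> D \<Longrightarrow> (h has_derivative (\<lambda>d. d \<bullet> grad h x)) (at x)"
  shows "\<exists>m>0. \<forall>x\<in>D. \<forall>y\<in>D. m * (norm (x - y))\<^sup>2 \<le> (grad h x - grad h y) \<bullet> (x - y)"
proof -
  obtain m where m: "m > 0" "\<And>x y t. x \<in> D \<Longrightarrow> y \<in> D \<Longrightarrow> t \<in> {0..1} \<Longrightarrow>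
      h (t *\<^sub>R x + (1 - t) *\<^sub>R y) \<le> t * h x + (1 - t) * h y - m / 2 * t * (1 - t) * (norm (x - y))\<^sup>2"
    using sc unfolding strongly_convex_on_def by blast
  have first: "(x - y) \<bullet> grad h y \<le> h x - h y - m / 2 * (norm (x - y))\<^sup>2" if x: "x \<in> D" and y: "y \<in> D" for x y
  proof -
    have "((\<lambda>t. h (y + t *\<^sub>R (x - y))) has_derivative (\<lambda>s. (s *\<^sub>R (x - y)) \<bullet> grad h (y + 0 *\<^sub>R (x - y)))) (at (0::real))"
      by (rule has_derivative_compose[where f = "\<lambda>t. y + t *\<^sub>R (x - y)" and g = h])
        (use diff[OF y] in \<open>auto intro!: derivative_eq_intros\<close>)
    then have "((\<lambda>t. h (y + t *\<^sub>R (x - y))) has_field_derivative (x - y) \<bullet> grad h y) (at 0)"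
      unfolding has_field_derivative_def by (simp add: mult_commute_abs)
    then have lim: "((\<lambda>t. (h (y + t *\<^sub>R (x - y)) - h y) / t) \<longlongrightarrow> (x - y) \<bullet> grad h y) (at_right 0)"
      unfolding DERIV_def by (simp add: filterlim_at_split)
    have lim': "((\<lambda>t. h x - h y - m / 2 * (1 - t) * (norm (x - y))\<^sup>2) \<longlongrightarrow>
        h x - h y - m / 2 * (1 - 0) * (norm (x - y))\<^sup>2) (at_right (0::real))"
      by (intro tendsto_intros)
    have "\<forall>\<^sub>F t in at_right (0::real).
        (h (y + t *\<^sub>R (x - y)) - h y) / t \<le> h x - h y - m / 2 * (1 - t) * (norm (x - y))\<^sup>2"
      using eventually_at_right_real[of 0 1, simplified]
    proof eventually_elim
      case (elim t)
      then have t: "0 < t" "t < 1" by auto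
      have "y + t *\<^sub>R (x - y) = t *\<^sub>R x + (1 - t) *\<^sub>R y" by (simp add: algebra_simps)
      then have "h (y + t *\<^sub>R (x - y)) - h y \<le> t * (h x - h y - m / 2 * (1 - t) * (norm (x - y))\<^sup>2)"
        using m(2)[OF x y, of t] t by (simp add: algebra_simps)
      then show ?case using t(1) by (simp add: pos_divide_le_eq mult.commute)
    qed
    from tendsto_le[OF trivial_limit_at_right_real lim' lim this] show ?thesis by simp
  qed
  have "m * (norm (x - y))\<^sup>2 \<le> (grad h x - grad h y) \<bullet> (x - y)" if "x \<in> D" "y \<in> D" for x y
    using first[OF that] first[OF that(2,1)]
    by (simp add: inner_diff_left inner_diff_right inner_commute norm_minus_commute algebra_simps)
  then show ?thesis using m(1) by blast
qed

text \<open>A limit of difference quotients along \<open>v\<close>. Its counterpart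
  \<open>derivative_coercive_imp_monotone\<close> goes back by the mean value theorem; the pair
  allows the curvatures of \<open>h\<close> and \<open>f\<close> to be added at the level of
  Hessians.\<close>

lemma monotone_imp_derivative_coercive:
  fixes G :: "'a::euclidean_space \<Rightarrow> 'a"
  assumes D: "open D" and x: "x \<in> D"
    and mono: "\<And>y. y \<in> D \<Longrightarrow> m * (norm (y - x))\<^sup>2 \<le> (G y - G x) \<bullet> (y - x)"
    and G': "(G has_derivative G') (at x)"
  shows "m * (norm v)\<^sup>2 \<le> v \<bullet> G' v"
proof -
  have lin: "linear G'" using G' by (rule has_derivative_linear)
  have "((\<lambda>t. G (x + t *\<^sub>R v) \<bullet> v) has_derivative (\<lambda>s. G' (s *\<^sub>R v) \<bullet> v)) (at (0::real))"
  proof (rule has_derivative_inner_left)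
    show "((\<lambda>t. G (x + t *\<^sub>R v)) has_derivative (\<lambda>s. G' (s *\<^sub>R v))) (at (0::real))"
      by (rule has_derivative_compose[where f = "\<lambda>t. x + t *\<^sub>R v" and g = G])
        (use G' in \<open>auto intro!: derivative_eq_intros\<close>)
  qed
  then have "((\<lambda>t. G (x + t *\<^sub>R v) \<bullet> v) has_field_derivative G' v \<bullet> v) (at 0)"
    unfolding has_field_derivative_def by (simp add: linear_cmul[OF lin] mult_commute_abs)
  then have lim: "((\<lambda>t. (G (x + t *\<^sub>R v) \<bullet> v - G x \<bullet> v) / t) \<longlongrightarrow> G' v \<bullet> v) (at_right 0)"
    unfolding DERIV_def by (simp add: filterlim_at_split)
  have "((\<lambda>t. x + t *\<^sub>R v) \<longlongrightarrow> x + 0 *\<^sub>R v) (at_right 0)" by (intro tendsto_intros)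
  then have "\<forall>\<^sub>F t in at_right 0. x + t *\<^sub>R v \<in> D"
    using topological_tendstoD[OF _ D] x by simp
  then have "\<forall>\<^sub>F t in at_right 0. m * (norm v)\<^sup>2 \<le> (G (x + t *\<^sub>R v) \<bullet> v - G x \<bullet> v) / t"
    using eventually_at_right_less[of 0]
  proof eventually_elim
    case (elim t)
    have "m * (t\<^sup>2 * (norm v)\<^sup>2) \<le> t * (G (x + t *\<^sub>R v) \<bullet> v - G x \<bullet> v)"
      using mono[OF elim(1)] by (simp add: power_mult_distrib inner_diff_left)
    then have "t * (t * (m * (norm v)\<^sup>2)) \<le> t * (G (x + t *\<^sub>R v) \<bullet> v - G x \<bullet> v)"
      by (simp add: power2_eq_square mult_ac)
    then have "t * (m * (norm v)\<^sup>2) \<le> G (x + t *\<^sub>R v) \<bullet> v - G x \<bullet> v"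
      using elim(2) mult_le_cancel_left_pos by blast
    then show ?case using elim(2) by (simp add: pos_le_divide_eq mult.commute)
  qed
  then have "m * (norm v)\<^sup>2 \<le> G' v \<bullet> v"
    by (rule tendsto_lowerbound[OF lim]) simp
  then show ?thesis by (simp add: inner_commute)
qed

lemma derivative_coercive_imp_monotone:
  fixes G :: "'a::euclidean_space \<Rightarrow> 'a"
  assumes D: "convex D" and x: "x \<in> D" and y: "y \<in> D"
    and G': "\<And>u. u \<in> D \<Longrightarrow> (G has_derivative G' u) (at u)"
    and coer: "\<And>u v. u \<in> D \<Longrightarrow> m * (norm v)\<^sup>2 \<le> v \<bullet> G' u v"
  shows "m * (norm (x - y))\<^sup>2 \<le> (G x - G y) \<bullet> (x - y)"
proof -
  define \<phi> where "\<phi> t = G (y + t *\<^sub>R (x - y)) \<bullet> (x - y)" for t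
  have inD: "y + t *\<^sub>R (x - y) \<in> D" if "t \<in> {0..1}" for t
    using convexD_alt[OF D y x, of t] that by (simp add: algebra_simps)
  have "(\<phi> has_derivative (\<lambda>s. G' (y + t *\<^sub>R (x - y)) (s *\<^sub>R (x - y)) \<bullet> (x - y))) (at t within {0..1})"
    if "t \<in> {0..1}" for t
    unfolding \<phi>_def
  proof (rule has_derivative_inner_left)
    show "((\<lambda>t. G (y + t *\<^sub>R (x - y))) has_derivative (\<lambda>s. G' (y + t *\<^sub>R (x - y)) (s *\<^sub>R (x - y)))) (at t within {0..1})"
      by (rule has_derivative_compose[where f = "\<lambda>t. y + t *\<^sub>R (x - y)" and g = G])
        (use G'[OF inD[OF that]] in \<open>auto intro!: derivative_eq_intros\<close>)
  qed
  then obtain t where t: "t \<in> {0<..<1}" "\<phi> 1 - \<phi> 0 = G' (y + t *\<^sub>R (x - y)) ((1 - 0) *\<^sub>R (x - y)) \<bullet> (x - y)"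
    using mvt_simple[of 0 1 \<phi> "\<lambda>t s. G' (y + t *\<^sub>R (x - y)) (s *\<^sub>R (x - y)) \<bullet> (x - y)"] by auto
  have "m * (norm (x - y))\<^sup>2 \<le> (x - y) \<bullet> G' (y + t *\<^sub>R (x - y)) (x - y)"
    using t(1) by (intro coer inD) auto
  also have "\<dots> = (G x - G y) \<bullet> (x - y)"
    using t(2) by (simp add: \<phi>_def inner_commute inner_diff_left inner_diff_right)
  finally show ?thesis .
qed

lemma strongly_monotone_norm_le:
  assumes "m * (norm (x - y))\<^sup>2 \<le> (p - q) \<bullet> (x - y)" "0 < m"
  shows "norm (x - y) \<le> norm (p - q) / m"
proof (cases "x = y")
  case False
  have "m * (norm (x - y))\<^sup>2 \<le> norm (p - q) * norm (x - y)"
    using assms(1) norm_cauchy_schwarz order_trans by blast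
  then have "m * norm (x - y) \<le> norm (p - q)"
    using False by (simp add: power2_eq_square)
  then show ?thesis using assms(2) by (simp add: pos_le_divide_eq mult.commute)
qed (use assms in simp)

section \<open>Basins of attraction\<close>

text \<open>Gradients are linearised at old and new iterates alike, so the error involves both
  differences. Multiplying by a left inverse of \<open>M\<close> reduces to
  \<open>T = M' \<circ> N\<close>, once the share of the error due to the new difference has been
  absorbed.\<close>

lemma negligible_bounded_invariant_implicit:
  fixes M N :: "'a::euclidean_space \<Rightarrow> 'a"
  assumes M: "linear M" and N: "linear N" and inj: "inj M"
    and e: "N e = \<mu> *\<^sub>R M e" "e \<noteq> 0" and \<mu>: "1 < \<mu>"
  shows "\<exists>\<epsilon>>0. \<forall>W g. bounded W \<longrightarrow> g ` W \<subseteq> W \<longrightarrow>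
    (\<forall>w\<in>W. \<forall>w'\<in>W. norm (M (g w - g w') - N (w - w')) \<le> \<epsilon> * (norm (w - w') + norm (g w - g w'))) \<longrightarrow>
    negligible W"
proof -
  obtain M' where M': "linear M'" "M' \<circ> M = id"
    using linear_injective_left_inverse[OF M inj] by blast
  have M'M: "M' (M v) = v" for v using M'(2) by (metis comp_apply id_apply)
  define T where "T = M' \<circ> N"
  have T: "linear T" unfolding T_def using N M'(1) by (rule linear_compose)
  have Te: "T e = \<mu> *\<^sub>R e" by (simp add: T_def e(1) linear_cmul[OF M'(1)] M'M)
  from negligible_bounded_invariant[OF T Te e(2) \<mu>]
  obtain \<epsilon>0 where \<epsilon>0: "\<epsilon>0 > 0" and neg: "\<forall>W g. bounded W \<longrightarrow> g ` W \<subseteq> W \<longrightarrow>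
      (\<forall>w\<in>W. \<forall>w'\<in>W. norm (g w - g w' - T (w - w')) \<le> \<epsilon>0 * norm (w - w')) \<longrightarrow> negligible W"
    by (elim exE conjE)
  have lb: "\<exists>B>0. \<forall>v. norm (f v) \<le> B * norm v" if "linear f" for f :: "'a \<Rightarrow> 'a"
    using bounded_linear.pos_bounded[of f] that by (simp add: linear_conv_bounded_linear mult.commute)
  obtain K where K: "K > 0" "\<forall>v. norm (M' v) \<le> K * norm v"
    using lb[OF M'(1)] by (elim exE conjE)
  obtain R where R: "R > 0" "\<forall>v. norm (T v) \<le> R * norm v"
    using lb[OF T] by (elim exE conjE)
  \<comment> \<open>The first bound lets at most half of \<open>q\<close> reappear on the right,
    where it is absorbed at the cost of a factor 2; the second keeps what remains below
    \<open>\<epsilon>0\<close>.\<close>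
  define \<epsilon> where "\<epsilon> = min (1 / (2 * K)) (\<epsilon>0 / (2 * K * (1 + R)))"
  have \<epsilon>: "\<epsilon> > 0" "K * \<epsilon> \<le> 1 / 2" "2 * (K * \<epsilon>) * (1 + R) \<le> \<epsilon>0"
  proof -
    show "\<epsilon> > 0" using K(1) R(1) \<epsilon>0 by (simp add: \<epsilon>_def)
    have "\<epsilon> \<le> 1 / (2 * K)" "\<epsilon> \<le> \<epsilon>0 / (2 * K * (1 + R))"
      unfolding \<epsilon>_def by (rule min.cobounded1 min.cobounded2)+
    then show "K * \<epsilon> \<le> 1 / 2" "2 * (K * \<epsilon>) * (1 + R) \<le> \<epsilon>0"
      using K(1) R(1) by (simp_all add: pos_le_divide_eq mult_ac)
  qed
  have "negligible W" if W: "bounded W" "g ` W \<subseteq> W" and est: "\<forall>w\<in>W. \<forall>w'\<in>W.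
      norm (M (g w - g w') - N (w - w')) \<le> \<epsilon> * (norm (w - w') + norm (g w - g w'))" for W g
  proof -
    have "norm (g w - g w' - T (w - w')) \<le> \<epsilon>0 * norm (w - w')" if w: "w \<in> W" "w' \<in> W" for w w'
    proof -
      define d d' where "d = w - w'" and "d' = g w - g w'"
      define q where "q = norm (d' - T d)"
      have "d' - T d = M' (M d' - N d)" by (simp add: linear_diff[OF M'(1)] M'M T_def)
      then have "q \<le> K * norm (M d' - N d)" unfolding q_def using K(2) by metis
      also have "\<dots> \<le> K * (\<epsilon> * (norm d + norm d'))"
        using est w K(1) unfolding d_def d'_def by (intro mult_left_mono) auto
      also have "\<dots> \<le> K * (\<epsilon> * (norm d + (R * norm d + q)))"
      proof -
        have "norm d' \<le> norm (T d) + q" unfolding q_def by (rule norm_triangle_sub)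
        then have "norm d' \<le> R * norm d + q" using R(2)[rule_format, of d] by linarith
        then show ?thesis using K(1) \<epsilon>(1) by (intro mult_left_mono add_left_mono) auto
      qed
      also have "\<dots> = (K * \<epsilon>) * (1 + R) * norm d + (K * \<epsilon>) * q" by (simp add: algebra_simps)
      also have "(K * \<epsilon>) * q \<le> 1 / 2 * q" using \<epsilon>(2) by (intro mult_right_mono) (auto simp: q_def)
      finally have "q \<le> 2 * (K * \<epsilon>) * (1 + R) * norm d" by linarith
      also have "\<dots> \<le> \<epsilon>0 * norm d" using \<epsilon>(3) by (intro mult_right_mono) auto
      finally show ?thesis by (simp add: q_def d_def d'_def)
    qed
    then show ?thesis using neg W by blast
  qed
  then show ?thesis using \<epsilon>(1) by blast
qed

section \<open>Null sets and Borel sets under iteration\<close>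

text \<open>Closeness is measured between images, so the assumption describes the inverse map. It
  already contains injectivity, since equal images have distance 0; the preimage of \<open>N\<close>
  is then a locally Lipschitz image of part of \<open>N\<close>.\<close>

lemma negligible_preimage_of_inverse_Lipschitz:
  fixes g :: "'a::euclidean_space \<Rightarrow> 'a"
  assumes inv: "\<And>z. z \<in> \<Omega> \<Longrightarrow> \<exists>r>0. \<exists>C. \<forall>w\<in>\<Omega>. dist (g w) (g z) < r \<longrightarrow> norm (w - z) \<le> C * norm (g w - g z)"
    and N: "negligible N"
  shows "negligible {z \<in> \<Omega>. g z \<in> N}"
proof -
  have inj: "inj_on g \<Omega>"
  proof (rule inj_onI)
    fix w z assume "w \<in> \<Omega>" "z \<in> \<Omega>" "g w = g z"
    then show "w = z" using inv[of z] by fastforce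
  qed
  let ?V = "{z \<in> \<Omega>. g z \<in> N}"
  have "negligible (the_inv_into \<Omega> g ` g ` ?V)"
  proof (rule negligible_locally_Lipschitz_image)
    show "negligible (g ` ?V)" by (rule negligible_subset[OF N]) auto
    fix x assume "x \<in> g ` ?V"
    then obtain z where z: "z \<in> \<Omega>" "x = g z" by blast
    from inv[OF z(1)] obtain r C where r: "r > 0"
      "\<forall>w\<in>\<Omega>. dist (g w) (g z) < r \<longrightarrow> norm (w - z) \<le> C * norm (g w - g z)" by (elim exE conjE)
    have "norm (the_inv_into \<Omega> g y - the_inv_into \<Omega> g x) \<le> C * norm (y - x)" if "y \<in> g ` ?V \<inter> ball x r" for y
      using that r(2) z by (auto simp: the_inv_into_f_f[OF inj] dist_commute)
    then show "\<exists>T B. open T \<and> x \<in> T \<and>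
        (\<forall>y\<in>g ` ?V \<inter> T. norm (the_inv_into \<Omega> g y - the_inv_into \<Omega> g x) \<le> B * norm (y - x))"
      using r(1) by (intro exI[of _ "ball x r"] exI[of _ C]) auto
  qed auto
  moreover have "the_inv_into \<Omega> g ` g ` ?V = ?V"
    by (force simp: the_inv_into_f_f[OF inj] image_image)
  ultimately show ?thesis by simp
qed

lemma negligible_funpow_preimage:
  fixes g :: "'a::euclidean_space \<Rightarrow> 'a"
  assumes pre: "\<And>N. negligible N \<Longrightarrow> negligible {z \<in> \<Omega>. g z \<in> N}"
    and inv: "g ` \<Omega> \<subseteq> \<Omega>" and N: "negligible N"
  shows "negligible {z \<in> \<Omega>. (g ^^ k) z \<in> N}"
proof (induction k)
  case 0
  show ?case by (rule negligible_subset[OF N]) auto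
next
  case (Suc k)
  have "{z \<in> \<Omega>. (g ^^ Suc k) z \<in> N} = {z \<in> \<Omega>. g z \<in> {z \<in> \<Omega>. (g ^^ k) z \<in> N}}"
    using inv by (auto simp: funpow_swap1)
  then show ?case using pre[OF Suc] by simp
qed

text \<open>A convergent orbit is eventually trapped in a member of a countable cover, so its start
  lies in an iterated preimage of a null set. Only countably many pairs of a member and an iteration
  count occur.\<close>

lemma negligible_basin:
  fixes g :: "'a::euclidean_space \<Rightarrow> 'a"
  assumes pre: "\<And>N. negligible N \<Longrightarrow> negligible {z \<in> \<Omega>. g z \<in> N}"
    and inv: "g ` \<Omega> \<subseteq> \<Omega>"
    and local: "\<And>z. z \<in> S \<Longrightarrow> \<exists>U. open U \<and> z \<in> U \<and> negligible {w \<in> \<Omega>. \<forall>k. (g ^^ k) w \<in> U}"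
  shows "negligible {z0 \<in> \<Omega>. \<exists>z\<in>S. (\<lambda>k. (g ^^ k) z0) \<longlonglongrightarrow> z}"
proof -
  define \<U> where "\<U> = {U. open U \<and> negligible {w \<in> \<Omega>. \<forall>k. (g ^^ k) w \<in> U}}"
  obtain \<V> where \<V>: "\<V> \<subseteq> \<U>" "countable \<V>" "\<Union>\<V> = \<Union>\<U>"
    using Lindelof[of \<U>] by (auto simp: \<U>_def)
  have iter: "(g ^^ k) w \<in> \<Omega>" if "w \<in> \<Omega>" for w k
    using that inv by (induction k) auto
  let ?P = "\<lambda>U k. {z \<in> \<Omega>. (g ^^ k) z \<in> {w \<in> \<Omega>. \<forall>j. (g ^^ j) w \<in> U}}"
  have "{z0 \<in> \<Omega>. \<exists>z\<in>S. (\<lambda>k. (g ^^ k) z0) \<longlonglongrightarrow> z} \<subseteq> (\<Union>U\<in>\<V>. \<Union>k. ?P U k)"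
  proof clarify
    fix z0 z assume z0: "z0 \<in> \<Omega>" and z: "z \<in> S" and lim: "(\<lambda>k. (g ^^ k) z0) \<longlonglongrightarrow> z"
    have "z \<in> \<Union>\<V>" unfolding \<V>(3) using local[OF z] by (auto simp: \<U>_def)
    then obtain U where U: "U \<in> \<V>" "z \<in> U" by blast
    then have "open U" using \<V>(1) by (auto simp: \<U>_def)
    then obtain k where k: "\<forall>j\<ge>k. (g ^^ j) z0 \<in> U"
      using topological_tendstoD[OF lim _ U(2)] by (auto simp: eventually_sequentially)
    have "(g ^^ j) ((g ^^ k) z0) \<in> U" for j
      using k[rule_format, of "j + k"] by (simp add: funpow_add)
    then have "z0 \<in> ?P U k" using z0 iter by blast
    then show "z0 \<in> (\<Union>U\<in>\<V>. \<Union>k. ?P U k)" using U(1) by blast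
  qed
  moreover have "negligible (\<Union>U\<in>\<V>. \<Union>k. ?P U k)"
  proof (rule negligible_countable_Union)
    show "countable ((\<lambda>U. \<Union>k. ?P U k) ` \<V>)" using \<V>(2) by simp
    fix X assume "X \<in> (\<lambda>U. \<Union>k. ?P U k) ` \<V>"
    then obtain U where U: "U \<in> \<V>" "X = (\<Union>k. ?P U k)" by blast
    then have "negligible {w \<in> \<Omega>. \<forall>j. (g ^^ j) w \<in> U}" using \<V>(1) by (auto simp: \<U>_def)
    then have "negligible (?P U k)" for k by (intro negligible_funpow_preimage pre inv)
    then show "negligible X" unfolding U(2) by (intro negligible_countable_Union) auto
  qed
  ultimately show ?thesis using negligible_subset by blast
qed

text \<open>Convergence to a point of \<open>S\<close> means being Cauchy with limit in
  \<open>S\<close>, and both conditions are measurable for a sequence of Borel functions.\<close>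

lemma borel_basin:
  fixes g :: "'a::euclidean_space \<Rightarrow> 'a"
  assumes \<Omega>: "open \<Omega>" and cont: "continuous_on \<Omega> g" and inv: "g ` \<Omega> \<subseteq> \<Omega>"
    and S: "S \<in> sets borel"
  shows "{z0 \<in> \<Omega>. \<exists>z\<in>S. (\<lambda>k. (g ^^ k) z0) \<longlonglongrightarrow> z} \<in> sets borel"
proof -
  \<comment> \<open>The value 0 off \<Omega> makes every iterate a Borel function on the whole
    space.\<close>
  define G where "G k z = (if z \<in> \<Omega> then (g ^^ k) z else 0)" for k z
  have "continuous_on \<Omega> (g ^^ k)" for k
  proof (induction k)
    case (Suc k)
    have "(g ^^ k) ` \<Omega> \<subseteq> \<Omega>" using inv by (induction k) auto
    then show ?case using continuous_on_compose2[OF cont Suc] by (simp add: comp_def)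
  qed (simp add: continuous_on_id)
  then have G[measurable]: "G k \<in> borel_measurable borel" for k
    unfolding G_def using \<Omega> by (intro borel_measurable_continuous_on_if) auto
  have [measurable]: "\<Omega> \<in> sets borel" using \<Omega> by simp
  note S[measurable]
  have "{z0 \<in> \<Omega>. \<exists>z\<in>S. (\<lambda>k. (g ^^ k) z0) \<longlonglongrightarrow> z}
      = \<Omega> \<inter> ({z0 \<in> space borel. Cauchy (\<lambda>k. G k z0)} \<inter> {z0 \<in> space borel. lim (\<lambda>k. G k z0) \<in> S})"
  proof -
    have "(\<exists>z\<in>S. (\<lambda>k. (g ^^ k) z0) \<longlonglongrightarrow> z) \<longleftrightarrow> Cauchy (\<lambda>k. G k z0) \<and> lim (\<lambda>k. G k z0) \<in> S"
      if "z0 \<in> \<Omega>" for z0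
      using that by (auto simp: G_def Cauchy_convergent_iff convergent_LIMSEQ_iff limI convergentI)
    then show ?thesis by auto
  qed
  also have "\<dots> \<in> sets borel" by measurable
  finally show ?thesis .
qed

text \<open>To be read with \<open>R z\<close> as the image of \<open>s z\<close> under a strongly
  monotone map: the solution depends on the right-hand side in a Lipschitz way.\<close>

lemma continuous_on_strongly_monotone_solution:
  fixes R s :: "'b::metric_space \<Rightarrow> 'a::real_inner"
  assumes R: "continuous_on \<Omega> R" and c: "0 < c"
    and mono: "\<And>z w. z \<in> \<Omega> \<Longrightarrow> w \<in> \<Omega> \<Longrightarrow> c * (norm (s z - s w))\<^sup>2 \<le> (R z - R w) \<bullet> (s z - s w)"
  shows "continuous_on \<Omega> s"
  unfolding continuous_on_iff
proof (intro ballI allI impI)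
  fix z and e :: real assume z: "z \<in> \<Omega>" and e: "0 < e"
  from R[unfolded continuous_on_iff, rule_format, OF z mult_pos_pos[OF c e]]
  obtain d where d: "d > 0" "\<forall>w\<in>\<Omega>. dist w z < d \<longrightarrow> dist (R w) (R z) < c * e"
    by blast
  have "dist (s w) (s z) < e" if w: "w \<in> \<Omega>" "dist w z < d" for w
  proof -
    have "dist (s w) (s z) \<le> dist (R w) (R z) / c"
      unfolding dist_norm using mono[OF w(1) z] c by (rule strongly_monotone_norm_le)
    also have "\<dots> < e" using d(2) w c by (simp add: pos_divide_less_eq mult.commute)
    finally show ?thesis .
  qed
  then show "\<exists>d>0. \<forall>w\<in>\<Omega>. dist w z < d \<longrightarrow> dist (s w) (s z) < e" using d(1) by blast
qed

section \<open>The Bregman ADMM step\<close>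

lemma inner_transpose:
  fixes K :: "real^'n^'p"
  shows "d \<bullet> (transpose K *v w) = (K *v d) \<bullet> w"
  using adjoint_works[OF matrix_vector_mul_linear, of d K w] unfolding adjoint_matrix .

lemma norm_matrix_vector_le:
  fixes K :: "real^'n^'p"
  shows "norm (K *v v) \<le> onorm ((*v) K) * norm v"
  by (rule onorm[OF matrix_vector_mul_bounded_linear])

lemma onorm_matrix_nonneg:
  fixes K :: "real^'n^'p"
  shows "0 \<le> onorm ((*v) K)"
  by (rule onorm_pos_le[OF matrix_vector_mul_bounded_linear])

text \<open>Stationarity at a minimiser, which is interior because \<open>D\<close> is open,
  multiplied by \<eta>. The vector \<open>c\<close> collects the other block and \<open>- b\<close>,
  so that one statement serves both updates.\<close>

lemma block_optimality:
  fixes K :: "real^'n^'p" and f h :: "real^'n \<Rightarrow> real"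
  assumes D: "open D" and u: "u \<in> D" and f: "C2_on D f" and h: "C2_on D h" and \<eta>: "0 < \<eta>"
    and min: "\<And>v. v \<in> D \<Longrightarrow>
      f u + l \<bullet> (K *v u + c) + \<rho> / 2 * (norm (K *v u + c))\<^sup>2 + 1 / \<eta> * bregman h u x
      \<le> f v + l \<bullet> (K *v v + c) + \<rho> / 2 * (norm (K *v v + c))\<^sup>2 + 1 / \<eta> * bregman h v x"
  shows "grad h u + \<eta> *\<^sub>R grad f u + \<eta> *\<^sub>R (transpose K *v l) + (\<eta> * \<rho>) *\<^sub>R (transpose K *v (K *v u + c))
    = grad h x"
proof -
  let ?\<phi> = "\<lambda>v. f v + l \<bullet> (K *v v + c) + \<rho> / 2 * ((K *v v + c) \<bullet> (K *v v + c))
    + 1 / \<eta> * (h v - h x - grad h x \<bullet> (v - x))"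
  define w where "w = grad f u + transpose K *v l + \<rho> *\<^sub>R (transpose K *v (K *v u + c))
    + (1 / \<eta>) *\<^sub>R (grad h u - grad h x)"
  note [derivative_intros] = bounded_linear.has_derivative[OF matrix_vector_mul_bounded_linear]
  have "(?\<phi> has_derivative (\<lambda>d. d \<bullet> grad f u + l \<bullet> (K *v d)
      + \<rho> / 2 * ((K *v u + c) \<bullet> (K *v d) + (K *v d) \<bullet> (K *v u + c))
      + 1 / \<eta> * (d \<bullet> grad h u - grad h x \<bullet> d))) (at u)"
    using \<eta> by (auto intro!: derivative_eq_intros C2_on_grad[OF f u] C2_on_grad[OF h u])
  moreover have "(\<lambda>d. d \<bullet> grad f u + l \<bullet> (K *v d)
      + \<rho> / 2 * ((K *v u + c) \<bullet> (K *v d) + (K *v d) \<bullet> (K *v u + c))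
      + 1 / \<eta> * (d \<bullet> grad h u - grad h x \<bullet> d)) = (\<lambda>d. d \<bullet> w)"
  proof
    fix d
    show "d \<bullet> grad f u + l \<bullet> (K *v d)
      + \<rho> / 2 * ((K *v u + c) \<bullet> (K *v d) + (K *v d) \<bullet> (K *v u + c))
      + 1 / \<eta> * (d \<bullet> grad h u - grad h x \<bullet> d) = d \<bullet> w"
      unfolding w_def inner_add_right inner_scaleR_right inner_diff_right inner_transpose
        inner_commute[of l "K *v d"] inner_commute[of "K *v u" "K *v d"] inner_commute[of c "K *v d"]
        inner_commute[of d "grad h x"] inner_add_left by simp
  qed
  ultimately have "(?\<phi> has_derivative (\<lambda>d. d \<bullet> w)) (at u)" by simp
  moreover have "\<forall>v\<in>D. ?\<phi> u \<le> ?\<phi> v"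
    using min by (simp add: bregman_def power2_norm_eq_inner)
  ultimately have "(\<lambda>d. d \<bullet> w) = (\<lambda>d. 0)"
    by (intro differential_zero_maxmin[OF u D]) auto
  then have "w = 0" by (metis inner_eq_zero_iff)
  then have "\<eta> *\<^sub>R w = 0" by simp
  then show ?thesis using \<eta> by (simp add: w_def scaleR_add_right algebra_simps)
qed

lemma C2_on_grad_locally_Lipschitz:
  fixes f :: "real^'n \<Rightarrow> real"
  assumes "C2_on D f" "open D" "x \<in> D"
  shows "\<exists>r>0. \<exists>C\<ge>0. \<forall>u\<in>ball x r. norm (grad f u - grad f x) \<le> C * norm (u - x)"
proof -
  from C2_on_strictly_differentiable[OF assms less_numeral_extra(1)]
  obtain r where r: "r > 0" "\<forall>u\<in>ball x r. \<forall>v\<in>ball x r.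
      norm (grad f u - grad f v - hessian f x *v (u - v)) \<le> 1 * norm (u - v)"
    by (elim exE conjE)
  define C where "C = 1 + onorm ((*v) (hessian f x))"
  have "norm (grad f u - grad f x) \<le> C * norm (u - x)" if "u \<in> ball x r" for u
  proof -
    have "norm (grad f u - grad f x - hessian f x *v (u - x)) \<le> 1 * norm (u - x)"
      using r that by auto
    then show ?thesis
      using norm_triangle_sub[of "grad f u - grad f x" "hessian f x *v (u - x)"]
        norm_matrix_vector_le[of "hessian f x" "u - x"]
      unfolding C_def distrib_right by linarith
  qed
  moreover have "C \<ge> 0" using onorm_matrix_nonneg[of "hessian f x"] by (simp add: C_def)
  ultimately show ?thesis using r(1) by blast
qed

lemma relatively_smooth_onD:
  assumes "relatively_smooth_on D L f h" "x \<in> D"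
  shows "0 \<le> L * (v \<bullet> (hessian h x *v v)) + v \<bullet> (hessian f x *v v)"
  using assms unfolding relatively_smooth_on_def pos_semidef_def
  by (auto simp: matrix_vector_mult_add_rdistrib inner_add_right simp flip: scaleR_matrix_vector_assoc)

text \<open>As \<eta> times \<open>L *\<^sub>R hessian h x + hessian f x\<close> is semidefinite,
  the Hessian of \<open>h\<close> plus \<eta> times that of \<open>f\<close> keeps at least the
  fraction \<open>1 - \<eta> * L\<close> of the former. Hence
  \<open>c = (1 - \<eta> * L) * m\<close>.\<close>

lemma relatively_smooth_coercive:
  fixes f h :: "real^'n \<Rightarrow> real"
  assumes D: "open D" "convex D" and f: "C2_on D f" and h: "C2_on D h"
    and sc: "strongly_convex_on D h" and rs: "relatively_smooth_on D L f h"
    and \<eta>: "0 < \<eta>" "\<eta> * L < 1"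
  shows "\<exists>m>0. \<exists>c>0. (\<forall>x\<in>D. \<forall>v. m * (norm v)\<^sup>2 \<le> v \<bullet> (hessian h x *v v)) \<and>
    (\<forall>x\<in>D. \<forall>y\<in>D. m * (norm (x - y))\<^sup>2 \<le> (grad h x - grad h y) \<bullet> (x - y)) \<and>
    (\<forall>x\<in>D. \<forall>y\<in>D. c * (norm (x - y))\<^sup>2 \<le>
      ((grad h x + \<eta> *\<^sub>R grad f x) - (grad h y + \<eta> *\<^sub>R grad f y)) \<bullet> (x - y))"
proof -
  have "\<exists>m>0. \<forall>x\<in>D. \<forall>y\<in>D. m * (norm (x - y))\<^sup>2 \<le> (grad h x - grad h y) \<bullet> (x - y)"
    by (rule strongly_convex_on_grad_monotone[OF sc]) (rule C2_on_grad[OF h])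
  then obtain m where m: "m > 0"
    and mono: "\<forall>x\<in>D. \<forall>y\<in>D. m * (norm (x - y))\<^sup>2 \<le> (grad h x - grad h y) \<bullet> (x - y)"
    by (elim exE conjE)
  have hess: "m * (norm v)\<^sup>2 \<le> v \<bullet> (hessian h x *v v)" if x: "x \<in> D" for x v
    by (rule monotone_imp_derivative_coercive[OF D(1) x _ C2_on_hessian[OF h x]])
      (rule mono[rule_format, OF _ x])
  define c where "c = (1 - \<eta> * L) * m"
  have c: "c > 0" using m \<eta> by (simp add: c_def)
  have "c * (norm (x - y))\<^sup>2 \<le>
      ((grad h x + \<eta> *\<^sub>R grad f x) - (grad h y + \<eta> *\<^sub>R grad f y)) \<bullet> (x - y)"
    if xy: "x \<in> D" "y \<in> D" for x y
  proof (rule derivative_coercive_imp_monotone[OF D(2) xy])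
    fix u assume u: "u \<in> D"
    show "((\<lambda>x. grad h x + \<eta> *\<^sub>R grad f x) has_derivative
        (\<lambda>v. hessian h u *v v + \<eta> *\<^sub>R (hessian f u *v v))) (at u)"
      by (auto intro!: derivative_eq_intros C2_on_hessian[OF h u] C2_on_hessian[OF f u])
    fix v
    have "0 \<le> \<eta> * (L * (v \<bullet> (hessian h u *v v)) + v \<bullet> (hessian f u *v v))"
      using \<eta>(1) relatively_smooth_onD[OF rs u] by (intro mult_nonneg_nonneg) auto
    moreover have "(1 - \<eta> * L) * (m * (norm v)\<^sup>2) \<le> (1 - \<eta> * L) * (v \<bullet> (hessian h u *v v))"
      using \<eta>(2) hess[OF u] by (intro mult_left_mono) auto
    ultimately show "c * (norm v)\<^sup>2 \<le> v \<bullet> (hessian h u *v v + \<eta> *\<^sub>R (hessian f u *v v))"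
      by (simp add: c_def inner_add_right algebra_simps)
  qed
  with hess mono c show ?thesis
    by (intro exI[where P = "\<lambda>m. 0 < m \<and> (\<exists>c. _ m c)", OF conjI[OF m]] exI[where x = c]) simp
qed

locale badmm =
  fixes A :: "real^'n^'p" and B :: "real^'m^'p" and b :: "real^'p"
    and \<rho> \<eta> L\<^sub>1 L\<^sub>2 :: real
    and D\<^sub>1 :: "(real^'n) set" and D\<^sub>2 :: "(real^'m) set"
    and f\<^sub>1 h\<^sub>1 :: "real^'n \<Rightarrow> real" and f\<^sub>2 h\<^sub>2 :: "real^'m \<Rightarrow> real"
    and \<Omega> :: "((real^'n) \<times> (real^'m) \<times> (real^'p)) set"
  assumes \<rho>: "\<rho> > 0"
    and D: "open D\<^sub>1" "convex D\<^sub>1" "open D\<^sub>2" "convex D\<^sub>2"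
    and C2: "C2_on D\<^sub>1 f\<^sub>1" "C2_on D\<^sub>1 h\<^sub>1" "C2_on D\<^sub>2 f\<^sub>2" "C2_on D\<^sub>2 h\<^sub>2"
    and strongly_convex: "strongly_convex_on D\<^sub>1 h\<^sub>1" "strongly_convex_on D\<^sub>2 h\<^sub>2"
    and rel_smooth: "relatively_smooth_on D\<^sub>1 L\<^sub>1 f\<^sub>1 h\<^sub>1" "relatively_smooth_on D\<^sub>2 L\<^sub>2 f\<^sub>2 h\<^sub>2"
    and \<eta>: "0 < \<eta>" "\<eta> * L\<^sub>1 < 1" "\<eta> * L\<^sub>2 < 1"
    and \<Omega>: "open \<Omega>" "\<Omega> \<subseteq> D\<^sub>1 \<times> D\<^sub>2 \<times> UNIV"
    and well_defined: "badmm_well_defined_on \<Omega> D\<^sub>1 D\<^sub>2 f\<^sub>1 f\<^sub>2 h\<^sub>1 h\<^sub>2 A B b \<rho> \<eta>"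
    and step_in: "badmm_step D\<^sub>1 D\<^sub>2 f\<^sub>1 f\<^sub>2 h\<^sub>1 h\<^sub>2 A B b \<rho> \<eta> ` \<Omega> \<subseteq> \<Omega>"
begin

abbreviation step where
  "step \<equiv> badmm_step D\<^sub>1 D\<^sub>2 f\<^sub>1 f\<^sub>2 h\<^sub>1 h\<^sub>2 A B b \<rho> \<eta>"

abbreviation At where "At \<equiv> (*v) (transpose A)"
abbreviation Bt where "Bt \<equiv> (*v) (transpose B)"

text \<open>Minimisation ends here: existence of minimisers makes \<open>arg_min_on\<close> an
  actual minimiser, and afterwards the step is known only through these equations.\<close>

lemma step_equations:
  assumes z: "(x, y, l) \<in> \<Omega>" and s: "step (x, y, l) = (x', y', l')"
  shows "x \<in> D\<^sub>1" "y \<in> D\<^sub>2" "x' \<in> D\<^sub>1" "y' \<in> D\<^sub>2"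
    and "grad h\<^sub>1 x' + \<eta> *\<^sub>R grad f\<^sub>1 x' + \<eta> *\<^sub>R At l + (\<eta> * \<rho>) *\<^sub>R At (A *v x' + (B *v y - b)) = grad h\<^sub>1 x"
    and "grad h\<^sub>2 y' + \<eta> *\<^sub>R grad f\<^sub>2 y' + \<eta> *\<^sub>R Bt l + (\<eta> * \<rho>) *\<^sub>R Bt (B *v y' + (A *v x' - b)) = grad h\<^sub>2 y"
    and "l' = l + \<rho> *\<^sub>R (A *v x' + B *v y' - b)"
proof -
  let ?X = "x_objective f\<^sub>1 f\<^sub>2 h\<^sub>1 A B b \<rho> \<eta> x y l"
  let ?Y = "y_objective f\<^sub>1 f\<^sub>2 h\<^sub>2 A B b \<rho> \<eta> x' y l"
  show "x \<in> D\<^sub>1" "y \<in> D\<^sub>2" using z \<Omega>(2) by auto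
  have x': "x' = arg_min_on ?X D\<^sub>1" and y': "y' = arg_min_on ?Y D\<^sub>2"
    and l': "l' = l + \<rho> *\<^sub>R (A *v x' + B *v y' - b)"
    using s unfolding badmm_step_def by (auto simp: Let_def)
  show "l' = l + \<rho> *\<^sub>R (A *v x' + B *v y' - b)" by (rule l')
  have "(\<exists>u. is_arg_min ?X (\<lambda>u. u \<in> D\<^sub>1) u) \<and> (\<exists>v. is_arg_min ?Y (\<lambda>v. v \<in> D\<^sub>2) v)"
    using well_defined z unfolding badmm_well_defined_on_def x' Let_def by blast
  then have "is_arg_min ?X (\<lambda>u. u \<in> D\<^sub>1) x'" "is_arg_min ?Y (\<lambda>v. v \<in> D\<^sub>2) y'"
    unfolding x' y' arg_min_on_def arg_min_def by (auto intro: someI_ex)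
  then have min: "x' \<in> D\<^sub>1" "\<And>u. u \<in> D\<^sub>1 \<Longrightarrow> ?X x' \<le> ?X u" "y' \<in> D\<^sub>2" "\<And>v. v \<in> D\<^sub>2 \<Longrightarrow> ?Y y' \<le> ?Y v"
    unfolding is_arg_min_def by (auto simp: not_less)
  show "x' \<in> D\<^sub>1" "y' \<in> D\<^sub>2" by (rule min)+
  show "grad h\<^sub>1 x' + \<eta> *\<^sub>R grad f\<^sub>1 x' + \<eta> *\<^sub>R At l + (\<eta> * \<rho>) *\<^sub>R At (A *v x' + (B *v y - b)) = grad h\<^sub>1 x"
  proof (rule block_optimality[OF D(1) min(1) C2(1,2) \<eta>(1)])
    fix v assume "v \<in> D\<^sub>1"
    from min(2)[OF this] show "f\<^sub>1 x' + l \<bullet> (A *v x' + (B *v y - b)) + \<rho> / 2 * (norm (A *v x' + (B *v y - b)))\<^sup>2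
        + 1 / \<eta> * bregman h\<^sub>1 x' x
      \<le> f\<^sub>1 v + l \<bullet> (A *v v + (B *v y - b)) + \<rho> / 2 * (norm (A *v v + (B *v y - b)))\<^sup>2 + 1 / \<eta> * bregman h\<^sub>1 v x"
      unfolding x_objective_def aug_lagrangian_def add_diff_eq by linarith
  qed
  have swap: "A *v x' + B *v v - b = B *v v + (A *v x' - b)" for v by simp
  show "grad h\<^sub>2 y' + \<eta> *\<^sub>R grad f\<^sub>2 y' + \<eta> *\<^sub>R Bt l + (\<eta> * \<rho>) *\<^sub>R Bt (B *v y' + (A *v x' - b)) = grad h\<^sub>2 y"
  proof (rule block_optimality[OF D(3) min(3) C2(3,4) \<eta>(1)])
    fix v assume "v \<in> D\<^sub>2"
    from min(4)[OF this] show "f\<^sub>2 y' + l \<bullet> (B *v y' + (A *v x' - b)) + \<rho> / 2 * (norm (B *v y' + (A *v x' - b)))\<^sup>2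
        + 1 / \<eta> * bregman h\<^sub>2 y' y
      \<le> f\<^sub>2 v + l \<bullet> (B *v v + (A *v x' - b)) + \<rho> / 2 * (norm (B *v v + (A *v x' - b)))\<^sup>2 + 1 / \<eta> * bregman h\<^sub>2 v y"
      unfolding y_objective_def aug_lagrangian_def swap by linarith
  qed
qed

text \<open>Subtraction removes \<open>b\<close>. The third equation absorbs the penalty into the
  new multiplier and so expresses the change of \<open>grad h\<^sub>2 y\<close> by the new iterate
  alone, which is where inverting the step begins; the first, second and fourth are the ones that
  get linearised.\<close>

lemma step_difference:
  assumes z: "(x, y, l) \<in> \<Omega>" "step (x, y, l) = (x', y', l')"
    and w: "(u, v, k) \<in> \<Omega>" "step (u, v, k) = (u', v', k')"
  shows "grad h\<^sub>1 x - grad h\<^sub>1 u = (grad h\<^sub>1 x' - grad h\<^sub>1 u') + \<eta> *\<^sub>R (grad f\<^sub>1 x' - grad f\<^sub>1 u')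
      + \<eta> *\<^sub>R At (l - k) + (\<eta> * \<rho>) *\<^sub>R At (A *v (x' - u') + B *v (y - v))"
    and "grad h\<^sub>2 y - grad h\<^sub>2 v = (grad h\<^sub>2 y' - grad h\<^sub>2 v') + \<eta> *\<^sub>R (grad f\<^sub>2 y' - grad f\<^sub>2 v')
      + \<eta> *\<^sub>R Bt (l - k) + (\<eta> * \<rho>) *\<^sub>R Bt (A *v (x' - u') + B *v (y' - v'))"
    and "grad h\<^sub>2 y - grad h\<^sub>2 v = (grad h\<^sub>2 y' - grad h\<^sub>2 v') + \<eta> *\<^sub>R (grad f\<^sub>2 y' - grad f\<^sub>2 v')
      + \<eta> *\<^sub>R Bt (l' - k')"
    and "l' - k' = (l - k) + \<rho> *\<^sub>R (A *v (x' - u') + B *v (y' - v'))"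
proof -
  note ez = step_equations(5-7)[OF z] and ew = step_equations(5-7)[OF w]
  show "grad h\<^sub>1 x - grad h\<^sub>1 u = (grad h\<^sub>1 x' - grad h\<^sub>1 u') + \<eta> *\<^sub>R (grad f\<^sub>1 x' - grad f\<^sub>1 u')
      + \<eta> *\<^sub>R At (l - k) + (\<eta> * \<rho>) *\<^sub>R At (A *v (x' - u') + B *v (y - v))"
    unfolding ez(1)[symmetric] ew(1)[symmetric]
    by (simp add: algebra_simps del: transpose_matrix_vector)
  show 2: "grad h\<^sub>2 y - grad h\<^sub>2 v = (grad h\<^sub>2 y' - grad h\<^sub>2 v') + \<eta> *\<^sub>R (grad f\<^sub>2 y' - grad f\<^sub>2 v')
      + \<eta> *\<^sub>R Bt (l - k) + (\<eta> * \<rho>) *\<^sub>R Bt (A *v (x' - u') + B *v (y' - v'))"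
    unfolding ez(2)[symmetric] ew(2)[symmetric]
    by (simp add: algebra_simps del: transpose_matrix_vector)
  show 4: "l' - k' = (l - k) + \<rho> *\<^sub>R (A *v (x' - u') + B *v (y' - v'))"
    unfolding ez(3) ew(3) by (simp add: algebra_simps)
  show "grad h\<^sub>2 y - grad h\<^sub>2 v = (grad h\<^sub>2 y' - grad h\<^sub>2 v') + \<eta> *\<^sub>R (grad f\<^sub>2 y' - grad f\<^sub>2 v')
      + \<eta> *\<^sub>R Bt (l' - k')"
    unfolding 2 4 by (simp add: algebra_simps del: transpose_matrix_vector)
qed

lemma coercive1: "\<exists>m>0. \<exists>c>0. (\<forall>x\<in>D\<^sub>1. \<forall>v. m * (norm v)\<^sup>2 \<le> v \<bullet> (hessian h\<^sub>1 x *v v)) \<and>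
    (\<forall>x\<in>D\<^sub>1. \<forall>y\<in>D\<^sub>1. m * (norm (x - y))\<^sup>2 \<le> (grad h\<^sub>1 x - grad h\<^sub>1 y) \<bullet> (x - y)) \<and>
    (\<forall>x\<in>D\<^sub>1. \<forall>y\<in>D\<^sub>1. c * (norm (x - y))\<^sup>2 \<le>
      ((grad h\<^sub>1 x + \<eta> *\<^sub>R grad f\<^sub>1 x) - (grad h\<^sub>1 y + \<eta> *\<^sub>R grad f\<^sub>1 y)) \<bullet> (x - y))"
  by (rule relatively_smooth_coercive[OF D(1,2) C2(1,2) strongly_convex(1) rel_smooth(1) \<eta>(1,2)])

lemma coercive2: "\<exists>m>0. \<exists>c>0. (\<forall>x\<in>D\<^sub>2. \<forall>v. m * (norm v)\<^sup>2 \<le> v \<bullet> (hessian h\<^sub>2 x *v v)) \<and>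
    (\<forall>x\<in>D\<^sub>2. \<forall>y\<in>D\<^sub>2. m * (norm (x - y))\<^sup>2 \<le> (grad h\<^sub>2 x - grad h\<^sub>2 y) \<bullet> (x - y)) \<and>
    (\<forall>x\<in>D\<^sub>2. \<forall>y\<in>D\<^sub>2. c * (norm (x - y))\<^sup>2 \<le>
      ((grad h\<^sub>2 x + \<eta> *\<^sub>R grad f\<^sub>2 x) - (grad h\<^sub>2 y + \<eta> *\<^sub>R grad f\<^sub>2 y)) \<bullet> (x - y))"
  by (rule relatively_smooth_coercive[OF D(3,4) C2(3,4) strongly_convex(2) rel_smooth(2) \<eta>(1,3)])

text \<open>Each update solves a strongly monotone equation with a continuous right-hand side
  \<open>R\<close>; the penalty adds a further nonnegative square. The \<open>x\<close> update comes
  first because the right-hand side for \<open>y\<close> contains it.\<close>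

lemma continuous_step: "continuous_on \<Omega> step"
proof -
  define X where "X z = fst (step z)" for z
  define Y where "Y z = fst (snd (step z))" for z
  define x y l where "x z = fst z" and "y z = fst (snd z)" and "l z = snd (snd z)"
    for z :: "(real^'n) \<times> (real^'m) \<times> (real^'p)"
  have z_eq: "z = (x z, y z, l z)" for z by (simp add: x_def y_def l_def)
  have step_eq: "step z = (X z, Y z, l z + \<rho> *\<^sub>R (A *v X z + B *v Y z - b))" if "z \<in> \<Omega>" for z
    using step_equations(7)[of "x z" "y z" "l z" "X z" "Y z" "snd (snd (step z))"] that
    by (simp add: X_def Y_def prod_eq_iff flip: z_eq)
  have eqs: "X z \<in> D\<^sub>1" "Y z \<in> D\<^sub>2"
    "grad h\<^sub>1 (X z) + \<eta> *\<^sub>R grad f\<^sub>1 (X z) + \<eta> *\<^sub>R At (l z) + (\<eta> * \<rho>) *\<^sub>R At (A *v X z + (B *v y z - b)) = grad h\<^sub>1 (x z)"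
    "grad h\<^sub>2 (Y z) + \<eta> *\<^sub>R grad f\<^sub>2 (Y z) + \<eta> *\<^sub>R Bt (l z) + (\<eta> * \<rho>) *\<^sub>R Bt (B *v Y z + (A *v X z - b)) = grad h\<^sub>2 (y z)"
    if "z \<in> \<Omega>" for z
  proof -
    have "(x z, y z, l z) \<in> \<Omega>" using that by (simp flip: z_eq)
    moreover have "step (x z, y z, l z) = (X z, Y z, snd (snd (step z)))"
      by (simp add: X_def Y_def flip: z_eq)
    ultimately show "X z \<in> D\<^sub>1" "Y z \<in> D\<^sub>2"
      "grad h\<^sub>1 (X z) + \<eta> *\<^sub>R grad f\<^sub>1 (X z) + \<eta> *\<^sub>R At (l z) + (\<eta> * \<rho>) *\<^sub>R At (A *v X z + (B *v y z - b)) = grad h\<^sub>1 (x z)"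
      "grad h\<^sub>2 (Y z) + \<eta> *\<^sub>R grad f\<^sub>2 (Y z) + \<eta> *\<^sub>R Bt (l z) + (\<eta> * \<rho>) *\<^sub>R Bt (B *v Y z + (A *v X z - b)) = grad h\<^sub>2 (y z)"
      by (rule step_equations)+
  qed
  have bl[continuous_intros]: "continuous_on S (\<lambda>z. K *v \<phi> z)" if "continuous_on S \<phi>"
    for K :: "real^'i^'j" and \<phi> :: "_ \<Rightarrow> real^'i" and S :: "((real^'n) \<times> (real^'m) \<times> (real^'p)) set"
    using bounded_linear.continuous_on[OF matrix_vector_mul_bounded_linear that] .
  have proj[continuous_intros]: "continuous_on \<Omega> x" "continuous_on \<Omega> y" "continuous_on \<Omega> l"
    unfolding x_def y_def l_def by (intro continuous_intros)+
  have xD: "x ` \<Omega> \<subseteq> D\<^sub>1" "y ` \<Omega> \<subseteq> D\<^sub>2" using \<Omega>(2) by (auto simp: x_def y_def)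
  have gh[continuous_intros]: "continuous_on \<Omega> (\<lambda>z. grad h\<^sub>1 (x z))" "continuous_on \<Omega> (\<lambda>z. grad h\<^sub>2 (y z))"
    using continuous_on_compose2[OF C2_on_grad_continuous[OF C2(2)] proj(1) xD(1)]
      continuous_on_compose2[OF C2_on_grad_continuous[OF C2(4)] proj(2) xD(2)] .
  have sq: "(transpose K *v (K *v d)) \<bullet> d = (K *v d) \<bullet> (K *v d)" for K :: "real^'i^'p" and d
    using inner_transpose[of d K "K *v d"] by (simp add: inner_commute del: transpose_matrix_vector)
  have contX[continuous_intros]: "continuous_on \<Omega> X"
  proof -
    define R where "R z = grad h\<^sub>1 (x z) - \<eta> *\<^sub>R At (l z) - (\<eta> * \<rho>) *\<^sub>R At (B *v y z - b)" for z
    obtain c where c: "0 < c" and mono: "\<forall>x\<in>D\<^sub>1. \<forall>y\<in>D\<^sub>1. c * (norm (x - y))\<^sup>2 \<le>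
        ((grad h\<^sub>1 x + \<eta> *\<^sub>R grad f\<^sub>1 x) - (grad h\<^sub>1 y + \<eta> *\<^sub>R grad f\<^sub>1 y)) \<bullet> (x - y)"
      using coercive1 by (elim exE conjE)
    show ?thesis
    proof (rule continuous_on_strongly_monotone_solution[OF _ c])
      show "continuous_on \<Omega> R" unfolding R_def by (intro continuous_intros)
      fix z w assume zw: "z \<in> \<Omega>" "w \<in> \<Omega>"
      have R_eq: "R z = grad h\<^sub>1 (X z) + \<eta> *\<^sub>R grad f\<^sub>1 (X z) + (\<eta> * \<rho>) *\<^sub>R At (A *v X z)" if "z \<in> \<Omega>" for z
        unfolding R_def eqs(3)[OF that, symmetric]
        by (simp add: algebra_simps del: transpose_matrix_vector)
      have "(R z - R w) \<bullet> (X z - X w)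
        = ((grad h\<^sub>1 (X z) + \<eta> *\<^sub>R grad f\<^sub>1 (X z)) - (grad h\<^sub>1 (X w) + \<eta> *\<^sub>R grad f\<^sub>1 (X w))) \<bullet> (X z - X w)
          + (\<eta> * \<rho>) * ((transpose A *v (A *v (X z - X w))) \<bullet> (X z - X w))"
        unfolding R_eq[OF zw(1)] R_eq[OF zw(2)] matrix_vector_mult_diff_distrib
        by (simp add: inner_diff_left inner_add_left algebra_simps del: transpose_matrix_vector)
      moreover have "(\<eta> * \<rho>) * ((transpose A *v (A *v (X z - X w))) \<bullet> (X z - X w)) \<ge> 0"
        unfolding sq using \<eta>(1) \<rho> by simp
      ultimately show "c * (norm (X z - X w))\<^sup>2 \<le> (R z - R w) \<bullet> (X z - X w)"
        using mono[rule_format, OF eqs(1)[OF zw(1)] eqs(1)[OF zw(2)]] by linarith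
    qed
  qed
  have contY[continuous_intros]: "continuous_on \<Omega> Y"
  proof -
    define R where "R z = grad h\<^sub>2 (y z) - \<eta> *\<^sub>R Bt (l z) - (\<eta> * \<rho>) *\<^sub>R Bt (A *v X z - b)" for z
    obtain c where c: "0 < c" and mono: "\<forall>x\<in>D\<^sub>2. \<forall>y\<in>D\<^sub>2. c * (norm (x - y))\<^sup>2 \<le>
        ((grad h\<^sub>2 x + \<eta> *\<^sub>R grad f\<^sub>2 x) - (grad h\<^sub>2 y + \<eta> *\<^sub>R grad f\<^sub>2 y)) \<bullet> (x - y)"
      using coercive2 by (elim exE conjE)
    show ?thesis
    proof (rule continuous_on_strongly_monotone_solution[OF _ c])
      show "continuous_on \<Omega> R" unfolding R_def by (intro continuous_intros)
      fix z w assume zw: "z \<in> \<Omega>" "w \<in> \<Omega>"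
      have R_eq: "R z = grad h\<^sub>2 (Y z) + \<eta> *\<^sub>R grad f\<^sub>2 (Y z) + (\<eta> * \<rho>) *\<^sub>R Bt (B *v Y z)" if "z \<in> \<Omega>" for z
        unfolding R_def eqs(4)[OF that, symmetric]
        by (simp add: algebra_simps del: transpose_matrix_vector)
      have "(R z - R w) \<bullet> (Y z - Y w)
        = ((grad h\<^sub>2 (Y z) + \<eta> *\<^sub>R grad f\<^sub>2 (Y z)) - (grad h\<^sub>2 (Y w) + \<eta> *\<^sub>R grad f\<^sub>2 (Y w))) \<bullet> (Y z - Y w)
          + (\<eta> * \<rho>) * ((transpose B *v (B *v (Y z - Y w))) \<bullet> (Y z - Y w))"
        unfolding R_eq[OF zw(1)] R_eq[OF zw(2)] matrix_vector_mult_diff_distrib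
        by (simp add: inner_diff_left inner_add_left algebra_simps del: transpose_matrix_vector)
      moreover have "(\<eta> * \<rho>) * ((transpose B *v (B *v (Y z - Y w))) \<bullet> (Y z - Y w)) \<ge> 0"
        unfolding sq using \<eta>(1) \<rho> by simp
      ultimately show "c * (norm (Y z - Y w))\<^sup>2 \<le> (R z - R w) \<bullet> (Y z - Y w)"
        using mono[rule_format, OF eqs(2)[OF zw(1)] eqs(2)[OF zw(2)]] by linarith
    qed
  qed
  have "continuous_on \<Omega> (\<lambda>z. (X z, Y z, l z + \<rho> *\<^sub>R (A *v X z + B *v Y z - b)))"
    by (intro continuous_intros)
  then show ?thesis by (rule continuous_on_cong[THEN iffD1, rotated 2]) (simp_all add: step_eq)
qed

end

lemma norm_triple_components:
  fixes a :: "'a::real_normed_vector" and b :: "'b::real_normed_vector" and c :: "'c::real_normed_vector"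
  shows "norm a \<le> norm (a, b, c)" "norm b \<le> norm (a, b, c)" "norm c \<le> norm (a, b, c)"
    and "norm (a, b, c) \<le> norm a + norm b + norm c"
  using norm_fst_le[of a "(b, c)"] norm_snd_le[of "(b, c)" a] norm_fst_le[of b c] norm_snd_le[of c b]
    norm_Pair_le[of a "(b, c)"] norm_Pair_le[of b c]
  by linarith+

context badmm
begin

text \<open>The new iterate determines in turn \<open>grad h\<^sub>2 y\<close>, \<open>l\<close> and \<open>grad h\<^sub>1 x\<close>; strong monotonicity of
  \<open>grad h\<^sub>j\<close> then recovers \<open>y\<close> and \<open>x\<close> with Lipschitz bounds.\<close>

lemma step_inverse_Lipschitz:
  assumes z\<Omega>: "z \<in> \<Omega>"
  shows "\<exists>r>0. \<exists>C. \<forall>w\<in>\<Omega>. dist (step w) (step z) < r \<longrightarrow> norm (w - z) \<le> C * norm (step w - step z)"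
proof -
  obtain x y l where z: "z = (x, y, l)" by (cases z)
  obtain x' y' l' where sz: "step (x, y, l) = (x', y', l')" by (cases "step (x, y, l)")
  note z\<Omega>' = z\<Omega>[unfolded z]
  have inD: "x \<in> D\<^sub>1" "y \<in> D\<^sub>2" "x' \<in> D\<^sub>1" "y' \<in> D\<^sub>2" using step_equations(1-4)[OF z\<Omega>' sz] .
  obtain m1 where m1: "0 < m1" and mono1: "\<forall>x\<in>D\<^sub>1. \<forall>y\<in>D\<^sub>1. m1 * (norm (x - y))\<^sup>2 \<le> (grad h\<^sub>1 x - grad h\<^sub>1 y) \<bullet> (x - y)"
    using coercive1 by (elim exE conjE)
  obtain m2 where m2: "0 < m2" and mono2: "\<forall>x\<in>D\<^sub>2. \<forall>y\<in>D\<^sub>2. m2 * (norm (x - y))\<^sup>2 \<le> (grad h\<^sub>2 x - grad h\<^sub>2 y) \<bullet> (x - y)"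
    using coercive2 by (elim exE conjE)
  obtain r1 k1 where r1: "r1 > 0" "k1 \<ge> 0" "\<forall>u\<in>ball x' r1. norm (grad h\<^sub>1 u - grad h\<^sub>1 x') \<le> k1 * norm (u - x')"
    using C2_on_grad_locally_Lipschitz[OF C2(2) D(1) inD(3)] by (elim exE conjE)
  obtain r2 k2 where r2: "r2 > 0" "k2 \<ge> 0" "\<forall>u\<in>ball x' r2. norm (grad f\<^sub>1 u - grad f\<^sub>1 x') \<le> k2 * norm (u - x')"
    using C2_on_grad_locally_Lipschitz[OF C2(1) D(1) inD(3)] by (elim exE conjE)
  obtain r3 k3 where r3: "r3 > 0" "k3 \<ge> 0" "\<forall>v\<in>ball y' r3. norm (grad h\<^sub>2 v - grad h\<^sub>2 y') \<le> k3 * norm (v - y')"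
    using C2_on_grad_locally_Lipschitz[OF C2(4) D(3) inD(4)] by (elim exE conjE)
  obtain r4 k4 where r4: "r4 > 0" "k4 \<ge> 0" "\<forall>v\<in>ball y' r4. norm (grad f\<^sub>2 v - grad f\<^sub>2 y') \<le> k4 * norm (v - y')"
    using C2_on_grad_locally_Lipschitz[OF C2(3) D(3) inD(4)] by (elim exE conjE)
  \<comment> \<open>A radius on the image side: all gradients on the right of
    \<open>step_difference\<close> are taken at new iterates.\<close>
  define r where "r = min (min r1 r2) (min r3 r4)"
  have r: "r > 0" "r \<le> r1" "r \<le> r2" "r \<le> r3" "r \<le> r4"
    using r1(1) r2(1) r3(1) r4(1) by (auto simp: r_def)
  let ?oA = "onorm ((*v) A)" and ?oB = "onorm ((*v) B)" and ?oAt = "onorm At" and ?oBt = "onorm Bt"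
  \<comment> \<open>These constants are read off from the third, fourth and first equations of
    \<open>step_difference\<close>, in that order, since \<open>Cx\<close> involves both
    \<open>Cy\<close> and \<open>Cl\<close>.\<close>
  define Cy where "Cy = (k3 + \<eta> * k4 + \<eta> * ?oBt) / m2"
  define Cl where "Cl = 1 + \<rho> * (?oA + ?oB)"
  define Cx where "Cx = (k1 + \<eta> * k2 + \<eta> * (?oAt * Cl) + (\<eta> * \<rho>) * (?oAt * (?oA + ?oB * Cy))) / m1"
  have "norm (w - z) \<le> (Cx + Cy + Cl) * norm (step w - step z)"
    if w\<Omega>: "w \<in> \<Omega>" and close: "dist (step w) (step z) < r" for w
  proof -
    obtain u v k where w: "w = (u, v, k)" by (cases w)
    obtain u' v' k' where sw: "step (u, v, k) = (u', v', k')" by (cases "step (u, v, k)")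
    note w\<Omega>' = w\<Omega>[unfolded w]
    have inD': "u \<in> D\<^sub>1" "v \<in> D\<^sub>2" using step_equations(1,2)[OF w\<Omega>' sw] .
    define d where "d = norm (step w - step z)"
    have "step w - step z = (u' - x', v' - y', k' - l')" using sz sw by (simp add: z w)
    then have d: "norm (u' - x') \<le> d" "norm (v' - y') \<le> d" "norm (k' - l') \<le> d"
      unfolding d_def by (simp_all add: norm_triple_components)
    have "d < r" using close by (simp add: d_def dist_norm)
    then have balls: "u' \<in> ball x' r1" "u' \<in> ball x' r2" "v' \<in> ball y' r3" "v' \<in> ball y' r4"
      using d r by (auto simp: dist_norm norm_minus_commute)
    have bound: "norm p \<le> k * d" if "norm p \<le> k * norm q" "norm q \<le> d" "0 \<le> k"
      for p :: "'q::real_normed_vector" and q :: "'r::real_normed_vector" and k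
      using that mult_left_mono[of "norm q" d k] by linarith
    note G = bound[OF r1(3)[rule_format, OF balls(1)] d(1) r1(2)] bound[OF r2(3)[rule_format, OF balls(2)] d(1) r2(2)]
      bound[OF r3(3)[rule_format, OF balls(3)] d(2) r3(2)] bound[OF r4(3)[rule_format, OF balls(4)] d(2) r4(2)]
    have tri3: "norm (p + \<eta> *\<^sub>R q + \<eta> *\<^sub>R s) \<le> norm p + \<eta> * norm q + \<eta> * norm s"
      for p q s :: "'q::real_normed_vector"
      using norm_triangle_ineq[of "p + \<eta> *\<^sub>R q" "\<eta> *\<^sub>R s"] norm_triangle_ineq[of p "\<eta> *\<^sub>R q"] \<eta>(1) by simp
    have matb: "norm (K *v q) \<le> onorm ((*v) K) * (e * d)" if "norm q \<le> e * d" for K :: "real^'i^'j" and q e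
      using norm_matrix_vector_le[of K q] mult_left_mono[OF that onorm_matrix_nonneg[of K]] by linarith
    have vy: "norm (v - y) \<le> Cy * d"
    proof -
      have "norm (v - y) \<le> norm (grad h\<^sub>2 v - grad h\<^sub>2 y) / m2"
        using mono2 inD(2) inD'(2) m2 by (intro strongly_monotone_norm_le) auto
      also have "norm (grad h\<^sub>2 v - grad h\<^sub>2 y) \<le> k3 * d + \<eta> * (k4 * d) + \<eta> * (?oBt * (1 * d))"
        unfolding step_difference(3)[OF w\<Omega>' sw z\<Omega>' sz]
        using \<eta>(1) G(3,4) matb[of "k' - l'" 1 "transpose B"] d(3)
        by (intro order_trans[OF tri3] add_mono mult_left_mono) (auto simp del: transpose_matrix_vector)
      also have "(k3 * d + \<eta> * (k4 * d) + \<eta> * (?oBt * (1 * d))) / m2 = Cy * d"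
        by (simp add: Cy_def algebra_simps)
      finally show ?thesis using m2 by (simp add: divide_right_mono)
    qed
    have kl: "norm (k - l) \<le> Cl * d"
    proof -
      have "k - l = (k' - l') - \<rho> *\<^sub>R (A *v (u' - x') + B *v (v' - y'))"
        using step_difference(4)[OF w\<Omega>' sw z\<Omega>' sz] by simp
      then have "norm (k - l) \<le> norm (k' - l') + \<rho> * norm (A *v (u' - x') + B *v (v' - y'))"
        using norm_triangle_ineq4[of "k' - l'" "\<rho> *\<^sub>R (A *v (u' - x') + B *v (v' - y'))"] \<rho> by simp
      also have "\<dots> \<le> d + \<rho> * (?oA * (1 * d) + ?oB * (1 * d))"
        using \<rho> d matb[of "u' - x'" 1 A] matb[of "v' - y'" 1 B]
        by (intro add_mono mult_left_mono order_trans[OF norm_triangle_ineq]) auto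
      also have "\<dots> = Cl * d" by (simp add: Cl_def algebra_simps)
      finally show ?thesis .
    qed
    have ux: "norm (u - x) \<le> Cx * d"
    proof -
      have "norm (u - x) \<le> norm (grad h\<^sub>1 u - grad h\<^sub>1 x) / m1"
        using mono1 inD(1) inD'(1) m1 by (intro strongly_monotone_norm_le) auto
      also have "norm (grad h\<^sub>1 u - grad h\<^sub>1 x) \<le> (k1 * d + \<eta> * (k2 * d) + \<eta> * (?oAt * (Cl * d)))
          + (\<eta> * \<rho>) * (?oAt * ((?oA + ?oB * Cy) * d))"
      proof -
        have "norm (A *v (u' - x') + B *v (v - y)) \<le> ?oA * (1 * d) + ?oB * (Cy * d)"
          using d matb[of "u' - x'" 1 A] matb[OF vy, of B]
          by (intro order_trans[OF norm_triangle_ineq] add_mono) auto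
        then have "norm (A *v (u' - x') + B *v (v - y)) \<le> (?oA + ?oB * Cy) * d"
          by (simp add: algebra_simps)
        from matb[OF this, of "transpose A"]
        have 1: "norm ((\<eta> * \<rho>) *\<^sub>R At (A *v (u' - x') + B *v (v - y))) \<le> (\<eta> * \<rho>) * (?oAt * ((?oA + ?oB * Cy) * d))"
          using \<eta>(1) \<rho> by (simp add: abs_mult del: transpose_matrix_vector)
        have 2: "norm ((grad h\<^sub>1 u' - grad h\<^sub>1 x') + \<eta> *\<^sub>R (grad f\<^sub>1 u' - grad f\<^sub>1 x') + \<eta> *\<^sub>R At (k - l))
            \<le> k1 * d + \<eta> * (k2 * d) + \<eta> * (?oAt * (Cl * d))"
          using \<eta>(1) G(1,2) matb[OF kl, of "transpose A"]
          by (intro order_trans[OF tri3] add_mono mult_left_mono) (auto simp del: transpose_matrix_vector)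
        show ?thesis
          unfolding step_difference(1)[OF w\<Omega>' sw z\<Omega>' sz]
          by (rule order_trans[OF norm_triangle_ineq add_mono[OF 2 1]])
      qed
      also have "(k1 * d + \<eta> * (k2 * d) + \<eta> * (?oAt * (Cl * d))
          + (\<eta> * \<rho>) * (?oAt * ((?oA + ?oB * Cy) * d))) / m1 = Cx * d"
        by (simp add: Cx_def algebra_simps)
      finally show ?thesis using m1 by (simp add: divide_right_mono)
    qed
    have "norm (w - z) \<le> norm (u - x) + norm (v - y) + norm (k - l)"
      by (simp add: w z norm_triple_components(4))
    also have "\<dots> \<le> (Cx + Cy + Cl) * d" using ux vy kl by (simp add: distrib_right)
    finally show ?thesis by (simp add: d_def)
  qed
  then show ?thesis using r(1) by blast
qed

text \<open>The set of trapped points is bounded and invariant. Once the neighbourhood is small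
  enough for the gradients at old and new iterates, differences of steps on it obey the linearised
  equation within the permitted error.\<close>

lemma negligible_near_strict_saddle:
  assumes z\<Omega>: "z \<in> \<Omega>" and saddle: "strict_saddle_KKT_point f\<^sub>1 f\<^sub>2 A B b z"
  shows "\<exists>U. open U \<and> z \<in> U \<and> negligible {w \<in> \<Omega>. \<forall>k. (step ^^ k) w \<in> U}"
proof -
  obtain x y l where z: "z = (x, y, l)" by (cases z)
  have xy: "x \<in> D\<^sub>1" "y \<in> D\<^sub>2" using z\<Omega> \<Omega>(2) by (auto simp: z)
  obtain dx dy where ker: "A *v dx + B *v dy = 0"
    and neg: "dx \<bullet> (hessian f\<^sub>1 x *v dx) + dy \<bullet> (hessian f\<^sub>2 y *v dy) < 0"
    using saddle by (auto simp: strict_saddle_KKT_point_def z)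
  have pos1: "0 < v \<bullet> (hessian h\<^sub>1 x *v v)" if "v \<noteq> 0" for v
  proof -
    obtain m where "0 < m" and m: "\<forall>x\<in>D\<^sub>1. \<forall>v. m * (norm v)\<^sup>2 \<le> v \<bullet> (hessian h\<^sub>1 x *v v)"
      using coercive1 by (elim exE conjE)
    then have "0 < m * (norm v)\<^sup>2" using that by simp
    then show ?thesis using m[rule_format, OF xy(1), of v] by linarith
  qed
  have pos2: "0 < v \<bullet> (hessian h\<^sub>2 y *v v)" if "v \<noteq> 0" for v
  proof -
    obtain m where "0 < m" and m: "\<forall>x\<in>D\<^sub>2. \<forall>v. m * (norm v)\<^sup>2 \<le> v \<bullet> (hessian h\<^sub>2 x *v v)"
      using coercive2 by (elim exE conjE)
    then have "0 < m * (norm v)\<^sup>2" using that by simp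
    then show ?thesis using m[rule_format, OF xy(2), of v] by linarith
  qed
  interpret S: linear_badmm "(*v) (hessian h\<^sub>1 x)" "(*v) (hessian f\<^sub>1 x)" "(*v) (hessian h\<^sub>2 y)"
    "(*v) (hessian f\<^sub>2 y)" "(*v) A" "(*v) B" \<eta> \<rho> L\<^sub>1 L\<^sub>2
    by (rule linear_badmm.intro)
      (fact matrix_vector_mul_linear C2_on_hessian_symmetric[OF C2(1) D(1) xy(1)]
        C2_on_hessian_symmetric[OF C2(2) D(1) xy(1)] C2_on_hessian_symmetric[OF C2(3) D(3) xy(2)]
        C2_on_hessian_symmetric[OF C2(4) D(3) xy(2)] pos1 pos2
        relatively_smooth_onD[OF rel_smooth(1) xy(1)] relatively_smooth_onD[OF rel_smooth(2) xy(2)]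
        \<eta> \<rho>)+
  from S.unstable_eigenvector[OF ker neg]
  obtain \<mu> e where \<mu>: "1 < \<mu>" and e: "e \<noteq> 0" "S.explicit_part e = \<mu> *\<^sub>R S.implicit_part e"
    by (elim exE conjE)
  from negligible_bounded_invariant_implicit[OF S.linear_implicit_part S.linear_explicit_part
      S.inj_implicit_part e(2,1) \<mu>]
  obtain \<epsilon> where \<epsilon>: "0 < \<epsilon>" and negl: "\<forall>W g. bounded W \<longrightarrow> g ` W \<subseteq> W \<longrightarrow>
    (\<forall>w\<in>W. \<forall>w'\<in>W. norm (S.implicit_part (g w - g w') - S.explicit_part (w - w'))
      \<le> \<epsilon> * (norm (w - w') + norm (g w - g w'))) \<longrightarrow> negligible W"
    by (elim exE conjE)
  \<comment> \<open>The \<open>x\<close> and \<open>y\<close> rows each contribute an error factor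
    \<open>\<delta> * (1 + \<eta>)\<close>, and two of these make up \<epsilon>.\<close>
  define \<delta> where "\<delta> = \<epsilon> / 2 / (1 + \<eta>)"
  have "\<delta> * (1 + \<eta>) = \<epsilon> / 2"
    by (rule nonzero_eq_divide_eq[THEN iffD1, OF _ \<delta>_def]) (use \<eta>(1) in simp)
  then have \<delta>2: "2 * (\<delta> * (1 + \<eta>)) = \<epsilon>" by linarith
  have \<delta>: "0 < \<delta>" using \<epsilon> \<eta>(1) by (simp add: \<delta>_def)
  obtain r1 where r1: "r1 > 0" "\<forall>u\<in>ball x r1. \<forall>v\<in>ball x r1.
      norm (grad h\<^sub>1 u - grad h\<^sub>1 v - hessian h\<^sub>1 x *v (u - v)) \<le> \<delta> * norm (u - v)"
    using C2_on_strictly_differentiable[OF C2(2) D(1) xy(1) \<delta>] by (elim exE conjE)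
  obtain r2 where r2: "r2 > 0" "\<forall>u\<in>ball x r2. \<forall>v\<in>ball x r2.
      norm (grad f\<^sub>1 u - grad f\<^sub>1 v - hessian f\<^sub>1 x *v (u - v)) \<le> \<delta> * norm (u - v)"
    using C2_on_strictly_differentiable[OF C2(1) D(1) xy(1) \<delta>] by (elim exE conjE)
  obtain r3 where r3: "r3 > 0" "\<forall>u\<in>ball y r3. \<forall>v\<in>ball y r3.
      norm (grad h\<^sub>2 u - grad h\<^sub>2 v - hessian h\<^sub>2 y *v (u - v)) \<le> \<delta> * norm (u - v)"
    using C2_on_strictly_differentiable[OF C2(4) D(3) xy(2) \<delta>] by (elim exE conjE)
  obtain r4 where r4: "r4 > 0" "\<forall>u\<in>ball y r4. \<forall>v\<in>ball y r4.
      norm (grad f\<^sub>2 u - grad f\<^sub>2 v - hessian f\<^sub>2 y *v (u - v)) \<le> \<delta> * norm (u - v)"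
    using C2_on_strictly_differentiable[OF C2(3) D(3) xy(2) \<delta>] by (elim exE conjE)
  \<comment> \<open>The equations are affine in the multiplier, so no smallness is required of the
    last ball, only boundedness.\<close>
  define U where "U = ball x (min r1 r2) \<times> ball y (min r3 r4) \<times> ball l 1"
  have U: "open U" "z \<in> U" "bounded U"
    using r1(1) r2(1) r3(1) r4(1) by (auto simp: U_def z open_Times bounded_Times)
  define W where "W = {w \<in> \<Omega>. \<forall>k. (step ^^ k) w \<in> U}"
  have W: "w \<in> \<Omega>" "w \<in> U" "step w \<in> U" if "w \<in> W" for w
  proof -
    have "(step ^^ 0) w \<in> U" "(step ^^ 1) w \<in> U" using that unfolding W_def by blast+
    then show "w \<in> U" "step w \<in> U" by simp_all
  qed (use that in \<open>simp add: W_def\<close>)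
  have "bounded W" by (rule bounded_subset[OF U(3)]) (use W(2) in blast)
  moreover have "step ` W \<subseteq> W"
  proof (rule image_subsetI)
    fix w assume w: "w \<in> W"
    have "(step ^^ k) (step w) \<in> U" for k
    proof -
      have "(step ^^ Suc k) w \<in> U" using w unfolding W_def by blast
      then show ?thesis by (simp add: funpow_swap1)
    qed
    then show "step w \<in> W" using step_in w unfolding W_def by blast
  qed
  moreover have "norm (S.implicit_part (step w1 - step w2) - S.explicit_part (w1 - w2))
      \<le> \<epsilon> * (norm (w1 - w2) + norm (step w1 - step w2))" if w1: "w1 \<in> W" and w2: "w2 \<in> W" for w1 w2
  proof -
    obtain x1 y1 l1 where w1_eq: "w1 = (x1, y1, l1)" by (cases w1)
    obtain x2 y2 l2 where w2_eq: "w2 = (x2, y2, l2)" by (cases w2)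
    obtain x1' y1' l1' where s1: "step (x1, y1, l1) = (x1', y1', l1')" by (cases "step (x1, y1, l1)")
    obtain x2' y2' l2' where s2: "step (x2, y2, l2) = (x2', y2', l2')" by (cases "step (x2, y2, l2)")
    note sd = step_difference[OF W(1)[OF w1, unfolded w1_eq] s1 W(1)[OF w2, unfolded w2_eq] s2]
    have inU: "x1 \<in> ball x r1" "x2 \<in> ball x r1" "x1' \<in> ball x r1" "x2' \<in> ball x r1"
      "x1' \<in> ball x r2" "x2' \<in> ball x r2" "y1 \<in> ball y r3" "y2 \<in> ball y r3" "y1' \<in> ball y r3"
      "y2' \<in> ball y r3" "y1' \<in> ball y r4" "y2' \<in> ball y r4"
      using W(2,3)[OF w1] W(2,3)[OF w2] by (simp_all add: U_def w1_eq w2_eq s1 s2)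
    define n n' where "n = norm (w1 - w2)" and "n' = norm (step w1 - step w2)"
    have nn: "norm (x1 - x2) \<le> n" "norm (y1 - y2) \<le> n" "norm (x1' - x2') \<le> n'" "norm (y1' - y2') \<le> n'"
      by (simp_all add: n_def n'_def w1_eq w2_eq s1 s2 norm_triple_components)
    have lin: "norm p \<le> \<delta> * e" if "norm p \<le> \<delta> * norm q" "norm q \<le> e"
      for p :: "'q::real_normed_vector" and q :: "'r::real_normed_vector" and e
      using that mult_left_mono[of "norm q" e \<delta>] \<delta> by linarith
    define a1 a2 a3 where "a1 = grad h\<^sub>1 x1 - grad h\<^sub>1 x2 - hessian h\<^sub>1 x *v (x1 - x2)"
      and "a2 = grad h\<^sub>1 x1' - grad h\<^sub>1 x2' - hessian h\<^sub>1 x *v (x1' - x2')"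
      and "a3 = grad f\<^sub>1 x1' - grad f\<^sub>1 x2' - hessian f\<^sub>1 x *v (x1' - x2')"
    define b1 b2 b3 where "b1 = grad h\<^sub>2 y1 - grad h\<^sub>2 y2 - hessian h\<^sub>2 y *v (y1 - y2)"
      and "b2 = grad h\<^sub>2 y1' - grad h\<^sub>2 y2' - hessian h\<^sub>2 y *v (y1' - y2')"
      and "b3 = grad f\<^sub>2 y1' - grad f\<^sub>2 y2' - hessian f\<^sub>2 y *v (y1' - y2')"
    have a: "norm a1 \<le> \<delta> * n" "norm a2 \<le> \<delta> * n'" "norm a3 \<le> \<delta> * n'"
      unfolding a1_def a2_def a3_def
      using lin[OF r1(2)[rule_format, OF inU(1,2)] nn(1)] lin[OF r1(2)[rule_format, OF inU(3,4)] nn(3)]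
        lin[OF r2(2)[rule_format, OF inU(5,6)] nn(3)] .
    have b: "norm b1 \<le> \<delta> * n" "norm b2 \<le> \<delta> * n'" "norm b3 \<le> \<delta> * n'"
      unfolding b1_def b2_def b3_def
      using lin[OF r3(2)[rule_format, OF inU(7,8)] nn(2)] lin[OF r3(2)[rule_format, OF inU(9,10)] nn(4)]
        lin[OF r4(2)[rule_format, OF inU(11,12)] nn(4)] .
    \<comment> \<open>All linear terms cancel and only the linearisation errors of the gradients
      remain; the multiplier row is exact.\<close>
    have "S.implicit_part (step w1 - step w2) - S.explicit_part (w1 - w2)
        = (a1 - a2 - \<eta> *\<^sub>R a3, b1 - b2 - \<eta> *\<^sub>R b3, 0)"
      unfolding w1_eq w2_eq s1 s2 S.implicit_part_def S.explicit_part_def adjoint_matrix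
        a1_def a2_def a3_def b1_def b2_def b3_def diff_Pair prod.case sd(1) sd(2) sd(4)
      by (simp add: algebra_simps del: transpose_matrix_vector)
    moreover have tri: "norm (p1 - p2 - \<eta> *\<^sub>R p3) \<le> \<delta> * (1 + \<eta>) * (n + n')"
      if "norm p1 \<le> \<delta> * n" "norm p2 \<le> \<delta> * n'" "norm p3 \<le> \<delta> * n'" for p1 p2 p3 :: "'q::real_normed_vector"
    proof -
      have "norm (p1 - p2 - \<eta> *\<^sub>R p3) \<le> norm p1 + norm p2 + \<eta> * norm p3"
        using norm_triangle_ineq4[of "p1 - p2" "\<eta> *\<^sub>R p3"] norm_triangle_ineq4[of p1 p2] \<eta>(1) by simp
      also have "\<dots> \<le> \<delta> * n + \<delta> * n' + \<eta> * (\<delta> * n')"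
        using that \<eta>(1) by (intro add_mono mult_left_mono) auto
      also have "\<dots> \<le> \<delta> * (1 + \<eta>) * (n + n')"
      proof -
        have "0 \<le> \<eta> * (\<delta> * n)" using \<eta>(1) \<delta> by (simp add: n_def)
        then show ?thesis by (simp add: algebra_simps)
      qed
      finally show ?thesis .
    qed
    ultimately have "norm (S.implicit_part (step w1 - step w2) - S.explicit_part (w1 - w2))
        \<le> \<delta> * (1 + \<eta>) * (n + n') + \<delta> * (1 + \<eta>) * (n + n')"
      using norm_triple_components(4)[of "a1 - a2 - \<eta> *\<^sub>R a3" "b1 - b2 - \<eta> *\<^sub>R b3" "0 :: real^'p"]
        tri[OF a] tri[OF b] by simp
    also have "\<dots> = 2 * (\<delta> * (1 + \<eta>)) * (n + n')" by simp
    also have "\<dots> = \<epsilon> * (n + n')" unfolding \<delta>2 ..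
    finally show ?thesis by (simp add: n_def n'_def)
  qed
  ultimately have "negligible W" using negl by blast
  then show ?thesis using U(1,2) unfolding W_def by blast
qed

section \<open>Measurability and conclusion\<close>

text \<open>The KKT equations cut out a relatively closed set. The curvature condition is a union
  over uncountably many feasible directions, but each member is open by continuity of the Hessians,
  so the union is open.\<close>

lemma borel_strict_saddles: "{z \<in> \<Omega>. strict_saddle_KKT_point f\<^sub>1 f\<^sub>2 A B b z} \<in> sets borel"
proof -
  have bl[continuous_intros]: "continuous_on S (\<lambda>z. K *v \<phi> z)" if "continuous_on S \<phi>"
    for K :: "real^'i^'j" and \<phi> :: "_ \<Rightarrow> real^'i" and S :: "((real^'n) \<times> (real^'m) \<times> (real^'p)) set"
    using bounded_linear.continuous_on[OF matrix_vector_mul_bounded_linear that] .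
  have proj[continuous_intros]: "continuous_on \<Omega> fst" "continuous_on \<Omega> (\<lambda>z. fst (snd z))" "continuous_on \<Omega> (\<lambda>z. snd (snd z))"
    by (intro continuous_intros)+
  have inD: "fst ` \<Omega> \<subseteq> D\<^sub>1" "(\<lambda>z. fst (snd z)) ` \<Omega> \<subseteq> D\<^sub>2" using \<Omega>(2) by auto
  have gf[continuous_intros]: "continuous_on \<Omega> (\<lambda>z. grad f\<^sub>1 (fst z))" "continuous_on \<Omega> (\<lambda>z. grad f\<^sub>2 (fst (snd z)))"
    using continuous_on_compose2[OF C2_on_grad_continuous[OF C2(1)] proj(1) inD(1)]
      continuous_on_compose2[OF C2_on_grad_continuous[OF C2(3)] proj(2) inD(2)] .
  have ch: "continuous_on D\<^sub>1 (hessian f\<^sub>1)" "continuous_on D\<^sub>2 (hessian f\<^sub>2)"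
    using C2(1,3) by (simp_all add: C2_on_def)
  have hf: "continuous_on \<Omega> (\<lambda>z. hessian f\<^sub>1 (fst z))" "continuous_on \<Omega> (\<lambda>z. hessian f\<^sub>2 (fst (snd z)))"
    using continuous_on_compose2[OF ch(1) proj(1) inD(1)] continuous_on_compose2[OF ch(2) proj(2) inD(2)] .
  have mv: "continuous_on \<Omega> (\<lambda>z. F z *v d)" if "continuous_on \<Omega> F"
    for F :: "(real^'n) \<times> (real^'m) \<times> (real^'p) \<Rightarrow> real^'i^'j" and d
    unfolding matrix_vector_mult_def by (intro continuous_intros that)
  define R where "R z = (A *v fst z + B *v fst (snd z) - b,
      grad f\<^sub>1 (fst z) + At (snd (snd z)), grad f\<^sub>2 (fst (snd z)) + Bt (snd (snd z)))" for z
  have "continuous_on \<Omega> R" unfolding R_def by (intro continuous_intros)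
  then have "closedin (top_of_set \<Omega>) (\<Omega> \<inter> R -` {0})"
    by (rule continuous_closedin_preimage) simp
  then obtain T where T: "closed T" "\<Omega> \<inter> R -` {0} = \<Omega> \<inter> T" by (auto simp: closedin_closed)
  define q where "q = (\<lambda>(dx, dy) (z :: (real^'n) \<times> (real^'m) \<times> (real^'p)). dx \<bullet> (hessian f\<^sub>1 (fst z) *v dx) + dy \<bullet> (hessian f\<^sub>2 (fst (snd z)) *v dy))"
  have "continuous_on \<Omega> (q d)" for d
    unfolding q_def case_prod_unfold by (intro continuous_intros mv hf)
  then have "open (\<Omega> \<inter> q d -` {..<0})" for d
    using \<Omega>(1) by (intro continuous_open_preimage) auto
  then have "open (\<Union>d\<in>{(dx, dy). A *v dx + B *v dy = 0}. \<Omega> \<inter> q d -` {..<0})" by blast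
  moreover have "{z \<in> \<Omega>. strict_saddle_KKT_point f\<^sub>1 f\<^sub>2 A B b z}
      = (\<Omega> \<inter> T) \<inter> (\<Union>d\<in>{(dx, dy). A *v dx + B *v dy = 0}. \<Omega> \<inter> q d -` {..<0})"
    unfolding T(2)[symmetric]
    by (auto simp: strict_saddle_KKT_point_def KKT_point_def R_def q_def zero_prod_def simp del: transpose_matrix_vector) blast
  ultimately show ?thesis using T(1) \<Omega>(1) by auto
qed

lemma null_set_strict_saddle_basin:
  "{z0 \<in> \<Omega>. \<exists>z\<in>\<Omega>. strict_saddle_KKT_point f\<^sub>1 f\<^sub>2 A B b z \<and> (\<lambda>k. (step ^^ k) z0) \<longlonglongrightarrow> z} \<in> null_sets lborel"
proof -
  let ?S = "{z \<in> \<Omega>. strict_saddle_KKT_point f\<^sub>1 f\<^sub>2 A B b z}"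
  let ?X = "{z0 \<in> \<Omega>. \<exists>z\<in>?S. (\<lambda>k. (step ^^ k) z0) \<longlonglongrightarrow> z}"
  have "negligible ?X"
  proof (rule negligible_basin)
    show "negligible {z \<in> \<Omega>. step z \<in> N}" if "negligible N" for N
      by (rule negligible_preimage_of_inverse_Lipschitz[OF step_inverse_Lipschitz that])
    show "\<exists>U. open U \<and> z \<in> U \<and> negligible {w \<in> \<Omega>. \<forall>k. (step ^^ k) w \<in> U}" if "z \<in> ?S" for z
      using that by (intro negligible_near_strict_saddle) auto
  qed (rule step_in)
  moreover have "?X \<in> sets lborel"
    using borel_basin[OF \<Omega>(1) continuous_step step_in borel_strict_saddles] by simp
  \<comment> \<open>\<open>negligible\<close> refers to the completed measure; Borel measurability
    brings the set down to \<open>lborel\<close>, the form that absolute continuity transfers to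
    \<open>M\<close>.\<close>
  ultimately have "?X \<in> null_sets lborel"
    by (simp add: negligible_iff_null_sets null_sets_completion_iff)
  moreover have "?X = {z0 \<in> \<Omega>. \<exists>z\<in>\<Omega>. strict_saddle_KKT_point f\<^sub>1 f\<^sub>2 A B b z \<and> (\<lambda>k. (step ^^ k) z0) \<longlonglongrightarrow> z}"
    by blast
  ultimately show ?thesis by simp
qed

end

theorem theorem3p1:
  fixes A :: "real^'n^'p" and B :: "real^'m^'p" and b :: "real^'p"
    and \<rho> \<eta> L\<^sub>1 L\<^sub>2 :: real
    and D\<^sub>1 :: "(real^'n) set" and D\<^sub>2 :: "(real^'m) set"
    and f\<^sub>1 h\<^sub>1 :: "real^'n \<Rightarrow> real" and f\<^sub>2 h\<^sub>2 :: "real^'m \<Rightarrow> real"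
    and \<Omega> :: "((real^'n) \<times> (real^'m) \<times> (real^'p)) set"
    and M :: "((real^'n) \<times> (real^'m) \<times> (real^'p)) measure"
  assumes "\<rho> > 0"
    and "D\<^sub>1 \<noteq> {}" "open D\<^sub>1" "convex D\<^sub>1"
    and "D\<^sub>2 \<noteq> {}" "open D\<^sub>2" "convex D\<^sub>2"
    and "C2_on D\<^sub>1 f\<^sub>1" "C2_on D\<^sub>1 h\<^sub>1" "C2_on D\<^sub>2 f\<^sub>2" "C2_on D\<^sub>2 h\<^sub>2"
    and "strongly_convex_on D\<^sub>1 h\<^sub>1" "strongly_convex_on D\<^sub>2 h\<^sub>2"
    and "L\<^sub>1 > 0" "relatively_smooth_on D\<^sub>1 L\<^sub>1 f\<^sub>1 h\<^sub>1"
    and "L\<^sub>2 > 0" "relatively_smooth_on D\<^sub>2 L\<^sub>2 f\<^sub>2 h\<^sub>2"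
    and "0 < \<eta>" "\<eta> < min (1 / L\<^sub>1) (1 / L\<^sub>2)"
    and "open \<Omega>" "\<Omega> \<subseteq> D\<^sub>1 \<times> D\<^sub>2 \<times> UNIV"
    and "badmm_well_defined_on \<Omega> D\<^sub>1 D\<^sub>2 f\<^sub>1 f\<^sub>2 h\<^sub>1 h\<^sub>2 A B b \<rho> \<eta>"
    and "badmm_step D\<^sub>1 D\<^sub>2 f\<^sub>1 f\<^sub>2 h\<^sub>1 h\<^sub>2 A B b \<rho> \<eta> ` \<Omega> \<subseteq> \<Omega>"
    and "prob_space M" "sets M = sets borel" "measure M \<Omega> = 1"
    and "absolutely_continuous lborel M"
  shows "{z0 \<in> \<Omega>. \<exists>z \<in> \<Omega>. strict_saddle_KKT_point f\<^sub>1 f\<^sub>2 A B b z \<and>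
            (\<lambda>k. (badmm_step D\<^sub>1 D\<^sub>2 f\<^sub>1 f\<^sub>2 h\<^sub>1 h\<^sub>2 A B b \<rho> \<eta> ^^ k) z0) \<longlonglongrightarrow> z} \<in> null_sets M"
proof -
  have "\<eta> * L\<^sub>1 < 1" "\<eta> * L\<^sub>2 < 1"
    using assms(14,16,19) by (simp_all add: pos_less_divide_eq)
  then interpret badmm A B b \<rho> \<eta> L\<^sub>1 L\<^sub>2 D\<^sub>1 D\<^sub>2 f\<^sub>1 h\<^sub>1 f\<^sub>2 h\<^sub>2 \<Omega>
    using assms by unfold_locales
  show ?thesis
    using null_set_strict_saddle_basin assms(27) unfolding absolutely_continuous_def by blast
qed

end
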